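(* Let $(\mathcal F_0,\mathbf a)$ be initial data for the completion problem in $\mathbb C^d$, let $\lambda=\lambda(S_{\mathcal F_0})$, and let $f:[0,\infty)\to[0,\infty)$ be a strictly convex function. Then: (1) There exists a vector $\mu=\mu(\lambda,\mathbf a,f)\in\Gamma_d(\mathbf a)$ such that $\mathcal F=(\mathcal F_0,\mathcal G)\in\mathcal C_{\mathbf a}(\mathcal F_0)$ is a global minimizer of $P_f$ on $\mathcal C_{\mathbf a}(\mathcal F_0)$ if and only if $\mathcal F\in\mathcal C_{\mathbf a}^{\rm op}(\mathcal F_0)$ and $\lambda^\uparrow(S_{\mathcal G})=\mu$. Assume now that $\mathcal F=(\mathcal F_0,\mathcal G)=\{f_i\}_{i=1}^n$ is a global minimizer of $P_f$ on $\mathcal C_{\mathbf a}^{\rm op}(\mathcal F_0)$, and let $\{\mathcal G_i\}_{i=1}^p$ be a partition of $\mathcal G$ into irreducible subsequences, where $\mathcal G_i=\{f_j\}_{j\in J_i}$ for a partition $\{J_i\}_{i=1}^p$ of $\{n_0+1,\dots,n\}$. Then for each $1\le i\le p$: (2) The frame operators $S_{\mathcal G_i}$ and $S_{\mathcal F_0}$ commute. (3) There exists $c_i\in\mathbb R_{>0}$ such that $S_{\mathcal F}f_j=c_if_j$ for every $j\in J_i$.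
   Context: For a vector $x\in\mathbb R^m$, $x^\downarrow$ (resp. $x^\uparrow$) is its decreasing (resp. increasing) rearrangement. For a positive semidefinite $d\times d$ matrix $S$, $\lambda(S)\in\mathbb R_{\ge0}^d$ is the vector of eigenvalues (with multiplicity) in decreasing order, and $\lambda^\uparrow(S)$ the same in increasing order. $x\otimes y$ is the operator $z\mapsto\langle z,y\rangle x$. Majorization: $x\prec y$ means $\sum_{i\le j}x_i^\downarrow\le\sum_{i\le j}y_i^\downarrow$ for all $j$ with equality of total sums; if $x,y$ have different lengths the shorter is first padded with zeros. For a finite sequence $\mathcal F=\{f_i\}$ in $\mathbb C^d$, its frame operator is $S_{\mathcal F}=\sum_i f_i\otimes f_i$, and the convex potential of $f$ is $P_f(\mathcal F)=\operatorname{tr} f(S_{\mathcal F})$. Initial data for the completion problem is a pair $(\mathcal F_0,\mathbf a)$ with $\mathcal F_0=\{f_i\}_{i=1}^{n_0}$ a finite sequence in $\mathbb C^d$ and $\mathbf a=(\alpha_i)_{i=1}^k\in\mathbb R_{>0}^k$ such that $d-\operatorname{rk}S_{\mathcal F_0}\le k$; put $n=n_0+k$. $\mathcal C_{\mathbf a}(\mathcal F_0)$ is the set of sequences $\mathcal F=(\mathcal F_0,\mathcal G)=\{f_i\}_{i=1}^n$ whose first $n_0$ vectors are $\mathcal F_0$ and whose remaining vectors $\mathcal G=\{f_i\}_{i=n_0+1}^n$ satisfy $\|f_{n_0+i}\|^2=\alpha_i$ for $1\le i\le k$. Define $$\mathcal C_{\mathbf a}^{\rm op}(\mathcal F_0)=\{\mathcal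 F=(\mathcal F_0,\mathcal G)\in\mathcal C_{\mathbf a}(\mathcal F_0):\ \lambda(S_{\mathcal F})=(\lambda(S_{\mathcal F_0})+\lambda^\uparrow(S_{\mathcal G}))^\downarrow\}$$ and $\Gamma_d(\mathbf a)=\{\mu\in\mathbb R_{\ge0}^d:\ \mu=\mu^\uparrow,\ \mathbf a\prec\mu\}$. A sequence of vectors is irreducible if it cannot be partitioned into two (nonempty) mutually orthogonal subsequences. A partition of a sequence into irreducible subsequences is a partition of its index set such that the corresponding subsequences are each irreducible and their spans are mutually orthogonal. *)

theory Defs
  imports
    "HOL-Analysis.Convex"
    "HOL-Library.Disjoint_Sets"
    "Jordan_Normal_Form.Schur_Decomposition"
    "Jordan_Normal_Form.DL_Rank"
begin

text \<open>
  Vectors of \<open>\<complex>\<^sup>d\<close> are elements of \<^term>\<open>carrier_vec d\<close>. Finite sequences of vectors and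
  vectors of \<open>\<real>\<^sup>m\<close> are lists, so indices start at \<open>0\<close>. The inner product
  \<^term>\<open>x \<bullet>c y\<close> is linear in \<open>x\<close> and conjugate linear in \<open>y\<close>.
\<close>

section \<open>Rearrangement and majorization\<close>

definition increasing :: "real list \<Rightarrow> real list" where
  "increasing x = sort x"

definition decreasing :: "real list \<Rightarrow> real list" where
  "decreasing x = rev (sort x)"

definition pad_zeros :: "nat \<Rightarrow> real list \<Rightarrow> real list" where
  "pad_zeros m x = x @ replicate (m - length x) 0"

definition majorized :: "real list \<Rightarrow> real list \<Rightarrow> bool" (infix "\<prec>\<^sub>m" 50) where
  "x \<prec>\<^sub>m y \<longleftrightarrow>
    (let m = max (length x) (length y); x' = pad_zeros m x; y' = pad_zeros m y
     in (\<forall>j\<le>m. sum_list (take j (decreasing x')) \<le> sum_list (take j (decreasing y')))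
        \<and> sum_list x' = sum_list y')"

section \<open>Eigenvalues, functional calculus and trace\<close>

text \<open>Only meaningful when the characteristic polynomial of \<open>S\<close> splits over the reals, in
  particular for Hermitian \<open>S\<close>; multiplicities are those of the roots.\<close>

definition eigenvalue_list :: "complex mat \<Rightarrow> real list" where
  "eigenvalue_list S = (THE xs. xs = decreasing xs \<and>
     char_poly S = (\<Prod>x\<leftarrow>xs. [:- complex_of_real x, 1:]))"

definition eigenvalue_list_incr :: "complex mat \<Rightarrow> real list" where
  "eigenvalue_list_incr S = increasing (eigenvalue_list S)"

text \<open>\<open>f(S)\<close> for Hermitian \<open>S\<close>: the operator acting as multiplication by \<open>f(x)\<close> on the eigenspace
  of each eigenvalue \<open>x\<close>. It is unique because eigenvectors of \<open>S\<close> span the whole space.\<close>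

definition mat_fun :: "(real \<Rightarrow> real) \<Rightarrow> complex mat \<Rightarrow> complex mat" where
  "mat_fun f S = (THE B. B \<in> carrier_mat (dim_row S) (dim_row S) \<and>
     (\<forall>x v. eigenvector S v (complex_of_real x) \<longrightarrow>
        B *\<^sub>v v = complex_of_real (f x) \<cdot>\<^sub>v v))"

definition mat_trace :: "complex mat \<Rightarrow> complex" where
  "mat_trace A = sum_list (diag_mat A)"

section \<open>Frame operators and convex potentials\<close>

text \<open>The matrix of \<open>z \<mapsto> \<langle>z, y\<rangle> x\<close>.\<close>

definition rank_one :: "complex vec \<Rightarrow> complex vec \<Rightarrow> complex mat" where
  "rank_one x y = mat (dim_vec x) (dim_vec y) (\<lambda>(i, j). x $ i * conjugate (y $ j))"

definition frame_op :: "nat \<Rightarrow> complex vec list \<Rightarrow> complex mat" where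
  "frame_op d F = foldr (\<lambda>v A. rank_one v v + A) F (0\<^sub>m d d)"

definition convex_potential :: "nat \<Rightarrow> (real \<Rightarrow> real) \<Rightarrow> complex vec list \<Rightarrow> real" where
  "convex_potential d f F = Re (mat_trace (mat_fun f (frame_op d F)))"

definition strictly_convex_on :: "real set \<Rightarrow> (real \<Rightarrow> real) \<Rightarrow> bool" where
  "strictly_convex_on S f \<longleftrightarrow> convex S \<and>
     (\<forall>x\<in>S. \<forall>y\<in>S. \<forall>u>0. \<forall>v>0. x \<noteq> y \<longrightarrow> u + v = 1 \<longrightarrow>
        f (u * x + v * y) < u * f x + v * f y)"

section \<open>The completion problem\<close>

text \<open>The rank condition is \<open>d - rk S \<le> k\<close> with the subtraction moved to the other side.\<close>

definition initial_data :: "nat \<Rightarrow> complex vec list \<Rightarrow> real list \<Rightarrow> bool" where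
  "initial_data d F\<^sub>0 a \<longleftrightarrow> set F\<^sub>0 \<subseteq> carrier_vec d \<and> (\<forall>\<alpha>\<in>set a. 0 < \<alpha>) \<and>
     d \<le> vec_space.rank d (frame_op d F\<^sub>0) + length a"

definition completions :: "nat \<Rightarrow> real list \<Rightarrow> complex vec list \<Rightarrow> complex vec list set" where
  "completions d a F\<^sub>0 = {F\<^sub>0 @ G | G. set G \<subseteq> carrier_vec d \<and> length G = length a \<and>
     (\<forall>i<length a. G ! i \<bullet>c G ! i = complex_of_real (a ! i))}"

definition op_completions :: "nat \<Rightarrow> real list \<Rightarrow> complex vec list \<Rightarrow> complex vec list set" where
  "op_completions d a F\<^sub>0 = {F\<^sub>0 @ G | G. F\<^sub>0 @ G \<in> completions d a F\<^sub>0 \<and>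
     eigenvalue_list (frame_op d (F\<^sub>0 @ G)) =
       decreasing (map2 (+) (eigenvalue_list (frame_op d F\<^sub>0))
                            (eigenvalue_list_incr (frame_op d G)))}"

definition Gamma_maj :: "nat \<Rightarrow> real list \<Rightarrow> real list set" where
  "Gamma_maj d a = {\<mu>. length \<mu> = d \<and> (\<forall>x\<in>set \<mu>. 0 \<le> x) \<and> \<mu> = increasing \<mu> \<and> a \<prec>\<^sub>m \<mu>}"

section \<open>Irreducible subsequences\<close>

definition irreducible_seq :: "complex vec list \<Rightarrow> bool" where
  "irreducible_seq H \<longleftrightarrow>
     \<not> (\<exists>A B. A \<union> B = {..<length H} \<and> A \<inter> B = {} \<and> A \<noteq> {} \<and> B \<noteq> {} \<and>
          (\<forall>i\<in>A. \<forall>j\<in>B. H ! i \<bullet>c H ! j = 0))"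

abbreviation vec_span :: "nat \<Rightarrow> complex vec set \<Rightarrow> complex vec set" where
  "vec_span d \<equiv> LinearCombinations.module.span class_ring (module_vec TYPE(complex) d)"

text \<open>\<open>P\<close> is the set of blocks of a partition of the index set \<open>I\<close>; the subsequence of \<open>F\<close>
  belonging to a block \<open>J\<close> is \<^term>\<open>nths F J\<close>.\<close>

definition irreducible_partition ::
    "nat \<Rightarrow> complex vec list \<Rightarrow> nat set \<Rightarrow> nat set set \<Rightarrow> bool" where
  "irreducible_partition d F I P \<longleftrightarrow> partition_on I P \<and>
     (\<forall>J\<in>P. irreducible_seq (nths F J)) \<and>
     (\<forall>J\<in>P. \<forall>K\<in>P. J \<noteq> K \<longrightarrow>
        (\<forall>x\<in>vec_span d (set (nths F J)). \<forall>y\<in>vec_span d (set (nths F K)). x \<bullet>c y = 0))"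

end

theory Submission
  imports Defs "HOL-Analysis.Function_Topology"
begin

text \<open>
  Let \<open>\<lambda>\<close> be the decreasing spectrum of the frame operator of the given vectors \<open>F\<^sub>0\<close> and \<open>\<mu>\<close> the
  increasing spectrum of the frame operator of the added vectors \<open>G\<close>. By Lidskii's inequality the
  spectrum of the sum of the two operators majorizes \<open>\<lambda> + \<mu>\<close>. Karamata's inequality turns this into
  \<open>P\<^sub>f(F) \<ge> \<Sum> f(\<lambda>\<^sub>i + \<mu>\<^sub>i)\<close>, with equality exactly when the spectrum is a rearrangement of \<open>\<lambda> + \<mu>\<close>
  (\<open>lidskii_convex\<close>), which is the condition defining \<open>op_completions\<close>. By the Schur-Horn theorem
  for frames (\<open>frame_norms_maj\<close>, \<open>frame_with_norms\<close>) the spectra \<open>\<mu>\<close> that occur are those that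
  majorize \<open>a\<close>, and each of them occurs with any prescribed orthonormal eigenbasis, in particular
  with that of \<open>F\<^sub>0\<close>. The problem is thereby reduced to minimizing \<open>\<Sum> f(\<lambda>\<^sub>i + \<mu>\<^sub>i)\<close> over a compact
  convex set of vectors \<open>\<mu>\<close>. Strict convexity makes the minimizer unique. Its existence is delicate
  because \<open>f\<close> may jump upwards at \<open>0\<close>: the continuous closure of \<open>f\<close> has a minimizer, and the rank
  condition keeps that minimizer away from the jump (\<open>minimizer_positive\<close>, \<open>unique_minimizer\<close>).

  For the structure of minimizers, note first that a minimizer among the \<open>op_completions\<close> minimizes
  among all completions, as the overall minimum is attained there. Equality in Lidskii's inequality
  forces the trace of the product of the two frame operators to be \<open>\<Sum> \<lambda>\<^sub>i \<mu>\<^sub>i\<close>, its least possible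
  value, and this forces a common eigenbasis \<open>v\<close> (\<open>trace_equality_block\<close>, \<open>joint_basis\<close>). Suppose
  that some added vector \<open>g\<close> has components along \<open>v l\<close> and \<open>v m\<close> and that the full frame operator
  has a larger eigenvalue at \<open>v l\<close> than at \<open>v m\<close>. Then a small amount of spectrum of \<open>G\<close> can be moved
  from \<open>v l\<close> to \<open>v m\<close> without violating the majorization of \<open>a\<close> (\<open>transfer_spectrum\<close>): an obstructing
  constraint would be tight, and tightness says that some set of added vectors carries all of the
  spectrum along \<open>v l\<close> and nothing along \<open>v m\<close>, which the vector \<open>g\<close> rules out. The Schur-Horn
  theorem realizes the new spectrum in the same basis, with a smaller potential. So every added
  vector is an eigenvector of the full frame operator. Eigenvectors with distinct eigenvalues are
  orthogonal, hence an irreducible block has a single eigenvalue \<open>c\<close>. On the vectors of a block with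
  frame operator \<open>T\<close> the operator \<open>S\<close> of \<open>F\<^sub>0\<close> therefore acts as \<open>c - T\<close>, so that \<open>S T = c T - T\<^sup>2\<close> is
  Hermitian, which means that \<open>S\<close> and \<open>T\<close> commute.
\<close>

section \<open>Weighted sums and sorting\<close>

text \<open>
  A linear programming bound together with its slack. For weights \<open>p\<close> in \<open>[0, 1]\<close> and a value \<open>s\<close>
  that separates the entries of \<open>y\<close> on \<open>K\<close> from those outside, both correction sums are nonnegative.
  They are kept in the statement because equality in the bound makes them vanish, and this is what
  later forces weights to be \<open>0\<close> or \<open>1\<close>.
\<close>

lemma weighted_sum_gap:
  fixes p y :: "'a \<Rightarrow> real"
  assumes "finite D" "K \<subseteq> D"
    and "s * sum p D \<le> s * real (card K)"
  shows "(\<Sum>l\<in>D. p l * y l) + (\<Sum>l\<in>K. (1 - p l) * (y l - s)) + (\<Sum>l\<in>D - K. p l * (s - y l)) \<le> sum y K"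
proof -
  have K: "finite K" using assms finite_subset by blast
  have split: "sum h D = sum h K + sum h (D - K)" for h :: "'a \<Rightarrow> real"
    using assms(1,2) by (metis add.commute sum.subset_diff)
  have "(\<Sum>l\<in>K. p l * y l) + (\<Sum>l\<in>K. (1 - p l) * (y l - s)) = (\<Sum>l\<in>K. (y l - s) + s * p l)"
    unfolding sum.distrib[symmetric] by (rule sum.cong) (auto simp: algebra_simps)
  also have "\<dots> = sum y K - s * real (card K) + s * sum p K"
    by (simp add: sum.distrib sum_subtractf sum_distrib_left)
  finally have 1: "(\<Sum>l\<in>K. p l * y l) + (\<Sum>l\<in>K. (1 - p l) * (y l - s)) = \<dots>" .
  have "(\<Sum>l\<in>D-K. p l * y l) + (\<Sum>l\<in>D-K. p l * (s - y l)) = (\<Sum>l\<in>D-K. s * p l)"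
    unfolding sum.distrib[symmetric] by (rule sum.cong) (auto simp: algebra_simps)
  then have 2: "(\<Sum>l\<in>D-K. p l * y l) + (\<Sum>l\<in>D-K. p l * (s - y l)) = s * sum p (D-K)"
    by (simp add: sum_distrib_left)
  show ?thesis using 1 2 split[of p] split[of "\<lambda>l. p l * y l"] assms(3) by (simp add: algebra_simps)
qed

definition nonincreasing :: "nat \<Rightarrow> (nat \<Rightarrow> real) \<Rightarrow> bool" where
  "nonincreasing n x \<longleftrightarrow> (\<forall>i j. i \<le> j \<longrightarrow> j < n \<longrightarrow> x j \<le> x i)"

lemma nonincreasingD: "nonincreasing n x \<Longrightarrow> i \<le> j \<Longrightarrow> j < n \<Longrightarrow> x j \<le> x i"
  by (simp add: nonincreasing_def)

lemma weighted_sum_le_prefix: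
  fixes p y :: "nat \<Rightarrow> real"
  assumes y: "nonincreasing n y" "\<And>l. l < n \<Longrightarrow> 0 \<le> y l"
    and p: "\<And>l. l < n \<Longrightarrow> 0 \<le> p l" "\<And>l. l < n \<Longrightarrow> p l \<le> 1"
    and s: "(\<Sum>l<n. p l) \<le> real j" and jn: "j \<le> n"
  shows "(\<Sum>l<n. p l * y l) \<le> (\<Sum>l<j. y l)"
proof (cases "j = n")
  case True
  then show ?thesis using y p by (auto intro!: sum_mono simp: mult_left_le_one_le)
next
  case False
  with jn have jn: "j < n" by simp
  have "(\<Sum>l<n. p l * y l) + (\<Sum>l<j. (1 - p l) * (y l - y j)) + (\<Sum>l\<in>{..<n} - {..<j}. p l * (y j - y l)) \<le> sum y {..<j}"
    by (rule weighted_sum_gap) (use s jn y in \<open>auto intro: mult_left_mono\<close>)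
  moreover have "y j \<le> y l" if "l < j" for l
    using nonincreasingD[OF y(1), of l j] that jn by simp
  then have "0 \<le> (\<Sum>l<j. (1 - p l) * (y l - y j))"
    using p(2) jn by (intro sum_nonneg mult_nonneg_nonneg) auto
  moreover have "y l \<le> y j" if "l \<in> {..<n} - {..<j}" for l
    using nonincreasingD[OF y(1), of j l] that by simp
  then have "0 \<le> (\<Sum>l\<in>{..<n} - {..<j}. p l * (y j - y l))"
    using p(1) by (intro sum_nonneg mult_nonneg_nonneg) auto
  ultimately show ?thesis by linarith
qed

lemma sum_indicator_weight:
  fixes y :: "nat \<Rightarrow> real"
  assumes "I \<subseteq> {..<n}"
  shows "(\<Sum>l<n. (if l \<in> I then 1 else 0) * y l) = sum y I" 
proof -
  have "(\<Sum>l<n. (if l \<in> I then 1 else 0) * y l) = (\<Sum>l<n. if l \<in> I then y l else 0)"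
    by (rule sum.cong) auto
  also have "\<dots> = sum y ({..<n} \<inter> I)"
    by (rule sum.inter_restrict[symmetric]) simp
  also have "{..<n} \<inter> I = I" using assms by blast
  finally show ?thesis .
qed

lemma subset_sum_le_prefix:
  fixes y :: "nat \<Rightarrow> real"
  assumes y: "nonincreasing n y" "\<And>l. l < n \<Longrightarrow> 0 \<le> y l"
    and I: "I \<subseteq> {..<n}" "card I \<le> j" and jn: "j \<le> n"
  shows "sum y I \<le> (\<Sum>l<j. y l)"
proof -
  define p :: "nat \<Rightarrow> real" where "p l = (if l \<in> I then 1 else 0)" for l
  have p: "(\<Sum>l<n. p l * z l) = sum z I" for z
    unfolding p_def by (rule sum_indicator_weight[OF I(1)])
  have "(\<Sum>l<n. p l) = real (card I)" using p[of "\<lambda>_. 1"] by simp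
  then have "(\<Sum>l<n. p l) \<le> real j" using I(2) by simp
  then have "(\<Sum>l<n. p l * y l) \<le> (\<Sum>l<j. y l)"
    using weighted_sum_le_prefix[OF y, of p j] jn by (simp add: p_def)
  then show ?thesis using p by simp
qed

lemma exists_sorting_permutation:
  fixes f :: "nat \<Rightarrow> real"
  shows "\<exists>\<pi>. bij_betw \<pi> {..<n} {..<n} \<and> nonincreasing n (f \<circ> \<pi>)"
proof -
  define L where "L = sort_key (\<lambda>i. - f i) [0..<n]"
  have len: "length L = n" and dist: "distinct L" and set: "set L = {..<n}" by (auto simp: L_def)
  have "bij_betw ((!) L) {..<n} {..<n}"
    by (rule bij_betw_nth[OF dist]) (auto simp: len set)
  moreover have "nonincreasing n (f \<circ> (!) L)"
    unfolding nonincreasing_def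
  proof (intro allI impI)
    fix i j assume ij: "i \<le> j" "j < n"
    have "sorted (map (\<lambda>i. - f i) L)" unfolding L_def by (rule sorted_sort_key)
    then have "map (\<lambda>i. - f i) L ! i \<le> map (\<lambda>i. - f i) L ! j"
      by (rule sorted_nth_mono) (use ij len in auto)
    then show "(f \<circ> (!) L) j \<le> (f \<circ> (!) L) i" using ij len by simp
  qed
  ultimately show ?thesis by (intro exI conjI)
qed

definition sorting :: "nat \<Rightarrow> (nat \<Rightarrow> real) \<Rightarrow> nat \<Rightarrow> nat" where
  "sorting n f = (SOME \<pi>. bij_betw \<pi> {..<n} {..<n} \<and> nonincreasing n (f \<circ> \<pi>))"

text \<open>
  Extended by \<open>0\<close>, so that families of different lengths can be compared without padding.
\<close>

definition rearr :: "nat \<Rightarrow> (nat \<Rightarrow> real) \<Rightarrow> nat \<Rightarrow> real" where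
  "rearr n f i = (if i < n then f (sorting n f i) else 0)"

lemma sorting_bij: "bij_betw (sorting n f) {..<n} {..<n}"
  and sorting_nonincreasing: "nonincreasing n (f \<circ> sorting n f)"
  using someI_ex[OF exists_sorting_permutation[of n f]] unfolding sorting_def by blast+

lemma rearr_nonincreasing: "nonincreasing n (rearr n f)"
  using sorting_nonincreasing[of n f] by (auto simp: nonincreasing_def rearr_def)

lemma sorting_less: "i < n \<Longrightarrow> sorting n f i < n"
  using sorting_bij[of n f] by (auto simp: bij_betw_def)

lemma rearr_nonneg: "(\<And>i. i < n \<Longrightarrow> 0 \<le> f i) \<Longrightarrow> 0 \<le> rearr n f i"
  by (simp add: rearr_def sorting_less)

lemma sum_rearr: "(\<Sum>i<n. h (rearr n f i)) = (\<Sum>i<n. h (f i))"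
  using sum.reindex_bij_betw[OF sorting_bij[of n f], of "\<lambda>i. h (f i)"] by (simp add: rearr_def)

text \<open>
  This lemma and the next one identify the prefix sums of the rearrangement with the largest
  subset sums. Majorization becomes a statement about subsets, free of any ordering.
\<close>

lemma subset_sum_le_rearr:
  assumes f: "\<And>i. i < n \<Longrightarrow> 0 \<le> f i" and I: "I \<subseteq> {..<n}" "card I \<le> j"
  shows "sum f I \<le> (\<Sum>i<j. rearr n f i)"
proof -
  define I' where "I' = {i\<in>{..<n}. sorting n f i \<in> I}"
  have inj: "inj_on (sorting n f) {..<n}" and im: "sorting n f ` {..<n} = {..<n}"
    using sorting_bij[of n f] by (auto simp: bij_betw_def)
  have b: "bij_betw (sorting n f) I' I"
    unfolding bij_betw_def using inj im I(1) by (auto simp: I'_def inj_on_def image_iff)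
  have "sum f I = (\<Sum>i\<in>I'. f (sorting n f i))"
    using sum.reindex_bij_betw[OF b, of f] by simp
  also have "\<dots> = sum (rearr n f) I'" by (rule sum.cong) (auto simp: I'_def rearr_def)
  also have "\<dots> \<le> (\<Sum>i<j. rearr (n) f i)"
  proof -
    have I'n: "I' \<subseteq> {..<n}" by (auto simp: I'_def)
    have "card I' = card I" using bij_betw_same_card[OF b] .
    moreover have "card I' \<le> n" using card_mono[OF _ I'n] by simp
    ultimately have "sum (rearr n f) I' \<le> (\<Sum>i<min j n. rearr n f i)"
      using subset_sum_le_prefix[of n "rearr n f" I' "min j n"] rearr_nonincreasing rearr_nonneg f I I'n by simp
    also have "\<dots> \<le> (\<Sum>i<j. rearr n f i)" by (rule sum_mono2) (auto intro: rearr_nonneg f)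
    finally show ?thesis .
  qed
  finally show ?thesis .
qed

lemma prefix_rearr_eq_subset_sum:
  "\<exists>I\<subseteq>{..<n}. card I \<le> j \<and> (\<Sum>i<j. rearr n f i) = sum f I"
proof -
  define I where "I = sorting n f ` {..<min j n}"
  have inj: "inj_on (sorting n f) {..<min j n}"
    using sorting_bij[of n f] by (auto simp: bij_betw_def inj_on_def)
  have "I \<subseteq> {..<n}" by (auto simp: I_def sorting_less)
  moreover have "card I \<le> j" unfolding I_def using card_image_le[of "{..<min j n}"] by (simp add: card_image[OF inj])
  moreover have "(\<Sum>i<j. rearr n f i) = sum f I"
  proof -
    have "(\<Sum>i<j. rearr n f i) = (\<Sum>i<min j n. rearr n f i)"
      by (rule sum.mono_neutral_right) (auto simp: rearr_def)
    also have "\<dots> = sum f I" unfolding I_def by (subst sum.reindex[OF inj]) (auto simp: rearr_def)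
    finally show ?thesis .
  qed
  ultimately show ?thesis by blast
qed

section \<open>Majorization\<close>

text \<open>
  For nonnegative families this is majorization after padding with zeros.
\<close>

definition maj :: "nat \<Rightarrow> (nat \<Rightarrow> real) \<Rightarrow> nat \<Rightarrow> (nat \<Rightarrow> real) \<Rightarrow> bool" where
  "maj n f m g \<longleftrightarrow> (\<forall>j. (\<Sum>i<j. rearr n f i) \<le> (\<Sum>i<j. rearr m g i)) \<and> (\<Sum>i<n. f i) = (\<Sum>i<m. g i)"

lemma maj_iff_subset_sums:
  assumes f: "\<And>i. i < n \<Longrightarrow> 0 \<le> f i" and g: "\<And>i. i < m \<Longrightarrow> 0 \<le> g i"
  shows "maj n f m g \<longleftrightarrow> (\<forall>I\<subseteq>{..<n}. \<exists>K\<subseteq>{..<m}. card K \<le> card I \<and> sum f I \<le> sum g K)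
     \<and> (\<Sum>i<n. f i) = (\<Sum>i<m. g i)"
proof (intro iffI conjI allI impI)
  fix I assume "maj n f m g" "I \<subseteq> {..<n}"
  then show "\<exists>K\<subseteq>{..<m}. card K \<le> card I \<and> sum f I \<le> sum g K"
    using subset_sum_le_rearr[of n f I "card I", OF f] prefix_rearr_eq_subset_sum[of m "card I" g]
    unfolding maj_def by (metis order_refl order_trans)
next
  assume *: "(\<forall>I\<subseteq>{..<n}. \<exists>K\<subseteq>{..<m}. card K \<le> card I \<and> sum f I \<le> sum g K) \<and> (\<Sum>i<n. f i) = (\<Sum>i<m. g i)"
  have "(\<Sum>i<j. rearr n f i) \<le> (\<Sum>i<j. rearr m g i)" for j
  proof -
    obtain I where I: "I\<subseteq>{..<n}" "card I \<le> j" "(\<Sum>i<j. rearr n f i) = sum f I"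
      using prefix_rearr_eq_subset_sum by blast
    with * obtain K where "K\<subseteq>{..<m}" "card K \<le> card I" "sum f I \<le> sum g K" by blast
    with I subset_sum_le_rearr[of m g K j, OF g] show ?thesis by linarith
  qed
  with * show "maj n f m g" unfolding maj_def by blast
qed (auto simp: maj_def)

lemma decreasing_map_sorting:
  assumes \<pi>: "bij_betw \<pi> {..<n} {..<n}" and f: "nonincreasing n (f \<circ> \<pi>)"
  shows "decreasing (map f [0..<n]) = map (f \<circ> \<pi>) [0..<n]"
proof -
  have "sort (map f [0..<n]) = rev (map (f \<circ> \<pi>) [0..<n])"
  proof (rule properties_for_sort)
    have "image_mset \<pi> (mset_set {..<n}) = mset_set {..<n}"
      using \<pi> by (metis bij_betw_def image_mset_mset_set)
    then have "image_mset (f \<circ> \<pi>) (mset_set {..<n}) = image_mset f (mset_set {..<n})"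
      by (metis image_mset.compositionality)
    then show "mset (rev (map (f \<circ> \<pi>) [0..<n])) = mset (map f [0..<n])"
      by (simp add: atLeast0LessThan)
    show "sorted (rev (map (f \<circ> \<pi>) [0..<n]))"
      unfolding sorted_rev_iff_nth_mono using f by (auto simp: nonincreasing_def)
  qed
  then show ?thesis unfolding decreasing_def by simp
qed

lemma decreasing_map_eq_rearr: "decreasing (map f [0..<n]) = map (rearr n f) [0..<n]"
  unfolding decreasing_map_sorting[OF sorting_bij sorting_nonincreasing] by (simp add: rearr_def)

lemma rearr_eqI:
  assumes "bij_betw \<pi> {..<n} {..<n}" "nonincreasing n (f \<circ> \<pi>)" "i < n"
  shows "rearr n f i = f (\<pi> i)"
  using decreasing_map_sorting[OF assms(1,2)] assms(3) unfolding decreasing_map_eq_rearr by simp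

lemma rearr_cong:
  assumes eq: "\<And>i. i < n \<Longrightarrow> f i = g i"
  shows "rearr n f i = rearr n g i"
proof (cases "i < n")
  case True
  have "nonincreasing n (f \<circ> sorting n g)"
    using sorting_nonincreasing[of n g] eq sorting_less[of _ n g] by (simp add: nonincreasing_def)
  from rearr_eqI[OF sorting_bij this True] show ?thesis
    using True eq[OF sorting_less[OF True, of g]] by (simp add: rearr_def)
qed (simp add: rearr_def)

lemma decreasing_eq_rearr:
  "decreasing xs = map (rearr (length xs) ((!) xs)) [0..<length xs]"
  using decreasing_map_eq_rearr[of "(!) xs" "length xs"] by (simp add: map_nth)

lemma sum_list_take_decreasing:
  "sum_list (take j (decreasing xs)) = (\<Sum>i<j. rearr (length xs) ((!) xs) i)"
proof -
  have "sum_list (take j (decreasing xs)) = (\<Sum>i<min j (length xs). rearr (length xs) ((!) xs) i)"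
    unfolding decreasing_eq_rearr by (simp add: sum_list_sum_nth take_map atLeast0LessThan min_def)
  also have "\<dots> = (\<Sum>i<j. rearr (length xs) ((!) xs) i)"
    by (rule sum.mono_neutral_left) (auto simp: rearr_def)
  finally show ?thesis .
qed

lemma decreasing_pad_zeros:
  assumes "\<forall>x\<in>set xs. 0 \<le> x"
  shows "decreasing (pad_zeros m xs) = decreasing xs @ replicate (m - length xs) 0"
proof -
  have "sort (xs @ replicate (m - length xs) 0) = replicate (m - length xs) 0 @ sort xs"
    by (rule properties_for_sort) (use assms in \<open>auto simp: sorted_append\<close>)
  then show ?thesis by (simp add: decreasing_def pad_zeros_def)
qed

lemma majorized_iff_maj:
  assumes "\<forall>x\<in>set xs. 0 \<le> x" "\<forall>x\<in>set ys. 0 \<le> x"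
  shows "xs \<prec>\<^sub>m ys \<longleftrightarrow> maj (length xs) ((!) xs) (length ys) ((!) ys)"
proof -
  define m where "m = max (length xs) (length ys)"
  have *: "sum_list (take j (decreasing (pad_zeros m zs))) = (\<Sum>i<j. rearr (length zs) ((!) zs) i)"
    if "\<forall>x\<in>set zs. 0 \<le> x" for zs j
    using that by (simp add: decreasing_pad_zeros sum_list_take_decreasing sum_list_replicate min_def)
  have tot: "sum_list (pad_zeros m zs) = (\<Sum>i<length zs. zs ! i)" for zs
    unfolding pad_zeros_def sum_list_append sum_list_replicate
    by (simp add: sum_list_sum_nth atLeast0LessThan)
  have big: "(\<Sum>i<j. rearr (length zs) ((!) zs) i) = (\<Sum>i<m. rearr (length zs) ((!) zs) i)"
    if "length zs \<le> m" "m \<le> j" for zs j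
    by (rule sum.mono_neutral_right) (use that in \<open>auto simp: rearr_def\<close>)
  have "xs \<prec>\<^sub>m ys \<longleftrightarrow> (\<forall>j\<le>m. (\<Sum>i<j. rearr (length xs) ((!) xs) i) \<le> (\<Sum>i<j. rearr (length ys) ((!) ys) i))
     \<and> (\<Sum>i<length xs. xs ! i) = (\<Sum>i<length ys. ys ! i)"
    unfolding majorized_def Let_def m_def[symmetric] using *[OF assms(1)] *[OF assms(2)] tot by simp
  moreover have "(\<Sum>i<j. rearr (length xs) ((!) xs) i) \<le> (\<Sum>i<j. rearr (length ys) ((!) ys) i)"
    if "\<forall>j\<le>m. (\<Sum>i<j. rearr (length xs) ((!) xs) i) \<le> (\<Sum>i<j. rearr (length ys) ((!) ys) i)" for j
  proof (cases "j \<le> m")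
    case False
    then have "(\<Sum>i<j. rearr (length zs) ((!) zs) i) = (\<Sum>i<m. rearr (length zs) ((!) zs) i)"
      if "length zs \<le> m" for zs using big[of zs j] that by simp
    from this[of xs] this[of ys] that show ?thesis by (simp add: m_def)
  qed (use that in blast)
  ultimately show ?thesis unfolding maj_def by blast
qed

lemma maj_cong:
  assumes "\<And>i. i < n \<Longrightarrow> f i = f' i" "\<And>i. i < m \<Longrightarrow> g i = g' i"
  shows "maj n f m g \<longleftrightarrow> maj n f' m g'"
proof -
  have "rearr n f i = rearr n f' i" "rearr m g i = rearr m g' i" for i
    using rearr_cong assms by blast+
  then show ?thesis using assms by (simp add: maj_def)
qed

section \<open>Karamata's inequality\<close>

lemma convex_slope_mono:
  fixes f :: "real \<Rightarrow> real"
  assumes f: "convex_on {0..} f" and nn: "0 \<le> x'" "0 \<le> y'" and le: "x' \<le> x" "y' \<le> y" and ne: "x \<noteq> y" "x' \<noteq> y'"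
  shows "(f y' - f x') / (y' - x') \<le> (f y - f x) / (y - x)"
proof -
  have flip: "(f u - f v) / (u - v) = (f v - f u) / (v - u)" for u v
    using minus_divide_divide[of "f v - f u" "v - u"] by simp
  define a b c e where "a = min x' y'" and "b = max x' y'" and "c = min x y" and "e = max x y"
  have o: "0 \<le> a" "a < b" "c < e" "a \<le> c" "b \<le> e" using assms by (auto simp: a_def b_def c_def e_def)
  have "(f a - f b) / (a - b) \<le> (f a - f e) / (a - e)"
    using convex_on_slope_le(1)[OF f, of a e b] o by (cases "b = e") auto
  also have "\<dots> \<le> (f c - f e) / (c - e)"
    using convex_on_slope_le(2)[OF f, of a e c] o by (cases "a = c") auto
  finally have "(f a - f b) / (a - b) \<le> (f c - f e) / (c - e)" .
  moreover have "(f a - f b) / (a - b) = (f y' - f x') / (y' - x')"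
    using flip by (auto simp: a_def b_def min_def max_def)
  moreover have "(f c - f e) / (c - e) = (f y - f x) / (y - x)"
    using flip by (auto simp: c_def e_def min_def max_def)
  ultimately show ?thesis by simp
qed

text \<open>
  Summation by parts against the slopes of the secants of \<open>f\<close> between \<open>x i\<close> and \<open>y i\<close>, which decrease
  along the sorted sequences. The induction carries a free lower bound \<open>c\<close> of the slopes, so that
  indices with \<open>x i = y i\<close>, which have no secant, are passed over. Secants are used because \<open>f\<close> need
  not have a subgradient at \<open>0\<close>.
\<close>

lemma karamata:
  fixes f :: "real \<Rightarrow> real"
  assumes f: "convex_on {0..} f"
    and x: "nonincreasing n x" "\<And>i. i < n \<Longrightarrow> 0 \<le> x i"
    and y: "nonincreasing n y" "\<And>i. i < n \<Longrightarrow> 0 \<le> y i"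
    and pre: "\<And>j. j \<le> n \<Longrightarrow> (\<Sum>i<j. x i) \<le> (\<Sum>i<j. y i)"
    and tot: "(\<Sum>i<n. x i) = (\<Sum>i<n. y i)"
  shows "(\<Sum>i<n. f (x i)) \<le> (\<Sum>i<n. f (y i))"
proof -
  define s where "s i = (f (y i) - f (x i)) / (y i - x i)" for i
  have main: "c * ((\<Sum>i<m. y i) - (\<Sum>i<m. x i)) \<le> (\<Sum>i<m. f (y i)) - (\<Sum>i<m. f (x i))"
    if "m \<le> n" "\<And>i. i < m \<Longrightarrow> x i \<noteq> y i \<Longrightarrow> c \<le> s i" for m c
    using that
  proof (induction m arbitrary: c)
    case 0
    then show ?case by simp
  next
    case (Suc m)
    show ?case
    proof (cases "x m = y m")
      case True
      then show ?thesis using Suc.IH[of c] Suc.prems by simp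
    next
      case False
      have "s m \<le> s i" if "i < m" "x i \<noteq> y i" for i
        unfolding s_def using that False Suc.prems(1) x y
        by (intro convex_slope_mono[OF f]) (auto simp: nonincreasing_def)
      then have 1: "s m * ((\<Sum>i<m. y i) - (\<Sum>i<m. x i)) \<le> (\<Sum>i<m. f (y i)) - (\<Sum>i<m. f (x i))"
        using Suc.IH[of "s m"] Suc.prems(1) by simp
      have 2: "s m * (y m - x m) = f (y m) - f (x m)" using False by (simp add: s_def)
      have "c * ((\<Sum>i<Suc m. y i) - (\<Sum>i<Suc m. x i)) \<le> s m * ((\<Sum>i<Suc m. y i) - (\<Sum>i<Suc m. x i))"
        using Suc.prems pre[of "Suc m"] False by (intro mult_right_mono) auto
      also have "\<dots> = s m * ((\<Sum>i<m. y i) - (\<Sum>i<m. x i)) + s m * (y m - x m)" by (simp add: algebra_simps)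
      finally show ?thesis using 1 2 by simp
    qed
  qed
  have "\<exists>c. \<forall>i\<in>{..<n}. c \<le> s i"
    using bdd_below_finite[of "s ` {..<n}"] by (auto simp: bdd_below_def)
  then obtain c where "\<And>i. i < n \<Longrightarrow> c \<le> s i" by auto
  with main[of n c] tot show ?thesis by simp
qed

lemma strictly_convex_imp_convex:
  assumes "strictly_convex_on S f" shows "convex_on S f"
proof
  fix t x y :: real assume "0 < t" "t < 1" "x \<in> S" "y \<in> S"
  then show "f ((1 - t) *\<^sub>R x + t *\<^sub>R y) \<le> (1 - t) * f x + t * f y"
  proof (cases "x = y")
    case False
    have *: "\<forall>x\<in>S. \<forall>y\<in>S. \<forall>u>0. \<forall>v>0. x \<noteq> y \<longrightarrow> u + v = 1 \<longrightarrow> f (u * x + v * y) < u * f x + v * f y"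
      using assms unfolding strictly_convex_on_def by blast
    have "f ((1 - t) * x + t * y) < (1 - t) * f x + t * f y"
      using *[rule_format, of x y "1 - t" t] False \<open>0 < t\<close> \<open>t < 1\<close> \<open>x \<in> S\<close> \<open>y \<in> S\<close> by simp
    then show ?thesis by simp
  qed (simp add: algebra_simps)
qed (use assms in \<open>auto simp: strictly_convex_on_def\<close>)

lemma strictly_convex_midpoint_sum:
  assumes f: "strictly_convex_on S f" and x: "\<And>i. i \<in> D \<Longrightarrow> x i \<in> S" "\<And>i. i \<in> D \<Longrightarrow> y i \<in> S"
    and "finite D" "\<exists>i\<in>D. x i \<noteq> y i"
  shows "(\<Sum>i\<in>D. f ((x i + y i) / 2)) < ((\<Sum>i\<in>D. f (x i)) + (\<Sum>i\<in>D. f (y i))) / 2"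
proof -
  have lt: "f ((x i + y i) / 2) < (f (x i) + f (y i)) / 2" if "i \<in> D" "x i \<noteq> y i" for i
  proof -
    have "f (1/2 * x i + 1/2 * y i) < 1/2 * f (x i) + 1/2 * f (y i)"
    proof -
      have *: "\<forall>x\<in>S. \<forall>y\<in>S. \<forall>u>0. \<forall>v>0. x \<noteq> y \<longrightarrow> u + v = 1 \<longrightarrow> f (u * x + v * y) < u * f x + v * f y"
        using f unfolding strictly_convex_on_def by blast
      show ?thesis by (rule *[rule_format]) (use x that in auto)
    qed
    then show ?thesis by (simp add: add_divide_distrib)
  qed
  have le: "f ((x i + y i) / 2) \<le> (f (x i) + f (y i)) / 2" if "i \<in> D" for i
    using lt[OF that] by (cases "x i = y i") auto
  have "(\<Sum>i\<in>D. f ((x i + y i) / 2)) < (\<Sum>i\<in>D. (f (x i) + f (y i)) / 2)"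
    using assms(4,5) le lt by (intro sum_strict_mono_ex1) auto
  also have "\<dots> = ((\<Sum>i\<in>D. f (x i)) + (\<Sum>i\<in>D. f (y i))) / 2"
    by (simp add: sum_divide_distrib[symmetric] sum.distrib)
  finally show ?thesis .
qed

text \<open>
  If \<open>x\<close> and \<open>y\<close> differed, strict convexity would put the sum of \<open>f\<close> over their midpoint below the
  average of the sums over \<open>x\<close> and \<open>y\<close>, hence below the sum over \<open>x\<close>. But the midpoint majorizes \<open>x\<close>.
\<close>

lemma karamata_strict:
  fixes f :: "real \<Rightarrow> real"
  assumes f: "strictly_convex_on {0..} f"
    and x: "nonincreasing n x" "\<And>i. i < n \<Longrightarrow> 0 \<le> x i"
    and y: "nonincreasing n y" "\<And>i. i < n \<Longrightarrow> 0 \<le> y i"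
    and pre: "\<And>j. j \<le> n \<Longrightarrow> (\<Sum>i<j. x i) \<le> (\<Sum>i<j. y i)"
    and tot: "(\<Sum>i<n. x i) = (\<Sum>i<n. y i)"
    and le: "(\<Sum>i<n. f (y i)) \<le> (\<Sum>i<n. f (x i))" and "i < n"
  shows "x i = y i"
proof (rule ccontr)
  assume ne: "x i \<noteq> y i"
  have cf: "convex_on {0..} f" by (rule strictly_convex_imp_convex[OF f])
  let ?z = "\<lambda>i. (x i + y i) / 2"
  have sz: "(\<Sum>i<j. ?z i) = ((\<Sum>i<j. x i) + (\<Sum>i<j. y i)) / 2" for j
    by (simp add: sum_divide_distrib[symmetric] sum.distrib)
  have "nonincreasing n ?z"
    using x(1) y(1) unfolding nonincreasing_def by (meson add_mono divide_right_mono zero_le_numeral)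
  moreover have "(\<Sum>i<j. x i) \<le> (\<Sum>i<j. ?z i)" if "j \<le> n" for j using pre[OF that] sz[of j] by simp
  ultimately have "(\<Sum>i<n. f (x i)) \<le> (\<Sum>i<n. f (?z i))"
    using karamata[OF cf x, of ?z] x(2) y(2) tot sz[of n] by (simp add: add_nonneg_nonneg)
  also have "\<dots> < ((\<Sum>i<n. f (x i)) + (\<Sum>i<n. f (y i))) / 2"
    by (rule strictly_convex_midpoint_sum[OF f]) (use ne \<open>i < n\<close> x y in auto)
  finally show False using le by simp
qed

section \<open>Reaching a majorized vector by transfers\<close>

text \<open>
  The Hardy-Littlewood-Polya argument: a transfer from the last surplus before the first deficit to
  that deficit keeps the prefix sums large enough and repairs at least one entry. The conclusion is
  phrased for a property \<open>P\<close> preserved by transfers, to be used for the squared norms of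
  systems of vectors that share a frame operator.
\<close>

lemma transfers_reach:
  fixes x y :: "nat \<Rightarrow> real" and P :: "(nat \<Rightarrow> real) \<Rightarrow> bool"
  assumes step: "\<And>y i j \<delta>. P y \<Longrightarrow> i < j \<Longrightarrow> j < n \<Longrightarrow> 0 \<le> \<delta> \<Longrightarrow> \<delta> \<le> y i - y j \<Longrightarrow>
      P (y(i := y i - \<delta>, j := y j + \<delta>))"
    and x: "nonincreasing n x" and P: "P y"
    and pre: "\<And>j. j \<le> n \<Longrightarrow> (\<Sum>i<j. x i) \<le> (\<Sum>i<j. y i)"
    and tot: "(\<Sum>i<n. x i) = (\<Sum>i<n. y i)"
  shows "\<exists>z. P z \<and> (\<forall>i<n. z i = x i)"
  using P pre tot
proof (induction "card {i. i < n \<and> y i \<noteq> x i}" arbitrary: y rule: less_induct)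
  case less
  note P = less.prems(1) and pre = less.prems(2) and tot = less.prems(3)
  define D where "D j = (\<Sum>i<j. y i) - (\<Sum>i<j. x i)" for j
  have D0: "0 \<le> D j" if "j \<le> n" for j using pre[OF that] by (simp add: D_def)
  have DS: "D (Suc j) = D j + (y j - x j)" for j by (simp add: D_def)
  show ?case
  proof (cases "\<forall>i<n. y i = x i")
    case True
    then show ?thesis using P by blast
  next
    case False
    have "\<exists>k<n. y k < x k"
    proof (rule ccontr)
      assume "\<not> ?thesis"
      then have ge: "\<And>k. k < n \<Longrightarrow> x k \<le> y k" by force
      moreover obtain i where "i < n" "y i \<noteq> x i" using False by blast
      ultimately have "(\<Sum>i<n. x i) < (\<Sum>i<n. y i)"
        by (intro sum_strict_mono_ex1) (auto intro!: bexI[of _ i] simp: order_less_le)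
      with tot show False by simp
    qed
    \<comment> \<open>the first deficit\<close>
    define k where "k = (LEAST k. k < n \<and> y k < x k)"
    have k: "k < n" "y k < x k" using LeastI_ex[OF \<open>\<exists>k<n. y k < x k\<close>] by (auto simp: k_def)
    have least: "x i \<le> y i" if "i < k" for i
      using not_less_Least[of i "\<lambda>k. k < n \<and> y k < x k"] that k(1) by (force simp: k_def)
    have "0 < D k" using D0[of "Suc k"] DS[of k] k by simp
    have "\<exists>j<k. x j < y j"
    proof (rule ccontr)
      assume "\<not> ?thesis"
      then have "(\<Sum>i<k. y i) \<le> (\<Sum>i<k. x i)" by (intro sum_mono) (metis lessThan_iff not_less)
      with \<open>0 < D k\<close> show False by (simp add: D_def)
    qed
    \<comment> \<open>the last surplus before it, so that \<open>x\<close> and \<open>y\<close> agree strictly between \<open>j\<close> and \<open>k\<close>\<close>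
    define j where "j = Max {j. j < k \<and> x j < y j}"
    have fin: "finite {j. j < k \<and> x j < y j}" by simp
    have j: "j < k" "x j < y j"
      using Max_in[OF fin] \<open>\<exists>j<k. x j < y j\<close> unfolding j_def by auto
    have eq: "y i = x i" if "j < i" "i < k" for i
      using least[OF that(2)] Max_ge[OF fin, of i] that unfolding j_def[symmetric] by force
    define \<delta> where "\<delta> = min (y j - x j) (x k - y k)"
    have \<delta>: "0 < \<delta>" "\<delta> \<le> y j - x j" "\<delta> \<le> x k - y k" using j k by (auto simp: \<delta>_def)
    have xkj: "x k \<le> x j" using x j k by (auto simp: nonincreasing_def)
    define y' where "y' = y(j := y j - \<delta>, k := y k + \<delta>)"
    have P': "P y'" unfolding y'_def by (rule step[OF P]) (use \<delta> j k xkj in auto)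
    have Dmid: "\<delta> \<le> D m" if "j < m" "m \<le> k" for m
      using that
    proof (induction m)
      case (Suc m)
      show ?case
      proof (cases "m = j")
        case True
        then show ?thesis using DS[of j] D0[of j] j k \<delta> by simp
      next
        case False
        then show ?thesis using Suc DS[of m] eq[of m] by simp
      qed
    qed simp
    have sum': "(\<Sum>i<m. y' i) = (\<Sum>i<m. y i) - (if j < m then \<delta> else 0) + (if k < m then \<delta> else 0)" for m
      by (induction m) (use j in \<open>auto simp: y'_def\<close>)
    have pre': "(\<Sum>i<m. x i) \<le> (\<Sum>i<m. y' i)" if "m \<le> n" for m
      using sum'[of m] Dmid[of m] D0[OF that] j \<delta> by (auto simp: D_def split: if_splits)
    have tot': "(\<Sum>i<n. x i) = (\<Sum>i<n. y' i)" using sum'[of n] tot j k by simp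
    have "{i. i < n \<and> y' i \<noteq> x i} \<subset> {i. i < n \<and> y i \<noteq> x i}"
    proof
      show "{i. i < n \<and> y' i \<noteq> x i} \<subseteq> {i. i < n \<and> y i \<noteq> x i}"
        using j k by (auto simp: y'_def)
      have "y' j = x j \<or> y' k = x k" using j by (auto simp: y'_def \<delta>_def)
      then show "{i. i < n \<and> y' i \<noteq> x i} \<noteq> {i. i < n \<and> y i \<noteq> x i}"
      proof
        assume y'j: "y' j = x j"
        have "j \<in> {i. i < n \<and> y i \<noteq> x i}" using j k by simp
        moreover have "j \<notin> {i. i < n \<and> y' i \<noteq> x i}" using y'j by simp
        ultimately show ?thesis by blast
      next
        assume y'k: "y' k = x k"
        have "k \<in> {i. i < n \<and> y i \<noteq> x i}" using k by simp
        moreover have "k \<notin> {i. i < n \<and> y' i \<noteq> x i}" using y'k by simp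
        ultimately show ?thesis by blast
      qed
    qed
    then have "card {i. i < n \<and> y' i \<noteq> x i} < card {i. i < n \<and> y i \<noteq> x i}"
      by (intro psubset_card_mono) simp_all
    from less.hyps[OF this P' pre' tot'] show ?thesis .
  qed
qed

section \<open>Orthonormal bases\<close>

lemma cip_eq_sum:
  "w \<in> carrier_vec d \<Longrightarrow> v \<bullet>c w = (\<Sum>i<d. v $ i * cnj (w $ i))" for v w :: "complex vec"
  by (simp add: scalar_prod_def atLeast0LessThan)

lemma cip_commute:
  "v \<in> carrier_vec d \<Longrightarrow> w \<in> carrier_vec d \<Longrightarrow> v \<bullet>c w = cnj (w \<bullet>c v)" for v w :: "complex vec"
  by (simp add: cip_eq_sum mult.commute)

lemma cip_self: "v \<in> carrier_vec d \<Longrightarrow> v \<bullet>c v = complex_of_real (\<Sum>i<d. (cmod (v $ i))\<^sup>2)"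
  for v :: "complex vec"
  unfolding of_real_sum complex_norm_square by (rule cip_eq_sum)

lemma cip_self_real: "v \<in> carrier_vec d \<Longrightarrow> v \<bullet>c v = complex_of_real (Re (v \<bullet>c v))" 
  for v :: "complex vec"
  by (simp add: cip_self)

lemma cip_self_pos: "v \<in> carrier_vec d \<Longrightarrow> v \<noteq> 0\<^sub>v d \<Longrightarrow> 0 < Re (v \<bullet>c v)" for v :: "complex vec"
  using conjugate_square_greater_0_vec[of v d] by (simp add: less_complex_def)

lemma cip_smult_left: "v \<in> carrier_vec d \<Longrightarrow> w \<in> carrier_vec d \<Longrightarrow> (a \<cdot>\<^sub>v v) \<bullet>c w = a * (v \<bullet>c w)"
  for v w :: "complex vec"
  by (simp add: cip_eq_sum sum_distrib_left mult.assoc)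

lemma cip_smult_right: "v \<in> carrier_vec d \<Longrightarrow> w \<in> carrier_vec d \<Longrightarrow> v \<bullet>c (a \<cdot>\<^sub>v w) = cnj a * (v \<bullet>c w)"
  for v w :: "complex vec"
  by (simp add: cip_eq_sum[of _ d] sum_distrib_left mult_ac)

lemma cip_add_left: "v \<in> carrier_vec d \<Longrightarrow> w \<in> carrier_vec d \<Longrightarrow> z \<in> carrier_vec d \<Longrightarrow> 
  (v + w) \<bullet>c z = v \<bullet>c z + w \<bullet>c z" for v w z :: "complex vec"
  by (simp add: cip_eq_sum[of _ d] sum.distrib algebra_simps)

definition onb :: "nat \<Rightarrow> (nat \<Rightarrow> complex vec) \<Rightarrow> bool" where
  "onb d u \<longleftrightarrow> (\<forall>l<d. u l \<in> carrier_vec d) \<and>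
     (\<forall>l<d. \<forall>m<d. u l \<bullet>c u m = (if l = m then 1 else 0))"

lemma onb_carrier: "onb d u \<Longrightarrow> l < d \<Longrightarrow> u l \<in> carrier_vec d"
  by (simp add: onb_def)

lemma onb_cip: "onb d u \<Longrightarrow> l < d \<Longrightarrow> m < d \<Longrightarrow> u l \<bullet>c u m = (if l = m then 1 else 0)"
  by (simp add: onb_def)

text \<open>
  For square matrices \<open>V U = 1\<close> implies \<open>U V = 1\<close>: orthonormality of the columns gives
  orthonormality of the rows.
\<close>

lemma onb_complete:
  assumes u: "onb d u" and ij: "i < d" "j < d"
  shows "(\<Sum>l<d. u l $ i * cnj (u l $ j)) = (if i = j then 1 else 0)"
proof -
  define U where "U = mat d d (\<lambda>(i, l). u l $ i)"
  define V where "V = mat d d (\<lambda>(l, i). cnj (u l $ i))"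
  have UV: "U \<in> carrier_mat d d" "V \<in> carrier_mat d d" by (auto simp: U_def V_def)
  have "V * U = 1\<^sub>m d"
  proof (rule eq_matI)
    fix l m assume lm: "l < dim_row (1\<^sub>m d)" "m < dim_col (1\<^sub>m d)"
    then have "(V * U) $$ (l, m) = (\<Sum>i<d. cnj (u l $ i) * u m $ i)"
      by (simp add: U_def V_def scalar_prod_def atLeast0LessThan)
    also have "\<dots> = u m \<bullet>c u l"
      using cip_eq_sum[OF onb_carrier[OF u, of l]] lm by (simp add: mult.commute)
    finally show "(V * U) $$ (l, m) = 1\<^sub>m d $$ (l, m)" using onb_cip[OF u] lm by auto
  qed (auto simp: U_def V_def)
  then have "U * V = 1\<^sub>m d" using mat_mult_left_right_inverse UV by blast
  moreover have "(U * V) $$ (i, j) = (\<Sum>l<d. u l $ i * cnj (u l $ j))"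
    using ij by (simp add: U_def V_def scalar_prod_def atLeast0LessThan)
  ultimately show ?thesis using ij by simp
qed

lemma onb_expand:
  assumes u: "onb d u" and v: "v \<in> carrier_vec d" and i: "i < d"
  shows "(\<Sum>l<d. (v \<bullet>c u l) * u l $ i) = v $ i"
proof -
  have "(\<Sum>l<d. (v \<bullet>c u l) * u l $ i) = (\<Sum>l<d. \<Sum>j<d. v $ j * (u l $ i * cnj (u l $ j)))"
    by (intro sum.cong refl) (simp add: cip_eq_sum[OF onb_carrier[OF u]] sum_distrib_left sum_distrib_right mult_ac)
  also have "\<dots> = (\<Sum>j<d. v $ j * (\<Sum>l<d. u l $ i * cnj (u l $ j)))"
    by (subst sum.swap) (simp add: sum_distrib_left)
  also have "\<dots> = (\<Sum>j<d. v $ j * (if i = j then 1 else 0))"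
    by (intro sum.cong refl) (use onb_complete[OF u i] in simp)
  also have "\<dots> = v $ i" using i by (simp add: if_distrib cong: if_cong)
  finally show ?thesis .
qed

lemma onb_combination:
  assumes u: "onb d u"
  shows "\<exists>h\<in>carrier_vec d. \<forall>l<d. h \<bullet>c u l = a l"
proof -
  define h where "h = Matrix.vec d (\<lambda>r. \<Sum>l<d. a l * u l $ r)"
  have "h \<bullet>c u m = a m" if m: "m < d" for m
  proof -
    have "h \<bullet>c u m = (\<Sum>r<d. \<Sum>l<d. a l * (u l $ r * cnj (u m $ r)))"
      unfolding cip_eq_sum[OF onb_carrier[OF u m]]
      by (intro sum.cong refl) (simp add: h_def sum_distrib_right mult.assoc)
    also have "\<dots> = (\<Sum>l<d. a l * (u l \<bullet>c u m))"
      unfolding cip_eq_sum[OF onb_carrier[OF u m]] by (subst sum.swap) (simp only: sum_distrib_left)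
    also have "\<dots> = (\<Sum>l<d. if l = m then a l else 0)"
      using m by (intro sum.cong refl) (auto simp: onb_cip[OF u])
    finally show ?thesis using m by simp
  qed
  then show ?thesis by (intro bexI[of _ h]) (auto simp: h_def)
qed

lemma parseval:
  assumes u: "onb d u" and v: "v \<in> carrier_vec d" and w: "w \<in> carrier_vec d"
  shows "(\<Sum>l<d. (v \<bullet>c u l) * cnj (w \<bullet>c u l)) = v \<bullet>c w"
proof -
  have "v \<bullet>c w = (\<Sum>i<d. (\<Sum>l<d. (v \<bullet>c u l) * u l $ i) * cnj (w $ i))"
    unfolding cip_eq_sum[OF w] by (intro sum.cong refl) (use onb_expand[OF u v] in simp)
  also have "\<dots> = (\<Sum>l<d. (v \<bullet>c u l) * (\<Sum>i<d. u l $ i * cnj (w $ i)))"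
    unfolding sum_distrib_left sum_distrib_right by (subst sum.swap) (simp add: mult.assoc)
  also have "\<dots> = (\<Sum>l<d. (v \<bullet>c u l) * cnj (w \<bullet>c u l))"
    by (intro sum.cong refl) (use cip_commute[OF w onb_carrier[OF u]] cip_eq_sum[OF w] in simp)
  finally show ?thesis by simp
qed

lemma parseval_norm:
  assumes "onb d u" "v \<in> carrier_vec d"
  shows "(\<Sum>l<d. (cmod (v \<bullet>c u l))\<^sup>2) = Re (v \<bullet>c v)"
proof -
  have "complex_of_real (\<Sum>l<d. (cmod (v \<bullet>c u l))\<^sup>2) = v \<bullet>c v"
    using parseval[OF assms assms(2)] by (simp only: of_real_sum complex_norm_square)
  then show ?thesis by (metis Re_complex_of_real)
qed

lemma onb_vec_eqI:
  assumes u: "onb d u" and v: "v \<in> carrier_vec d" and w: "w \<in> carrier_vec d"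
    and eq: "\<And>l. l < d \<Longrightarrow> v \<bullet>c u l = w \<bullet>c u l"
  shows "v = w"
proof (rule eq_vecI)
  fix i assume "i < dim_vec w"
  then have i: "i < d" using w by simp
  show "v $ i = w $ i"
    unfolding onb_expand[OF u v i, symmetric] onb_expand[OF u w i, symmetric]
    by (rule sum.cong) (auto simp: eq)
qed (use v w in auto)

section \<open>Spectral representations\<close>

text \<open>
  The operator \<open>\<Sum> x l (u l \<otimes> u l)\<close>, which has eigenvalue \<open>x l\<close> at \<open>u l\<close> when \<open>u\<close> is orthonormal.
\<close>

definition spectral :: "nat \<Rightarrow> (nat \<Rightarrow> complex vec) \<Rightarrow> (nat \<Rightarrow> real) \<Rightarrow> complex mat" where
  "spectral d u x = mat d d (\<lambda>(i, j). \<Sum>l<d. complex_of_real (x l) * (u l $ i * cnj (u l $ j)))"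

lemma spectral_carrier [simp]: "spectral d u x \<in> carrier_mat d d"
  by (simp add: spectral_def)

lemma spectral_cong: "(\<And>l. l < d \<Longrightarrow> x l = y l) \<Longrightarrow> spectral d u x = spectral d u y"
  unfolding spectral_def by (intro cong_mat refl) (auto intro!: sum.cong)

lemma mat_vec_index: "A \<in> carrier_mat d d \<Longrightarrow> v \<in> carrier_vec d \<Longrightarrow> i < d \<Longrightarrow>
  (A *\<^sub>v v) $ i = (\<Sum>j<d. A $$ (i, j) * v $ j)" for A :: "complex mat"
  by (simp add: scalar_prod_def atLeast0LessThan)

lemma spectral_mult_vec_index:
  assumes u: "onb d u" and v: "v \<in> carrier_vec d" and i: "i < d"
  shows "(spectral d u x *\<^sub>v v) $ i = (\<Sum>l<d. complex_of_real (x l) * (v \<bullet>c u l) * u l $ i)"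
proof -
  have "(spectral d u x *\<^sub>v v) $ i = (\<Sum>j<d. \<Sum>l<d. complex_of_real (x l) * (u l $ i * cnj (u l $ j)) * v $ j)"
    unfolding mat_vec_index[OF spectral_carrier v i] using i by (simp add: spectral_def sum_distrib_right)
  also have "\<dots> = (\<Sum>l<d. complex_of_real (x l) * (\<Sum>j<d. v $ j * cnj (u l $ j)) * u l $ i)"
    by (subst sum.swap) (simp add: sum_distrib_left sum_distrib_right mult_ac)
  also have "\<dots> = (\<Sum>l<d. complex_of_real (x l) * (v \<bullet>c u l) * u l $ i)"
    by (intro sum.cong refl) (simp add: cip_eq_sum[OF onb_carrier[OF u]])
  finally show ?thesis .
qed

lemma spectral_form:
  assumes u: "onb d u" and v: "v \<in> carrier_vec d" and w: "w \<in> carrier_vec d"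
  shows "(spectral d u x *\<^sub>v v) \<bullet>c w = (\<Sum>l<d. complex_of_real (x l) * (v \<bullet>c u l) * cnj (w \<bullet>c u l))"
proof -
  have "(spectral d u x *\<^sub>v v) \<bullet>c w = (\<Sum>i<d. \<Sum>l<d. complex_of_real (x l) * (v \<bullet>c u l) * u l $ i * cnj (w $ i))"
    unfolding cip_eq_sum[OF w]
    by (intro sum.cong refl) (simp add: spectral_mult_vec_index[OF u v] sum_distrib_right)
  also have "\<dots> = (\<Sum>l<d. complex_of_real (x l) * (v \<bullet>c u l) * (\<Sum>i<d. u l $ i * cnj (w $ i)))"
    by (subst sum.swap) (simp add: sum_distrib_left mult.assoc)
  also have "\<dots> = (\<Sum>l<d. complex_of_real (x l) * (v \<bullet>c u l) * cnj (w \<bullet>c u l))"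
    by (intro sum.cong refl) (use cip_commute[OF w onb_carrier[OF u]] cip_eq_sum[OF w] in simp)
  finally show ?thesis .
qed

lemma spectral_eigen:
  assumes u: "onb d u" and m: "m < d"
  shows "spectral d u x *\<^sub>v u m = complex_of_real (x m) \<cdot>\<^sub>v u m"
proof (rule eq_vecI)
  fix i assume "i < dim_vec (complex_of_real (x m) \<cdot>\<^sub>v u m)"
  then have i: "i < d" using onb_carrier[OF u m] by simp
  have "(spectral d u x *\<^sub>v u m) $ i = (\<Sum>l<d. complex_of_real (x l) * (if m = l then 1 else 0) * u l $ i)"
    unfolding spectral_mult_vec_index[OF u onb_carrier[OF u m] i]
    by (intro sum.cong refl) (simp add: onb_cip[OF u m])
  also have "\<dots> = complex_of_real (x m) * u m $ i"
    using m by (simp add: if_distrib if_distribR cong: if_cong)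
  finally show "(spectral d u x *\<^sub>v u m) $ i = (complex_of_real (x m) \<cdot>\<^sub>v u m) $ i"
    using onb_carrier[OF u m] i by simp
qed (use onb_carrier[OF u m] in \<open>simp add: spectral_def\<close>)

lemma mat_eqI_onb:
  assumes u: "onb d u" and A: "A \<in> carrier_mat d d" "B \<in> carrier_mat d d"
    and eq: "\<And>l. l < d \<Longrightarrow> A *\<^sub>v u l = B *\<^sub>v u l"
  shows "A = (B :: complex mat)"
proof -
  have entry: "C $$ (i, j) = (\<Sum>l<d. (C *\<^sub>v u l) $ i * cnj (u l $ j))"
    if C: "C \<in> carrier_mat d d" and ij: "i < d" "j < d" for C i j
  proof -
    have "(\<Sum>l<d. (C *\<^sub>v u l) $ i * cnj (u l $ j)) = (\<Sum>l<d. \<Sum>k<d. C $$ (i, k) * (u l $ k * cnj (u l $ j)))"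
      by (intro sum.cong refl) (simp add: mat_vec_index[OF C onb_carrier[OF u] ij(1)] sum_distrib_left sum_distrib_right mult_ac)
    also have "\<dots> = (\<Sum>k<d. C $$ (i, k) * (\<Sum>l<d. u l $ k * cnj (u l $ j)))"
      by (subst sum.swap) (simp add: sum_distrib_left)
    also have "\<dots> = (\<Sum>k<d. C $$ (i, k) * (if k = j then 1 else 0))"
      by (intro sum.cong refl) (use onb_complete[OF u _ ij(2)] in simp)
    also have "\<dots> = C $$ (i, j)" using ij by (simp add: if_distrib cong: if_cong)
    finally show ?thesis by simp
  qed
  show ?thesis
  proof (rule eq_matI)
    fix i j assume "i < dim_row B" "j < dim_col B"
    then have ij: "i < d" "j < d" using A by auto
    show "A $$ (i, j) = B $$ (i, j)"
      unfolding entry[OF A(1) ij] entry[OF A(2) ij] by (rule sum.cong) (auto simp: eq)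
  qed (use A in auto)
qed

lemma spectralI:
  assumes u: "onb d u" and "A \<in> carrier_mat d d"
    and "\<And>l. l < d \<Longrightarrow> A *\<^sub>v u l = complex_of_real (x l) \<cdot>\<^sub>v u l"
  shows "A = spectral d u x"
  by (rule mat_eqI_onb[OF u]) (use assms spectral_eigen[OF u] in auto)

lemma spectral_add: "spectral d u x + spectral d u y = spectral d u (\<lambda>l. x l + y l)"
  by (rule eq_matI) (simp_all add: spectral_def sum.distrib distrib_right)

lemma spectral_permute:
  assumes "bij_betw \<pi> {..<d} {..<d}"
  shows "spectral d (u \<circ> \<pi>) (x \<circ> \<pi>) = spectral d u x"
proof -
  have "(\<Sum>l<d. complex_of_real ((x \<circ> \<pi>) l) * ((u \<circ> \<pi>) l $ i * cnj ((u \<circ> \<pi>) l $ j)))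
      = (\<Sum>l<d. complex_of_real (x l) * (u l $ i * cnj (u l $ j)))" for i j
    using sum.reindex_bij_betw[OF assms, of "\<lambda>l. complex_of_real (x l) * (u l $ i * cnj (u l $ j))"] by simp
  then show ?thesis by (simp add: spectral_def)
qed

lemma onb_permute:
  assumes "bij_betw \<pi> {..<d} {..<d}" "onb d u"
  shows "onb d (u \<circ> \<pi>)"
proof -
  have "\<pi> l < d" if "l < d" for l using assms(1) that by (auto simp: bij_betw_def)
  moreover have "\<pi> l = \<pi> m \<longleftrightarrow> l = m" if "l < d" "m < d" for l m
    using assms(1) that by (auto simp: bij_betw_def inj_on_def)
  ultimately show ?thesis using assms(2) by (auto simp: onb_def)
qed

lemma linear_factors_mset:
  fixes xs ys :: "'a :: idom list"
  shows "(\<Prod>x\<leftarrow>xs. [:- x, 1:]) = (\<Prod>x\<leftarrow>ys. [:- x, 1:]) \<longleftrightarrow> mset xs = mset ys"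
proof
  have p: "proots (\<Prod>x\<leftarrow>zs. [:- x, 1:]) = mset zs" for zs :: "'a list"
  proof (induction zs)
    case (Cons z zs)
    have "(\<Prod>x\<leftarrow>zs. [:- x, 1:]) \<noteq> 0" unfolding prod_list_zero_iff by auto
    then have "proots ([:- z, 1:] * (\<Prod>x\<leftarrow>zs. [:- x, 1:])) = proots [:- z, 1:] + mset zs"
      using Cons by (subst proots_mult) auto
    then show ?case by (simp only: list.map prod_list.Cons proots_linear_factor minus_minus) simp
  qed simp
  show "mset xs = mset ys" if "(\<Prod>x\<leftarrow>xs. [:- x, 1:]) = (\<Prod>x\<leftarrow>ys. [:- x, 1:])"
    using p[of xs] p[of ys] that by simp
  show "(\<Prod>x\<leftarrow>xs. [:- x, 1:]) = (\<Prod>x\<leftarrow>ys. [:- x, 1:])" if "mset xs = mset ys"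
    using that by (metis mset_map prod_mset_prod_list)
qed

lemma char_poly_spectral:
  assumes u: "onb d u"
  shows "char_poly (spectral d u x) = (\<Prod>t\<leftarrow>map x [0..<d]. [:- complex_of_real t, 1:])"
proof -
  define U where "U = mat d d (\<lambda>(i, l). u l $ i)"
  define V where "V = mat d d (\<lambda>(l, i). cnj (u l $ i))"
  define D where "D = mat d d (\<lambda>(i, j). if i = j then complex_of_real (x i) else 0)"
  have car: "U \<in> carrier_mat d d" "V \<in> carrier_mat d d" "D \<in> carrier_mat d d" 
    by (auto simp: U_def V_def D_def)
  have UV: "U * V = 1\<^sub>m d"
    by (rule eq_matI) (auto simp: U_def V_def scalar_prod_def atLeast0LessThan onb_complete[OF u])
  then have VU: "V * U = 1\<^sub>m d" using mat_mult_left_right_inverse car by blast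
  have UD: "(U * D) $$ (i, l) = u l $ i * complex_of_real (x l)" if "i < d" "l < d" for i l
    using that by (simp add: U_def D_def scalar_prod_def atLeast0LessThan if_distrib cong: if_cong)
  have "spectral d u x = U * D * V"
  proof (rule eq_matI)
    fix i j assume "i < dim_row (U * D * V)" "j < dim_col (U * D * V)"
    then have ij: "i < d" "j < d" using car by auto
    have "(U * D * V) $$ (i, j) = (\<Sum>l<d. (U * D) $$ (i, l) * V $$ (l, j))"
      using car ij by (subst index_mult_mat) (auto simp: scalar_prod_def atLeast0LessThan)
    then show "spectral d u x $$ (i, j) = (U * D * V) $$ (i, j)"
      using ij by (simp add: spectral_def UD V_def mult_ac)
  qed (use car in \<open>auto simp: spectral_def\<close>)
  then have "similar_mat (spectral d u x) D"
    by (intro similar_matI[of _ _ U V d]) (use car UV VU in auto)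
  then have "char_poly (spectral d u x) = char_poly D" by (rule char_poly_similar)
  also have "\<dots> = (\<Prod>a\<leftarrow>diag_mat D. [:- a, 1:])"
    by (rule char_poly_upper_triangular[OF car(3)]) (auto simp: D_def)
  also have "diag_mat D = map complex_of_real (map x [0..<d])"
    by (auto simp: diag_mat_def D_def)
  finally show ?thesis by (simp add: o_def)
qed

lemma mset_decreasing: "mset (decreasing xs) = mset xs"
  by (simp add: decreasing_def)

lemma decreasing_eq_iff: "decreasing xs = decreasing ys \<longleftrightarrow> mset xs = mset ys"
  by (metis decreasing_def mset_decreasing sorted_list_of_multiset_mset)

lemma eigenvalue_list_spectral:
  assumes u: "onb d u"
  shows "eigenvalue_list (spectral d u x) = decreasing (map x [0..<d])"
proof -
  have inj: "mset (map complex_of_real xs) = mset (map complex_of_real ys) \<longleftrightarrow> mset xs = mset ys" for xs ys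
  proof -
    have "inj (image_mset complex_of_real)" by (rule multiset.inj_map) (simp add: inj_def)
    then show ?thesis by (auto simp: inj_def)
  qed
  have factors: "(\<Prod>t\<leftarrow>xs. [:- complex_of_real t, 1:]) = (\<Prod>t\<leftarrow>ys. [:- complex_of_real t, 1:]) \<longleftrightarrow> mset xs = mset ys"
    for xs ys
    using linear_factors_mset[of "map complex_of_real xs" "map complex_of_real ys"]
    unfolding inj by (simp add: o_def)
  show ?thesis
    unfolding eigenvalue_list_def char_poly_spectral[OF u] factors
  proof (rule the_equality)
    show "decreasing (map x [0..<d]) = decreasing (decreasing (map x [0..<d])) \<and>
        mset (map x [0..<d]) = mset (decreasing (map x [0..<d]))"
      by (simp add: decreasing_eq_iff mset_decreasing)
    fix xs assume "xs = decreasing xs \<and> mset (map x [0..<d]) = mset xs"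
    then show "xs = decreasing (map x [0..<d])" by (metis decreasing_eq_iff)
  qed
qed

lemma eigenvalue_list_incr_spectral:
  assumes "onb d u"
  shows "eigenvalue_list_incr (spectral d u x) = increasing (map x [0..<d])"
  unfolding eigenvalue_list_incr_def eigenvalue_list_spectral[OF assms] increasing_def decreasing_def
  by (rule properties_for_sort) simp_all

lemma spectral_coeff:
  assumes u: "onb d u" and v: "v \<in> carrier_vec d" and m: "m < d"
  shows "(spectral d u y *\<^sub>v v) \<bullet>c u m = complex_of_real (y m) * (v \<bullet>c u m)"
  unfolding spectral_form[OF u v onb_carrier[OF u m]] using m
  by (simp add: onb_cip[OF u m] if_distrib cong: if_cong)

text \<open>
  An eigenvector for the eigenvalue \<open>t\<close> only has components along those \<open>u l\<close> with \<open>x l = t\<close>.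
\<close>

lemma mat_fun_spectral:
  assumes u: "onb d u"
  shows "mat_fun f (spectral d u x) = spectral d u (\<lambda>l. f (x l))"
  unfolding mat_fun_def
proof (rule the_equality)
  have dim: "dim_row (spectral d u x) = d" by (simp add: spectral_def)
  have "spectral d u (\<lambda>l. f (x l)) *\<^sub>v v = complex_of_real (f t) \<cdot>\<^sub>v v"
    if e: "eigenvector (spectral d u x) v (complex_of_real t)" for t v
  proof -
    have v: "v \<in> carrier_vec d" and ev: "spectral d u x *\<^sub>v v = complex_of_real t \<cdot>\<^sub>v v"
      using e by (auto simp: eigenvector_def dim)
    show ?thesis
    proof (rule onb_vec_eqI[OF u])
      fix m assume m: "m < d"
      have um: "u m \<in> carrier_vec d" by (rule onb_carrier[OF u m])
      note coeff = spectral_coeff[OF u v m]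
      have "complex_of_real (x m) * (v \<bullet>c u m) = complex_of_real t * (v \<bullet>c u m)"
        unfolding coeff[symmetric] ev by (rule cip_smult_left[OF v um])
      then have "x m = t \<or> v \<bullet>c u m = 0" by (metis mult_cancel_right of_real_eq_iff)
      then show "(spectral d u (\<lambda>l. f (x l)) *\<^sub>v v) \<bullet>c u m = (complex_of_real (f t) \<cdot>\<^sub>v v) \<bullet>c u m"
        unfolding coeff cip_smult_left[OF v um] by auto
    next
      show "spectral d u (\<lambda>l. f (x l)) *\<^sub>v v \<in> carrier_vec d"
        by (rule mult_mat_vec_carrier[OF spectral_carrier v])
    qed (use v in simp)
  qed
  then show "spectral d u (\<lambda>l. f (x l)) \<in> carrier_mat (dim_row (spectral d u x)) (dim_row (spectral d u x)) \<and>
    (\<forall>t v. eigenvector (spectral d u x) v (complex_of_real t) \<longrightarrow>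
       spectral d u (\<lambda>l. f (x l)) *\<^sub>v v = complex_of_real (f t) \<cdot>\<^sub>v v)"
    by (simp add: dim)
  fix B assume B: "B \<in> carrier_mat (dim_row (spectral d u x)) (dim_row (spectral d u x)) \<and>
    (\<forall>t v. eigenvector (spectral d u x) v (complex_of_real t) \<longrightarrow> B *\<^sub>v v = complex_of_real (f t) \<cdot>\<^sub>v v)"
  show "B = spectral d u (\<lambda>l. f (x l))"
  proof (rule spectralI[OF u])
    show "B \<in> carrier_mat d d" using B by (simp add: dim)
    fix l assume l: "l < d"
    have "u l \<noteq> 0\<^sub>v d" using onb_cip[OF u l l] by auto
    then have "eigenvector (spectral d u x) (u l) (complex_of_real (x l))"
      using spectral_eigen[OF u l] onb_carrier[OF u l] by (simp add: eigenvector_def dim)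
    then show "B *\<^sub>v u l = complex_of_real (f (x l)) \<cdot>\<^sub>v u l" using B by blast
  qed
qed

lemma mat_trace_spectral:
  assumes u: "onb d u"
  shows "mat_trace (spectral d u x) = complex_of_real (\<Sum>l<d. x l)"
proof -
  have "mat_trace (spectral d u x) = (\<Sum>i<d. \<Sum>l<d. complex_of_real (x l) * (u l $ i * cnj (u l $ i)))"
    by (simp add: mat_trace_def diag_mat_def spectral_def sum_list_sum_nth atLeast0LessThan)
  also have "\<dots> = (\<Sum>l<d. complex_of_real (x l) * (u l \<bullet>c u l))"
    by (subst sum.swap) (simp add: cip_eq_sum[OF onb_carrier[OF u]] sum_distrib_left)
  also have "\<dots> = complex_of_real (\<Sum>l<d. x l)" by (simp add: onb_cip[OF u])
  finally show ?thesis .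
qed

lemma convex_potential_spectral:
  assumes "onb d u" "frame_op d F = spectral d u x"
  shows "convex_potential d f F = (\<Sum>l<d. f (x l))"
  by (simp add: convex_potential_def assms(2) mat_fun_spectral[OF assms(1)] mat_trace_spectral[OF assms(1)])

section \<open>The spectral theorem\<close>

definition hermitian_op :: "nat \<Rightarrow> complex mat \<Rightarrow> bool" where
  "hermitian_op d A \<longleftrightarrow> A \<in> carrier_mat d d \<and>
     (\<forall>v\<in>carrier_vec d. \<forall>w\<in>carrier_vec d. (A *\<^sub>v v) \<bullet>c w = v \<bullet>c (A *\<^sub>v w))"

lemma hermitian_opD: "hermitian_op d A \<Longrightarrow> v \<in> carrier_vec d \<Longrightarrow> w \<in> carrier_vec d \<Longrightarrow>
    (A *\<^sub>v v) \<bullet>c w = v \<bullet>c (A *\<^sub>v w)"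
  and hermitian_op_carrier: "hermitian_op d A \<Longrightarrow> A \<in> carrier_mat d d"
  by (auto simp: hermitian_op_def)

lemma hermitian_spectral: "onb d u \<Longrightarrow> hermitian_op d (spectral d u x)"
  unfolding hermitian_op_def
proof (intro conjI ballI)
  fix v w :: "complex vec" assume u: "onb d u" and v: "v \<in> carrier_vec d" and w: "w \<in> carrier_vec d"
  have "v \<bullet>c (spectral d u x *\<^sub>v w) = cnj ((spectral d u x *\<^sub>v w) \<bullet>c v)"
    by (rule cip_commute[OF v mult_mat_vec_carrier[OF spectral_carrier w]])
  then show "(spectral d u x *\<^sub>v v) \<bullet>c w = v \<bullet>c (spectral d u x *\<^sub>v w)"
    by (simp add: spectral_form[OF u v w] spectral_form[OF u w v] mult_ac)
qed simp

lemma hermitian_op_add: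
  assumes A: "hermitian_op d A" and B: "hermitian_op d B"
  shows "hermitian_op d (A + B)"
  unfolding hermitian_op_def
proof (intro conjI ballI)
  note cA = hermitian_op_carrier[OF A] and cB = hermitian_op_carrier[OF B]
  show "A + B \<in> carrier_mat d d" using cA cB by simp
  fix v w :: "complex vec" assume v: "v \<in> carrier_vec d" and w: "w \<in> carrier_vec d"
  have car: "A *\<^sub>v z \<in> carrier_vec d" "B *\<^sub>v z \<in> carrier_vec d" if "z \<in> carrier_vec d" for z
    using cA cB that mult_mat_vec_carrier by blast+
  have "v \<bullet>c ((A + B) *\<^sub>v w) = cnj (((A + B) *\<^sub>v w) \<bullet>c v)"
    by (rule cip_commute[OF v mult_mat_vec_carrier[OF add_carrier_mat[OF cB] w]])
  also have "\<dots> = cnj ((A *\<^sub>v w) \<bullet>c v) + cnj ((B *\<^sub>v w) \<bullet>c v)"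
    unfolding add_mult_distrib_mat_vec[OF cA cB w] cip_add_left[OF car(1)[OF w] car(2)[OF w] v] by simp
  also have "\<dots> = (A *\<^sub>v v) \<bullet>c w + (B *\<^sub>v v) \<bullet>c w"
    unfolding hermitian_opD[OF A v w] hermitian_opD[OF B v w]
    using cip_commute[OF v car(1)[OF w]] cip_commute[OF v car(2)[OF w]] by simp
  also have "\<dots> = ((A + B) *\<^sub>v v) \<bullet>c w"
    unfolding add_mult_distrib_mat_vec[OF cA cB v] cip_add_left[OF car(1)[OF v] car(2)[OF v] w] ..
  finally show "((A + B) *\<^sub>v v) \<bullet>c w = v \<bullet>c ((A + B) *\<^sub>v w)" by simp
qed

lemma extend_to_onb:
  assumes v: "v \<in> carrier_vec n" "v \<noteq> 0\<^sub>v n" and n: "n \<noteq> 0"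
  shows "\<exists>w a. onb n w \<and> w 0 = a \<cdot>\<^sub>v v"
proof -
  interpret cof_vec_space n "TYPE(complex)" .
  define b where "b = basis_completion v"
  define ws where "ws = gram_schmidt n b"
  from basis_completion[OF v, folded b_def]
  have dist_b: "distinct b" and indep: "\<not> lin_dep (set b)" and b: "set b \<subseteq> carrier_vec n"
    and hdb: "hd b = v" and len_b: "length b = n" by auto
  from hdb len_b n obtain vs where bv: "b = v # vs" by (cases b, auto)
  from gram_schmidt_result[OF b dist_b indep refl, folded ws_def]
  have ws: "set ws \<subseteq> carrier_vec n" "corthogonal ws" "length ws = n" by (auto simp: len_b)
  from gram_schmidt_hd[OF v(1), of vs, folded bv] have hdws: "hd ws = v" unfolding ws_def .
  have car: "ws ! i \<in> carrier_vec n" if "i < n" for i using ws that by auto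
  define r where "r i = sqrt (Re (ws ! i \<bullet>c ws ! i))" for i
  define w where "w i = complex_of_real (1 / r i) \<cdot>\<^sub>v (ws ! i)" for i
  have r: "0 < r i" "complex_of_real (r i) * complex_of_real (r i) = ws ! i \<bullet>c ws ! i" if "i < n" for i
  proof -
    have "ws ! i \<bullet>c ws ! i \<noteq> 0" using corthogonalD[OF ws(2), of i i] ws(3) that by simp
    then have "ws ! i \<noteq> 0\<^sub>v n" by auto
    then have p: "0 < Re (ws ! i \<bullet>c ws ! i)" using cip_self_pos car[OF that] by blast
    then show "0 < r i" by (simp add: r_def)
    have "complex_of_real (r i) * complex_of_real (r i) = complex_of_real (r i * r i)" by simp
    also have "r i * r i = Re (ws ! i \<bullet>c ws ! i)" using p by (simp add: r_def)
    finally show "complex_of_real (r i) * complex_of_real (r i) = ws ! i \<bullet>c ws ! i"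
      using cip_self_real[OF car[OF that]] by simp
  qed
  have "onb n w"
    unfolding onb_def
  proof (intro conjI allI impI)
    show "w l \<in> carrier_vec n" if "l < n" for l using car[OF that] by (simp add: w_def)
    fix l m assume l: "l < n" and m: "m < n"
    have e: "w l \<bullet>c w m = complex_of_real (1 / r l) * (complex_of_real (1 / r m) * (ws ! l \<bullet>c ws ! m))"
      unfolding w_def using car[OF l] car[OF m]
      by (subst cip_smult_left[of _ n]) (auto simp: cip_smult_right[of _ n])
    show "w l \<bullet>c w m = (if l = m then 1 else 0)"
    proof (cases "l = m")
      case True
      have "complex_of_real (r m) \<noteq> 0" using r(1)[OF m] by simp
      then show ?thesis using e unfolding True r(2)[OF m, symmetric] by simp
    next
      case False
      then have "ws ! l \<bullet>c ws ! m = 0" using corthogonalD[OF ws(2)] ws(3) l m by simp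
      then show ?thesis using e False by simp
    qed
  qed
  moreover have "w 0 = complex_of_real (1 / r 0) \<cdot>\<^sub>v v"
    using hdws ws(3) n by (simp add: w_def hd_conv_nth[symmetric] length_greater_0_conv[symmetric] del: length_greater_0_conv)
  ultimately show ?thesis by blast
qed

lemma hermitian_eigenvector:
  assumes A: "hermitian_op n A" and n: "n \<noteq> 0"
  shows "\<exists>v e. v \<in> carrier_vec n \<and> v \<noteq> 0\<^sub>v n \<and> A *\<^sub>v v = complex_of_real e \<cdot>\<^sub>v v"
proof -
  note cA = hermitian_op_carrier[OF A]
  obtain as where as: "char_poly A = (\<Prod>a\<leftarrow>as. [:- a, 1:])" "length as = n"
    using char_poly_factorized[OF cA] by blast
  obtain e es where "as = e # es" using as(2) n by (cases as) auto
  then have "poly (char_poly A) e = 0" by (simp add: as(1))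
  then have "eigenvalue A e" using eigenvalue_root_char_poly[OF cA] by simp
  then obtain v where v: "v \<in> carrier_vec n" "v \<noteq> 0\<^sub>v n" "A *\<^sub>v v = e \<cdot>\<^sub>v v"
    using cA by (auto simp: eigenvalue_def eigenvector_def)
  have "e * (v \<bullet>c v) = cnj e * (v \<bullet>c v)"
    using hermitian_opD[OF A v(1) v(1)] unfolding v(3) cip_smult_left[OF v(1) v(1)] cip_smult_right[OF v(1) v(1)] .
  moreover have "v \<bullet>c v \<noteq> 0" using cip_self_pos[OF v(1,2)] by auto
  ultimately have "e = cnj e" by simp
  then have "e = complex_of_real (Re e)" by (simp add: complex_eq_iff)
  then show ?thesis using v by metis
qed

text \<open>
  Induction on the dimension, by splitting off an eigenvector \<open>w 0\<close>. The map \<open>E\<close> is the isometry from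
  dimension \<open>d\<close> onto the orthogonal complement of \<open>w 0\<close>, which is invariant because the operator is
  Hermitian, and \<open>A'\<close> is the operator transported along \<open>E\<close>.
\<close>

lemma spectral_theorem:
  assumes "hermitian_op d A"
  shows "\<exists>u x. onb d u \<and> A = spectral d u x"
  using assms
proof (induction d arbitrary: A)
  case 0
  have "A = spectral 0 u x" for u x by (rule eq_matI) (use hermitian_op_carrier[OF 0] in \<open>auto simp: spectral_def\<close>)
  then show ?case by (auto simp: onb_def)
next
  case (Suc d)
  note A = Suc.prems and cA = hermitian_op_carrier[OF Suc.prems]
  obtain v r where v: "v \<in> carrier_vec (Suc d)" "v \<noteq> 0\<^sub>v (Suc d)" "A *\<^sub>v v = complex_of_real r \<cdot>\<^sub>v v"
    using hermitian_eigenvector[OF A] by blast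
  obtain w a where w: "onb (Suc d) w" "w 0 = a \<cdot>\<^sub>v v" using extend_to_onb[OF v(1,2)] by blast
  have w0: "A *\<^sub>v w 0 = complex_of_real r \<cdot>\<^sub>v w 0"
    unfolding w(2) mult_mat_vec[OF cA v(1)] v(3) by (simp add: smult_smult_assoc mult.commute)
  have cw: "w l \<in> carrier_vec (Suc d)" if "l < Suc d" for l by (rule onb_carrier[OF w(1) that])
  have cAv: "A *\<^sub>v z \<in> carrier_vec (Suc d)" if "z \<in> carrier_vec (Suc d)" for z
    by (rule mult_mat_vec_carrier[OF cA that])
  define A' where "A' = mat d d (\<lambda>(i, j). (A *\<^sub>v w (Suc j)) \<bullet>c w (Suc i))"
  define E where "E z = Matrix.vec (Suc d) (\<lambda>r. \<Sum>i<d. z $ i * w (Suc i) $ r)" for z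
  have cE: "E z \<in> carrier_vec (Suc d)" for z by (simp add: E_def)
  have Ew: "E z \<bullet>c w l = (\<Sum>i<d. z $ i * (w (Suc i) \<bullet>c w l))" if l: "l < Suc d" for z l
  proof -
    have "E z \<bullet>c w l = (\<Sum>r<Suc d. \<Sum>i<d. z $ i * (w (Suc i) $ r * cnj (w l $ r)))"
      unfolding cip_eq_sum[OF cw[OF l]]
      by (intro sum.cong refl) (simp add: E_def sum_distrib_right mult.assoc)
    also have "\<dots> = (\<Sum>i<d. z $ i * (\<Sum>r<Suc d. w (Suc i) $ r * cnj (w l $ r)))"
      by (subst sum.swap) (simp only: sum_distrib_left)
    finally show ?thesis unfolding cip_eq_sum[OF cw[OF l]] .
  qed
  have Ew0: "E z \<bullet>c w 0 = 0" for z
    unfolding Ew[OF zero_less_Suc] by (intro sum.neutral) (simp add: onb_cip[OF w(1)])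
  have EwS: "E z \<bullet>c w (Suc j) = z $ j" if "j < d" for z j
  proof -
    have "E z \<bullet>c w (Suc j) = (\<Sum>i<d. z $ i * (if i = j then 1 else 0))"
      unfolding Ew[OF Suc_mono[OF that]] using that by (intro sum.cong refl) (simp add: onb_cip[OF w(1)])
    then show ?thesis using that by (simp add: if_distrib cong: if_cong)
  qed
  have EE: "E z \<bullet>c E y = z \<bullet>c y" if y: "y \<in> carrier_vec d" for z y
    unfolding parseval[OF w(1) cE cE, symmetric] sum.lessThan_Suc_shift cip_eq_sum[OF y]
    by (simp add: Ew0 EwS)
  have cA': "A' \<in> carrier_mat d d" by (simp add: A'_def)
  have AEw0: "(A *\<^sub>v E z) \<bullet>c w 0 = 0" for z
    unfolding hermitian_opD[OF A cE cw[OF zero_less_Suc]] w0 cip_smult_right[OF cE cw[OF zero_less_Suc]] Ew0 by simp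
  have AEwS: "(A *\<^sub>v E z) \<bullet>c w (Suc i) = (A' *\<^sub>v z) $ i" if i: "i < d" and z: "z \<in> carrier_vec d" for z i
  proof -
    have Si: "Suc i < Suc d" using i by simp
    have "(A *\<^sub>v E z) \<bullet>c w (Suc i) = E z \<bullet>c (A *\<^sub>v w (Suc i))"
      by (rule hermitian_opD[OF A cE cw[OF Si]])
    also have "\<dots> = (\<Sum>j<d. z $ j * cnj ((A *\<^sub>v w (Suc i)) \<bullet>c w (Suc j)))"
      unfolding parseval[OF w(1) cE cAv[OF cw[OF Si]], symmetric] sum.lessThan_Suc_shift
      by (simp add: Ew0 EwS)
    also have "\<dots> = (\<Sum>j<d. A' $$ (i, j) * z $ j)"
    proof (intro sum.cong refl)
      fix j assume "j \<in> {..<d}"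
      then have j: "j < d" and Sj: "Suc j < Suc d" by auto
      have "cnj ((A *\<^sub>v w (Suc i)) \<bullet>c w (Suc j)) = w (Suc j) \<bullet>c (A *\<^sub>v w (Suc i))"
        by (rule cip_commute[OF cw[OF Sj] cAv[OF cw[OF Si]], symmetric])
      also have "\<dots> = (A *\<^sub>v w (Suc j)) \<bullet>c w (Suc i)"
        by (rule hermitian_opD[OF A cw[OF Sj] cw[OF Si], symmetric])
      finally show "z $ j * cnj ((A *\<^sub>v w (Suc i)) \<bullet>c w (Suc j)) = A' $$ (i, j) * z $ j"
        using i j by (simp add: A'_def)
    qed
    also have "\<dots> = (A' *\<^sub>v z) $ i" by (rule mat_vec_index[OF cA' z i, symmetric])
    finally show ?thesis .
  qed
  have AE: "A *\<^sub>v E z = E (A' *\<^sub>v z)" if z: "z \<in> carrier_vec d" for z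
  proof (rule onb_vec_eqI[OF w(1) cAv[OF cE] cE])
    fix l assume "l < Suc d"
    then show "(A *\<^sub>v E z) \<bullet>c w l = E (A' *\<^sub>v z) \<bullet>c w l"
      by (cases l) (simp_all add: AEw0 Ew0 AEwS EwS z)
  qed
  have "hermitian_op d A'"
    unfolding hermitian_op_def
  proof (intro conjI ballI cA')
    fix z y :: "complex vec" assume z: "z \<in> carrier_vec d" and y: "y \<in> carrier_vec d"
    have "(A' *\<^sub>v z) \<bullet>c y = (A *\<^sub>v E z) \<bullet>c E y" unfolding AE[OF z] EE[OF y] ..
    also have "\<dots> = E z \<bullet>c (A *\<^sub>v E y)" by (rule hermitian_opD[OF A cE cE])
    also have "\<dots> = z \<bullet>c (A' *\<^sub>v y)" unfolding AE[OF y] EE[OF mult_mat_vec_carrier[OF cA' y]] ..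
    finally show "(A' *\<^sub>v z) \<bullet>c y = z \<bullet>c (A' *\<^sub>v y)" .
  qed
  from Suc.IH[OF this] obtain u x where u: "onb d u" "A' = spectral d u x" by blast
  define u' where "u' l = (case l of 0 \<Rightarrow> w 0 | Suc k \<Rightarrow> E (u k))" for l
  define x' where "x' l = (case l of 0 \<Rightarrow> r | Suc k \<Rightarrow> x k)" for l
  have cu: "u l \<in> carrier_vec d" if "l < d" for l by (rule onb_carrier[OF u(1) that])
  have w0E: "w 0 \<bullet>c E z = 0" for z
    using cip_commute[OF cw[OF zero_less_Suc] cE, of z] Ew0 by simp
  have "onb (Suc d) u'"
    unfolding onb_def
  proof (intro conjI allI impI)
    show "u' l \<in> carrier_vec (Suc d)" if "l < Suc d" for l
      using that cE cw[of 0] by (cases l) (auto simp: u'_def)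
    show "u' l \<bullet>c u' m = (if l = m then 1 else 0)" if "l < Suc d" "m < Suc d" for l m
      using that onb_cip[OF w(1), of 0 0] onb_cip[OF u(1)]
      by (cases l; cases m) (simp_all add: u'_def Ew0 w0E EE cu)
  qed
  moreover have "A = spectral (Suc d) u' x'"
  proof (rule spectralI[OF calculation cA])
    fix l assume l: "l < Suc d"
    show "A *\<^sub>v u' l = complex_of_real (x' l) \<cdot>\<^sub>v u' l"
    proof (cases l)
      case 0
      then show ?thesis using w0 by (simp add: u'_def x'_def)
    next
      case (Suc k)
      with l have k: "k < d" by simp
      have "A *\<^sub>v u' l = E (complex_of_real (x k) \<cdot>\<^sub>v u k)"
        using AE[OF cu[OF k]] spectral_eigen[OF u(1) k] by (simp add: u'_def Suc u(2))
      also have "\<dots> = complex_of_real (x k) \<cdot>\<^sub>v E (u k)"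
        by (rule eq_vecI) (use cu[OF k] in \<open>auto simp: E_def sum_distrib_left mult.assoc\<close>)
      finally show ?thesis by (simp add: Suc u'_def x'_def)
    qed
  qed
  ultimately show ?case by blast
qed

lemma spectral_theorem_sorted:
  assumes "hermitian_op d A"
  shows "\<exists>u x. onb d u \<and> A = spectral d u x \<and> nonincreasing d x"
proof -
  obtain u x where u: "onb d u" "A = spectral d u x" using spectral_theorem[OF assms] by blast
  then show ?thesis
    using onb_permute[OF sorting_bij u(1)] spectral_permute[OF sorting_bij] sorting_nonincreasing by metis
qed

section \<open>Weyl monotonicity and Lidskii's inequality\<close>

lemma quadratic_form_spectral:
  assumes u: "onb d u" and v: "v \<in> carrier_vec d"
  shows "Re ((spectral d u x *\<^sub>v v) \<bullet>c v) = (\<Sum>l<d. x l * (cmod (v \<bullet>c u l))\<^sup>2)"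
proof -
  have "(spectral d u x *\<^sub>v v) \<bullet>c v = complex_of_real (\<Sum>l<d. x l * (cmod (v \<bullet>c u l))\<^sup>2)"
    unfolding spectral_form[OF u v v] of_real_sum of_real_mult complex_norm_square
    by (simp add: mult.assoc)
  then show ?thesis by simp
qed

text \<open>
  The zero row encodes a homogeneous system with fewer equations than unknowns.
\<close>

lemma nontrivial_kernel_zero_row:
  fixes M :: "complex mat"
  assumes M: "M \<in> carrier_mat n n" and i: "i < n" and z: "\<And>j. j < n \<Longrightarrow> M $$ (i, j) = 0"
  shows "\<exists>c. c \<in> carrier_vec n \<and> c \<noteq> 0\<^sub>v n \<and> M *\<^sub>v c = 0\<^sub>v n"
proof -
  have "det M = 0"
    unfolding det_def'[OF M]
  proof (intro sum.neutral ballI)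
    fix p assume "p \<in> {p. p permutes {0..<n}}"
    then have "p i < n" using i permutes_in_image[of p "{0..<n}" i] by auto
    then have "(\<Prod>k = 0..<n. M $$ (k, p k)) = 0" using i z by (auto intro!: prod_zero bexI[of _ i])
    then show "signof p * (\<Prod>k = 0..<n. M $$ (k, p k)) = 0" by simp
  qed
  then show ?thesis using det_0_iff_vec_prod_zero[OF M] by simp
qed

text \<open>
  A dimension count: some nonzero \<open>v\<close> in the span of \<open>u 0, \<dots>, u i\<close> is orthogonal to
  \<open>w 0, \<dots>, w (i - 1)\<close>. On this \<open>v\<close> the first form is at least \<open>x i\<close> times the squared norm, and the
  second one at most \<open>y i\<close> times it.
\<close>

lemma weyl_monotone:
  assumes u: "onb d u" and w: "onb d w" and x: "nonincreasing d x" and y: "nonincreasing d y"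
    and le: "\<And>v. v \<in> carrier_vec d \<Longrightarrow>
      Re ((spectral d u x *\<^sub>v v) \<bullet>c v) \<le> Re ((spectral d w y *\<^sub>v v) \<bullet>c v)"
    and i: "i < d"
  shows "x i \<le> y i"
proof -
  define M where "M = mat (Suc i) (Suc i) (\<lambda>(j, l). if j < i then u l \<bullet>c w j else 0)"
  have cM: "M \<in> carrier_mat (Suc i) (Suc i)" by (simp add: M_def)
  obtain c where c: "c \<in> carrier_vec (Suc i)" "c \<noteq> 0\<^sub>v (Suc i)" "M *\<^sub>v c = 0\<^sub>v (Suc i)"
    using nontrivial_kernel_zero_row[OF cM, of i] by (auto simp: M_def)
  obtain v where v: "v \<in> carrier_vec d" and vu: "\<And>l. l < d \<Longrightarrow> v \<bullet>c u l = (if l \<le> i then c $ l else 0)"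
    using onb_combination[OF u, of "\<lambda>l. if l \<le> i then c $ l else 0"] by blast
  have vw: "v \<bullet>c w j = 0" if j: "j < i" for j
  proof -
    have jd: "j < d" using i j by simp
    have "v \<bullet>c w j = (\<Sum>l<d. (v \<bullet>c u l) * cnj (w j \<bullet>c u l))"
      by (rule parseval[OF u v onb_carrier[OF w jd], symmetric])
    also have "\<dots> = (\<Sum>l<Suc i. (v \<bullet>c u l) * cnj (w j \<bullet>c u l))"
      by (rule sum.mono_neutral_right) (use i vu in auto)
    also have "\<dots> = (\<Sum>l<Suc i. M $$ (j, l) * c $ l)"
      by (rule sum.cong) (use i j vu cip_commute[OF onb_carrier[OF u] onb_carrier[OF w jd]] in \<open>auto simp: M_def\<close>)
    also have "\<dots> = (M *\<^sub>v c) $ j" by (rule mat_vec_index[OF cM c(1), symmetric]) (use j in simp)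
    finally show ?thesis using c(3) j by simp
  qed
  have nz: "0 < Re (v \<bullet>c v)"
  proof -
    obtain m where m: "m < Suc i" "c $ m \<noteq> 0" using c(1,2) by (metis carrier_vecD eq_vecI index_zero_vec(1) index_zero_vec(2))
    then have "v \<bullet>c u m \<noteq> 0" using vu[of m] i by simp
    then have "v \<noteq> 0\<^sub>v d" using onb_carrier[OF u, of m] m i by auto
    then show ?thesis using cip_self_pos[OF v] by simp
  qed
  have "x i * Re (v \<bullet>c v) = (\<Sum>l<d. x i * (cmod (v \<bullet>c u l))\<^sup>2)"
    unfolding parseval_norm[OF u v, symmetric] sum_distrib_left ..
  also have "\<dots> \<le> (\<Sum>l<d. x l * (cmod (v \<bullet>c u l))\<^sup>2)"
  proof (rule sum_mono)
    fix l assume "l \<in> {..<d}"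
    then show "x i * (cmod (v \<bullet>c u l))\<^sup>2 \<le> x l * (cmod (v \<bullet>c u l))\<^sup>2"
      using vu[of l] nonincreasingD[OF x, of l i] i by (cases "l \<le> i") (auto intro: mult_right_mono)
  qed
  also have "\<dots> = Re ((spectral d u x *\<^sub>v v) \<bullet>c v)" by (rule quadratic_form_spectral[OF u v, symmetric])
  also have "\<dots> \<le> Re ((spectral d w y *\<^sub>v v) \<bullet>c v)" by (rule le[OF v])
  also have "\<dots> = (\<Sum>l<d. y l * (cmod (v \<bullet>c w l))\<^sup>2)" by (rule quadratic_form_spectral[OF w v])
  also have "\<dots> \<le> (\<Sum>l<d. y i * (cmod (v \<bullet>c w l))\<^sup>2)"
  proof (rule sum_mono)
    fix l assume "l \<in> {..<d}"
    then show "y l * (cmod (v \<bullet>c w l))\<^sup>2 \<le> y i * (cmod (v \<bullet>c w l))\<^sup>2"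
      using vw[of l] nonincreasingD[OF y, of i l] by (cases "l < i") (auto intro: mult_right_mono)
  qed
  also have "\<dots> = y i * Re (v \<bullet>c v)"
    unfolding parseval_norm[OF w v, symmetric] sum_distrib_left ..
  finally show ?thesis using nz by simp
qed

lemma mat_trace_add: "A \<in> carrier_mat d d \<Longrightarrow> B \<in> carrier_mat d d \<Longrightarrow> mat_trace (A + B) = mat_trace A + mat_trace B"
  by (simp add: mat_trace_def diag_mat_def sum_list_sum_nth sum.distrib)

lemma spectral_sum_trace:
  assumes "onb d u" "onb d w" "onb d t" "spectral d t z = spectral d u x + spectral d w y"
  shows "(\<Sum>l<d. z l) = (\<Sum>l<d. x l) + (\<Sum>l<d. y l)"
proof -
  have "complex_of_real (\<Sum>l<d. z l) = complex_of_real ((\<Sum>l<d. x l) + (\<Sum>l<d. y l))"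
    using mat_trace_spectral[OF assms(3), of z] mat_trace_spectral[OF assms(1), of x] 
      mat_trace_spectral[OF assms(2), of y] mat_trace_add[OF spectral_carrier spectral_carrier, of d u x w y] assms(4) 
    by simp
  then show ?thesis by (simp only: of_real_eq_iff)
qed

lemma quadratic_form_add:
  assumes "A \<in> carrier_mat d d" "B \<in> carrier_mat d d" "v \<in> carrier_vec d"
  shows "Re (((A + B) *\<^sub>v v) \<bullet>c v) = Re ((A *\<^sub>v v) \<bullet>c v) + Re ((B *\<^sub>v v) \<bullet>c v)"
  unfolding add_mult_distrib_mat_vec[OF assms]
  using cip_add_left[of "A *\<^sub>v v" d "B *\<^sub>v v" v] assms by simp

text \<open>
  The argument of Li and Mathias. Let \<open>A\<close>, \<open>B\<close>, \<open>C = A + B\<close> have the spectra \<open>x\<close>, \<open>y\<close>, \<open>z\<close>. With \<open>\<tau>\<close> the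
  smallest of the \<open>card I\<close> largest eigenvalues of \<open>C\<close> and \<open>C\<^sub>+\<close> the positive part of \<open>C - \<tau>\<close>, put
  \<open>M = C\<^sub>+ - B\<close>. Then \<open>A \<le> M + \<tau>\<close> and \<open>- B \<le> M\<close>, so Weyl monotonicity gives \<open>x i \<le> m i + \<tau>\<close> and
  \<open>0 \<le> m i + y i\<close>. The sum of \<open>m i + y i\<close> over \<open>I\<close> is thus at most the sum over all indices,
  which is the trace of \<open>C\<^sub>+\<close>.
\<close>

lemma lidskii:
  assumes u: "onb d u" and w: "onb d w" and t: "onb d t"
    and x: "nonincreasing d x" and y: "nonincreasing d (\<lambda>l. - y l)" and z: "nonincreasing d z"
    and sum: "spectral d t z = spectral d u x + spectral d w y"
    and I: "I \<subseteq> {..<d}"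
  shows "(\<Sum>i\<in>I. x i + y i) \<le> (\<Sum>i<card I. z i)"
proof (cases "I = {}")
  case False
  have fI: "finite I" using I finite_subset by blast
  have k: "0 < card I" "card I \<le> d" using False fI card_mono[OF _ I] by (auto simp: card_gt_0_iff)
  define \<tau> where "\<tau> = z (card I - 1)"
  define zp where "zp l = max (z l - \<tau>) 0" for l
  define M where "M = spectral d t zp + spectral d w (\<lambda>l. - y l)"
  have "hermitian_op d M" unfolding M_def by (intro hermitian_op_add hermitian_spectral t w)
  then obtain s m where s: "onb d s" "M = spectral d s m" "nonincreasing d m"
    using spectral_theorem_sorted by blast
  have formM: "(\<Sum>l<d. m l * (cmod (v \<bullet>c s l))\<^sup>2)
      = (\<Sum>l<d. zp l * (cmod (v \<bullet>c t l))\<^sup>2) - (\<Sum>l<d. y l * (cmod (v \<bullet>c w l))\<^sup>2)" if v: "v \<in> carrier_vec d" for v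
    using quadratic_form_add[OF spectral_carrier spectral_carrier v, of t zp w "\<lambda>l. - y l"]
    unfolding M_def[symmetric] s(2) quadratic_form_spectral[OF s(1) v] quadratic_form_spectral[OF t v]
      quadratic_form_spectral[OF w v] by (simp add: sum_negf)
  have xm: "x i \<le> m i + \<tau>" if "i < d" for i
  proof (rule weyl_monotone[OF u s(1) x _ _ that])
    show "nonincreasing d (\<lambda>i. m i + \<tau>)" using s(3) by (simp add: nonincreasing_def)
    fix v :: "complex vec" assume v: "v \<in> carrier_vec d"
    have "(\<Sum>l<d. x l * (cmod (v \<bullet>c u l))\<^sup>2) + (\<Sum>l<d. y l * (cmod (v \<bullet>c w l))\<^sup>2) = (\<Sum>l<d. z l * (cmod (v \<bullet>c t l))\<^sup>2)"
      using quadratic_form_add[OF spectral_carrier spectral_carrier v, of u x w y]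
      unfolding sum[symmetric] quadratic_form_spectral[OF u v] quadratic_form_spectral[OF t v]
      quadratic_form_spectral[OF w v] by simp
    also have "\<dots> \<le> (\<Sum>l<d. (zp l + \<tau>) * (cmod (v \<bullet>c t l))\<^sup>2)"
      by (intro sum_mono mult_right_mono) (auto simp: zp_def)
    also have "\<dots> = (\<Sum>l<d. zp l * (cmod (v \<bullet>c t l))\<^sup>2) + \<tau> * Re (v \<bullet>c v)"
      unfolding parseval_norm[OF t v, symmetric] by (simp add: distrib_right sum.distrib sum_distrib_left)
    finally have "(\<Sum>l<d. x l * (cmod (v \<bullet>c u l))\<^sup>2) \<le> (\<Sum>l<d. m l * (cmod (v \<bullet>c s l))\<^sup>2) + \<tau> * Re (v \<bullet>c v)"
      using formM[OF v] by simp
    also have "\<dots> = (\<Sum>l<d. (m l + \<tau>) * (cmod (v \<bullet>c s l))\<^sup>2)"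
      unfolding parseval_norm[OF s(1) v, symmetric] by (simp add: distrib_right sum.distrib sum_distrib_left)
    finally show "Re ((spectral d u x *\<^sub>v v) \<bullet>c v) \<le> Re ((spectral d s (\<lambda>i. m i + \<tau>) *\<^sub>v v) \<bullet>c v)"
      unfolding quadratic_form_spectral[OF u v] quadratic_form_spectral[OF s(1) v] .
  qed
  have ym: "- y i \<le> m i" if "i < d" for i
  proof (rule weyl_monotone[OF w s(1) y s(3) _ that])
    fix v :: "complex vec" assume v: "v \<in> carrier_vec d"
    have "0 \<le> (\<Sum>l<d. zp l * (cmod (v \<bullet>c t l))\<^sup>2)" by (intro sum_nonneg mult_nonneg_nonneg) (auto simp: zp_def)
    then show "Re ((spectral d w (\<lambda>l. - y l) *\<^sub>v v) \<bullet>c v) \<le> Re ((spectral d s m *\<^sub>v v) \<bullet>c v)"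
      unfolding quadratic_form_spectral[OF w v] quadratic_form_spectral[OF s(1) v] formM[OF v] by (simp add: sum_negf)
  qed
  have tr: "(\<Sum>l<d. m l) = (\<Sum>l<d. zp l) - (\<Sum>l<d. y l)"
    using spectral_sum_trace[OF t w s(1), of m zp "\<lambda>l. - y l"] s(2) by (simp add: M_def sum_negf)
  have "(\<Sum>i\<in>I. x i + y i) \<le> (\<Sum>i\<in>I. \<tau> + (m i + y i))" using xm I by (intro sum_mono) (force simp: algebra_simps)
  also have "\<dots> = card I * \<tau> + (\<Sum>i\<in>I. m i + y i)" by (simp add: sum.distrib)
  also have "(\<Sum>i\<in>I. m i + y i) \<le> (\<Sum>i<d. m i + y i)"
    by (rule sum_mono2) (use I ym in \<open>force+\<close>)
  also have "(\<Sum>i<d. m i + y i) = (\<Sum>l<d. zp l)" using tr by (simp add: sum.distrib)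
  also have "\<dots> = (\<Sum>l<card I. z l - \<tau>)"
  proof -
    have "(\<Sum>l<d. zp l) = (\<Sum>l<card I. zp l)"
    proof (rule sum.mono_neutral_right)
      show "\<forall>i\<in>{..<d} - {..<card I}. zp i = 0"
        using nonincreasingD[OF z, of "card I - 1"] by (auto simp: zp_def \<tau>_def)
    qed (use k in auto)
    also have "\<dots> = (\<Sum>l<card I. z l - \<tau>)"
      using nonincreasingD[OF z, of _ "card I - 1"] k by (intro sum.cong refl) (auto simp: zp_def \<tau>_def)
    finally show ?thesis .
  qed
  finally show ?thesis by (simp add: sum_subtractf)
qed simp

section \<open>Frame operators\<close>

lemma mat_eqI_form:
  fixes A B :: "complex mat"
  assumes u: "onb d u" and A: "A \<in> carrier_mat d d" "B \<in> carrier_mat d d"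
    and eq: "\<And>v w. v \<in> carrier_vec d \<Longrightarrow> w \<in> carrier_vec d \<Longrightarrow> (A *\<^sub>v v) \<bullet>c w = (B *\<^sub>v v) \<bullet>c w"
  shows "A = B"
proof (rule mat_eqI_onb[OF u A])
  fix l assume l: "l < d"
  note ul = onb_carrier[OF u l]
  show "A *\<^sub>v u l = B *\<^sub>v u l"
    by (rule onb_vec_eqI[OF u mult_mat_vec_carrier[OF A(1) ul] mult_mat_vec_carrier[OF A(2) ul]])
      (rule eq[OF ul onb_carrier[OF u]])
qed

lemma rank_one_form:
  assumes g: "g \<in> carrier_vec d" and v: "v \<in> carrier_vec d" and w: "w \<in> carrier_vec d"
  shows "(rank_one g g *\<^sub>v v) \<bullet>c w = (v \<bullet>c g) * cnj (w \<bullet>c g)"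
proof -
  have c: "rank_one g g \<in> carrier_mat d d" using g by (simp add: rank_one_def)
  have "(rank_one g g *\<^sub>v v) $ i = (v \<bullet>c g) * g $ i" if i: "i < d" for i
    unfolding mat_vec_index[OF c v i] cip_eq_sum[OF g] sum_distrib_right
    using g i by (intro sum.cong refl) (simp add: rank_one_def mult_ac)
  then have "(rank_one g g *\<^sub>v v) \<bullet>c w = (v \<bullet>c g) * (g \<bullet>c w)"
    unfolding cip_eq_sum[OF w] by (simp add: sum_distrib_left mult.assoc)
  then show ?thesis using cip_commute[OF g w] by simp
qed

lemma frame_op_Cons: "frame_op d (g # G) = rank_one g g + frame_op d G"
  and frame_op_Nil: "frame_op d [] = 0\<^sub>m d d"
  by (simp_all add: frame_op_def)

lemma rank_one_carrier: "g \<in> carrier_vec d \<Longrightarrow> rank_one g g \<in> carrier_mat d d"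
  by (simp add: rank_one_def)

lemma frame_op_carrier: "set G \<subseteq> carrier_vec d \<Longrightarrow> frame_op d G \<in> carrier_mat d d"
  by (induction G) (auto simp: frame_op_Cons frame_op_Nil rank_one_carrier)

lemma frame_op_append:
  assumes "set F \<subseteq> carrier_vec d" "set G \<subseteq> carrier_vec d"
  shows "frame_op d (F @ G) = frame_op d F + frame_op d G"
  using assms(1)
proof (induction F)
  case Nil
  then show ?case using frame_op_carrier[OF assms(2)] by (simp add: frame_op_Nil)
next
  case (Cons g F)
  then have "rank_one g g \<in> carrier_mat d d" "frame_op d F \<in> carrier_mat d d" "frame_op d G \<in> carrier_mat d d"
    using assms(2) by (auto simp: rank_one_carrier frame_op_carrier)
  then show ?case using Cons by (simp add: frame_op_Cons assoc_add_mat)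
qed

lemma frame_op_form:
  assumes "set G \<subseteq> carrier_vec d" and v: "v \<in> carrier_vec d" and w: "w \<in> carrier_vec d"
  shows "(frame_op d G *\<^sub>v v) \<bullet>c w = (\<Sum>i<length G. (v \<bullet>c G ! i) * cnj (w \<bullet>c G ! i))"
  using assms(1)
proof (induction G)
  case Nil
  have "(0\<^sub>m d d *\<^sub>v v) \<bullet>c w = 0" unfolding cip_eq_sum[OF w] 
    by (intro sum.neutral) (use v in simp)
  then show ?case by (simp add: frame_op_Nil)
next
  case (Cons g G)
  then have c: "rank_one g g \<in> carrier_mat d d" "frame_op d G \<in> carrier_mat d d" and g: "g \<in> carrier_vec d"
    by (auto simp: rank_one_carrier frame_op_carrier)
  have "(frame_op d (g # G) *\<^sub>v v) \<bullet>c w = (rank_one g g *\<^sub>v v) \<bullet>c w + (frame_op d G *\<^sub>v v) \<bullet>c w"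
    unfolding frame_op_Cons add_mult_distrib_mat_vec[OF c v]
    by (rule cip_add_left[OF mult_mat_vec_carrier[OF c(1) v] mult_mat_vec_carrier[OF c(2) v] w])
  then show ?case using Cons rank_one_form[OF g v w]
    unfolding length_Cons sum.lessThan_Suc_shift by simp
qed

lemma frame_op_hermitian:
  assumes G: "set G \<subseteq> carrier_vec d" shows "hermitian_op d (frame_op d G)"
  unfolding hermitian_op_def
proof (intro conjI ballI frame_op_carrier[OF G])
  fix v w :: "complex vec" assume v: "v \<in> carrier_vec d" and w: "w \<in> carrier_vec d"
  have "v \<bullet>c (frame_op d G *\<^sub>v w) = cnj ((frame_op d G *\<^sub>v w) \<bullet>c v)"
    by (rule cip_commute[OF v mult_mat_vec_carrier[OF frame_op_carrier[OF G] w]])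
  then show "(frame_op d G *\<^sub>v v) \<bullet>c w = v \<bullet>c (frame_op d G *\<^sub>v w)"
    by (simp add: frame_op_form[OF G v w] frame_op_form[OF G w v] mult.commute)
qed

lemma frame_op_spectral:
  assumes "set G \<subseteq> carrier_vec d"
  shows "\<exists>u x. onb d u \<and> frame_op d G = spectral d u x \<and> nonincreasing d x"
  by (rule spectral_theorem_sorted[OF frame_op_hermitian[OF assms]])

lemma frame_op_eigenvalue_eq:
  assumes G: "set G \<subseteq> carrier_vec d" and u: "onb d u" and S: "frame_op d G = spectral d u y" and l: "l < d"
  shows "y l = (\<Sum>i<length G. (cmod (G ! i \<bullet>c u l))\<^sup>2)"
proof -
  note ul = onb_carrier[OF u l]
  have "complex_of_real (y l) = (frame_op d G *\<^sub>v u l) \<bullet>c u l"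
    unfolding S spectral_eigen[OF u l] cip_smult_left[OF ul ul] onb_cip[OF u l l] by simp
  also have "\<dots> = (\<Sum>i<length G. (u l \<bullet>c G ! i) * cnj (u l \<bullet>c G ! i))" by (rule frame_op_form[OF G ul ul])
  also have "\<dots> = complex_of_real (\<Sum>i<length G. (cmod (G ! i \<bullet>c u l))\<^sup>2)"
    unfolding of_real_sum complex_norm_square
  proof (intro sum.cong refl)
    fix i assume "i \<in> {..<length G}"
    then have "G ! i \<in> carrier_vec d" using G by auto
    then show "(u l \<bullet>c G ! i) * cnj (u l \<bullet>c G ! i) = (G ! i \<bullet>c u l) * cnj (G ! i \<bullet>c u l)"
      using cip_commute[OF ul, of "G ! i"] by simp
  qed
  finally show ?thesis by (simp only: of_real_eq_iff)
qed

lemma frame_op_eigenvalue_nonneg: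
  assumes "set G \<subseteq> carrier_vec d" "onb d u" "frame_op d G = spectral d u y" "l < d"
  shows "0 \<le> y l"
  using frame_op_eigenvalue_eq[OF assms] by (simp add: sum_nonneg)

section \<open>The Schur-Horn theorem for frames\<close>

text \<open>
  Bessel's inequality, obtained by testing the frame operator \<open>S\<close> on \<open>h = S\<^sup>-\<^sup>1 g\<close>, where \<open>g\<close> is the
  vector in question: the sum \<open>q\<close> equals both \<open>\<langle>h, g\<rangle>\<close> and \<open>\<langle>S h, h\<rangle>\<close>, and the latter is at least
  \<open>q\<^sup>2\<close>. Division by zero makes the directions in the kernel of \<open>S\<close> drop out on both sides.
\<close>

lemma frame_vector_bessel:
  assumes G: "set G \<subseteq> carrier_vec d" and u: "onb d u" and S: "frame_op d G = spectral d u y" and i: "i < length G"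
  shows "(\<Sum>l<d. (cmod (G ! i \<bullet>c u l))\<^sup>2 / y l) \<le> 1"
proof -
  define c where "c l = G ! i \<bullet>c u l" for l
  define q where "q = (\<Sum>l<d. (cmod (c l))\<^sup>2 / y l)"
  obtain h where h: "h \<in> carrier_vec d" "\<And>l. l < d \<Longrightarrow> h \<bullet>c u l = c l / complex_of_real (y l)"
    using onb_combination[OF u, of "\<lambda>l. c l / complex_of_real (y l)"] by blast
  have gi: "G ! i \<in> carrier_vec d" using G i by auto
  have hg: "h \<bullet>c G ! i = complex_of_real q"
    unfolding parseval[OF u h(1) gi, symmetric] q_def of_real_sum of_real_divide complex_norm_square
    by (intro sum.cong refl) (simp add: h(2) c_def)
  have "Re ((frame_op d G *\<^sub>v h) \<bullet>c h) = (\<Sum>l<d. y l * (cmod (c l / complex_of_real (y l)))\<^sup>2)"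
    unfolding S quadratic_form_spectral[OF u h(1)] by (intro sum.cong refl) (simp add: h(2))
  also have "\<dots> = q"
    unfolding q_def by (intro sum.cong refl) (simp add: norm_divide power2_eq_square)
  finally have 1: "Re ((frame_op d G *\<^sub>v h) \<bullet>c h) = q" .
  have "(frame_op d G *\<^sub>v h) \<bullet>c h = complex_of_real (\<Sum>j<length G. (cmod (h \<bullet>c G ! j))\<^sup>2)"
    unfolding frame_op_form[OF G h(1) h(1)] of_real_sum complex_norm_square ..
  then have "q = (\<Sum>j<length G. (cmod (h \<bullet>c G ! j))\<^sup>2)" using 1 by simp
  also have "\<dots> \<ge> (cmod (h \<bullet>c G ! i))\<^sup>2" by (rule member_le_sum) (use i in auto)
  finally have "q\<^sup>2 \<le> q" unfolding hg by (simp add: norm_of_real)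
  then have "q \<le> 1"
    using mult_strict_left_mono[of 1 q q] by (cases "q \<le> 1") (auto simp: power2_eq_square)
  then show ?thesis by (simp add: q_def c_def)
qed

text \<open>
  The necessary half of the Schur-Horn theorem with its weights made explicit: \<open>p l\<close> is the share of
  the eigenvalue \<open>y l\<close> that is due to the vectors with index in \<open>I\<close>, and Bessel's inequality bounds the
  total weight by the number of these vectors.
\<close>

lemma frame_norm_weights:
  assumes G: "set G \<subseteq> carrier_vec d" and u: "onb d u" and S: "frame_op d G = spectral d u y"
    and I: "I \<subseteq> {..<length G}"
  shows "\<exists>p. (\<forall>l<d. 0 \<le> p l \<and> p l \<le> 1 \<and> p l * y l = (\<Sum>i\<in>I. (cmod (G ! i \<bullet>c u l))\<^sup>2)) \<and>
     (\<Sum>l<d. p l) \<le> real (card I) \<and> (\<Sum>i\<in>I. Re (G ! i \<bullet>c G ! i)) = (\<Sum>l<d. p l * y l)"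
proof -
  define p where "p l = (\<Sum>i\<in>I. (cmod (G ! i \<bullet>c u l))\<^sup>2 / y l)" for l
  have fI: "finite I" using I finite_subset by blast
  have y: "y l = (\<Sum>i<length G. (cmod (G ! i \<bullet>c u l))\<^sup>2)" if "l < d" for l
    by (rule frame_op_eigenvalue_eq[OF G u S that])
  have le: "(\<Sum>i\<in>I. (cmod (G ! i \<bullet>c u l))\<^sup>2) \<le> y l" if "l < d" for l
    unfolding y[OF that] by (rule sum_mono2) (use I in auto)
  have y0: "0 \<le> y l" if "l < d" for l unfolding y[OF that] by (simp add: sum_nonneg)
  have p1: "p l * y l = (\<Sum>i\<in>I. (cmod (G ! i \<bullet>c u l))\<^sup>2)" if l: "l < d" for l
  proof (cases "y l = 0")
    case True
    have "0 \<le> (\<Sum>i\<in>I. (cmod (G ! i \<bullet>c u l))\<^sup>2)" by (simp add: sum_nonneg)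
    with True le[OF l] show ?thesis by simp
  qed (simp add: p_def sum_divide_distrib[symmetric])
  have p2: "0 \<le> p l" "p l \<le> 1" if l: "l < d" for l
  proof -
    show "0 \<le> p l" using y0[OF l] by (simp add: p_def sum_nonneg)
    show "p l \<le> 1" using le[OF l] y0[OF l] by (simp add: p_def sum_divide_distrib[symmetric] divide_le_eq_1 less_le)
  qed
  have "(\<Sum>l<d. p l) = (\<Sum>i\<in>I. \<Sum>l<d. (cmod (G ! i \<bullet>c u l))\<^sup>2 / y l)" unfolding p_def by (rule sum.swap)
  also have "\<dots> \<le> (\<Sum>i\<in>I. 1)" by (intro sum_mono frame_vector_bessel[OF G u S]) (use I in auto)
  finally have p3: "(\<Sum>l<d. p l) \<le> real (card I)" by simp
  have "(\<Sum>i\<in>I. Re (G ! i \<bullet>c G ! i)) = (\<Sum>i\<in>I. \<Sum>l<d. (cmod (G ! i \<bullet>c u l))\<^sup>2)"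
    by (intro sum.cong refl parseval_norm[OF u, symmetric]) (meson I G nth_mem subsetD lessThan_iff)
  also have "\<dots> = (\<Sum>l<d. p l * y l)" by (subst sum.swap) (simp add: p1)
  finally show ?thesis using p1 p2 p3 by blast
qed

lemma frame_norms_maj:
  assumes G: "set G \<subseteq> carrier_vec d" and u: "onb d u" and S: "frame_op d G = spectral d u y"
  shows "maj (length G) (\<lambda>i. Re (G ! i \<bullet>c G ! i)) d y"
proof -
  define \<pi> where "\<pi> = sorting d y"
  let ?u = "u \<circ> \<pi>" and ?y = "y \<circ> \<pi>" and ?n = "\<lambda>i. Re (G ! i \<bullet>c G ! i)"
  have u': "onb d ?u" unfolding \<pi>_def by (rule onb_permute[OF sorting_bij u])
  have S': "frame_op d G = spectral d ?u ?y"
    unfolding S \<pi>_def by (rule spectral_permute[OF sorting_bij, symmetric])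
  have ry: "rearr d y l = ?y l" if "l < d" for l using that by (simp add: rearr_def \<pi>_def)
  have y0: "0 \<le> y l" if "l < d" for l by (rule frame_op_eigenvalue_nonneg[OF G u S that])
  have tot: "(\<Sum>i<length G. ?n i) = (\<Sum>l<d. y l)"
  proof -
    have "(\<Sum>i<length G. ?n i) = (\<Sum>i<length G. \<Sum>l<d. (cmod (G ! i \<bullet>c u l))\<^sup>2)"
      by (intro sum.cong refl parseval_norm[OF u, symmetric]) (use G in auto)
    also have "\<dots> = (\<Sum>l<d. y l)"
      by (subst sum.swap) (simp add: frame_op_eigenvalue_eq[OF G u S])
    finally show ?thesis .
  qed
  have "(\<Sum>i<j. rearr (length G) ?n i) \<le> (\<Sum>i<j. rearr d y i)" for j
  proof -
    obtain I where I: "I \<subseteq> {..<length G}" "card I \<le> j" "(\<Sum>i<j. rearr (length G) ?n i) = sum ?n I"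
      using prefix_rearr_eq_subset_sum by blast
    obtain p where p: "\<And>l. l < d \<Longrightarrow> 0 \<le> p l \<and> p l \<le> 1" "(\<Sum>l<d. p l) \<le> real (card I)"
      "(\<Sum>i\<in>I. ?n i) = (\<Sum>l<d. p l * ?y l)"
      using frame_norm_weights[OF G u' S' I(1)] by blast
    have "(\<Sum>l<d. p l) \<le> (\<Sum>l<d. 1)" by (rule sum_mono) (use p(1) in auto)
    then have "(\<Sum>l<d. p l) \<le> real (min j d)" using p(2) I(2) by simp
    then have "(\<Sum>l<d. p l * rearr d y l) \<le> (\<Sum>l<min j d. rearr d y l)"
      by (intro weighted_sum_le_prefix[OF rearr_nonincreasing rearr_nonneg[OF y0]]) (use p(1) in auto)
    also have "\<dots> \<le> (\<Sum>l<j. rearr d y l)" by (rule sum_mono2) (auto intro: rearr_nonneg y0)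
    finally show ?thesis unfolding I(3) p(3) by (simp add: ry)
  qed
  with tot show ?thesis unfolding maj_def by blast
qed

text \<open>
  A rotation of the pair \<open>(x, y)\<close> by an angle \<open>\<theta>\<close> does not change \<open>x \<otimes> x + y \<otimes> y\<close>, while the squared
  norm \<open>\<phi> \<theta>\<close> of the first vector runs continuously from \<open>bi\<close> to \<open>bj\<close> on \<open>[0, pi / 2]\<close>. The sum of the
  two squared norms is constant.
\<close>

lemma rotate_pair:
  assumes gi: "x \<in> carrier_vec d" and gj: "y \<in> carrier_vec d"
    and bi: "x \<bullet>c x = complex_of_real bi" and bj: "y \<bullet>c y = complex_of_real bj"
    and \<delta>: "0 \<le> \<delta>" "\<delta> \<le> bi - bj"
  shows "\<exists>gi' gj'. gi' \<in> carrier_vec d \<and> gj' \<in> carrier_vec d \<and>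
     gi' \<bullet>c gi' = complex_of_real (bi - \<delta>) \<and> gj' \<bullet>c gj' = complex_of_real (bj + \<delta>) \<and>
     (\<forall>v\<in>carrier_vec d. \<forall>w\<in>carrier_vec d. (v \<bullet>c gi') * cnj (w \<bullet>c gi') + (v \<bullet>c gj') * cnj (w \<bullet>c gj')
        = (v \<bullet>c x) * cnj (w \<bullet>c x) + (v \<bullet>c y) * cnj (w \<bullet>c y))"
proof -
  define \<rho> where "\<rho> = Re (x \<bullet>c y)"
  define \<phi> where "\<phi> \<theta> = (cos \<theta>)\<^sup>2 * bi + (sin \<theta>)\<^sup>2 * bj + 2 * cos \<theta> * sin \<theta> * \<rho>" for \<theta> :: real
  have "\<exists>\<theta>. 0 \<le> \<theta> \<and> \<theta> \<le> pi / 2 \<and> \<phi> \<theta> = bi - \<delta>"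
    by (rule IVT2) (use \<delta> in \<open>auto simp: \<phi>_def intro!: continuous_intros\<close>)
  then obtain \<theta> where \<theta>: "\<phi> \<theta> = bi - \<delta>" by blast
  define c s where "c = complex_of_real (cos \<theta>)" and "s = complex_of_real (sin \<theta>)"
  have cs: "c * c + s * s = 1" "cnj c = c" "cnj s = s"
    unfolding c_def s_def of_real_mult[symmetric] of_real_add[symmetric]
    by (simp_all add: power2_eq_square[symmetric])
  define gi' gj' where "gi' = c \<cdot>\<^sub>v x + s \<cdot>\<^sub>v y" and "gj' = (- s) \<cdot>\<^sub>v x + c \<cdot>\<^sub>v y"
  have car: "gi' \<in> carrier_vec d" "gj' \<in> carrier_vec d" using gi gj by (auto simp: gi'_def gj'_def)
  have lin: "v \<bullet>c (a \<cdot>\<^sub>v x + b \<cdot>\<^sub>v y) = cnj a * (v \<bullet>c x) + cnj b * (v \<bullet>c y)"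
    if v: "v \<in> carrier_vec d" for v a b
  proof -
    have "(a \<cdot>\<^sub>v x + b \<cdot>\<^sub>v y) \<bullet>c v = a * (x \<bullet>c v) + b * (y \<bullet>c v)"
      using gi gj v by (simp add: cip_add_left[of _ d] cip_smult_left[of _ d])
    then show ?thesis
      using cip_commute[OF v, of "a \<cdot>\<^sub>v x + b \<cdot>\<^sub>v y"] cip_commute[OF v gi] cip_commute[OF v gj] gi gj by simp
  qed
  have form: "(v \<bullet>c gi') * cnj (w \<bullet>c gi') + (v \<bullet>c gj') * cnj (w \<bullet>c gj')
        = (v \<bullet>c x) * cnj (w \<bullet>c x) + (v \<bullet>c y) * cnj (w \<bullet>c y)"
    if v: "v \<in> carrier_vec d" and w: "w \<in> carrier_vec d" for v w
  proof -
    have "(v \<bullet>c gi') * cnj (w \<bullet>c gi') + (v \<bullet>c gj') * cnj (w \<bullet>c gj')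
        = (c * c + s * s) * ((v \<bullet>c x) * cnj (w \<bullet>c x) + (v \<bullet>c y) * cnj (w \<bullet>c y))"
      unfolding gi'_def gj'_def lin[OF v] lin[OF w] by (simp add: cs(2,3) algebra_simps)
    then show ?thesis using cs by simp
  qed
  have lin1: "(a \<cdot>\<^sub>v x + b \<cdot>\<^sub>v y) \<bullet>c v = a * (x \<bullet>c v) + b * (y \<bullet>c v)"
    if v: "v \<in> carrier_vec d" for v a b
    using gi gj v by (simp add: cip_add_left[of _ d] cip_smult_left[of _ d])
  have sym: "y \<bullet>c x = cnj (x \<bullet>c y)" by (rule cip_commute[OF gj gi])
  have re: "x \<bullet>c y + cnj (x \<bullet>c y) = complex_of_real (2 * \<rho>)"
    by (simp add: complex_add_cnj \<rho>_def)
  have "gi' \<bullet>c gi' = c * c * (x \<bullet>c x) + s * s * (y \<bullet>c y) + c * s * (x \<bullet>c y + cnj (x \<bullet>c y))"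
    unfolding gi'_def lin[OF car(1)[unfolded gi'_def]] lin1[OF gi] lin1[OF gj] sym by (simp add: cs(2,3) algebra_simps)
  also have "\<dots> = complex_of_real (\<phi> \<theta>)"
    unfolding bi bj re \<phi>_def c_def s_def by (simp add: power2_eq_square)
  finally have ni: "gi' \<bullet>c gi' = complex_of_real (bi - \<delta>)" unfolding \<theta> .
  have "gj' \<bullet>c gj' = s * s * (x \<bullet>c x) + c * c * (y \<bullet>c y) - c * s * (x \<bullet>c y + cnj (x \<bullet>c y))"
    unfolding gj'_def lin[OF car(2)[unfolded gj'_def]] lin1[OF gi] lin1[OF gj] sym by (simp add: cs(2,3) algebra_simps)
  also have "\<dots> = complex_of_real ((sin \<theta>)\<^sup>2 * bi + (cos \<theta>)\<^sup>2 * bj - 2 * cos \<theta> * sin \<theta> * \<rho>)"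
    unfolding bi bj re c_def s_def by (simp add: power2_eq_square)
  also have "(sin \<theta>)\<^sup>2 * bi + (cos \<theta>)\<^sup>2 * bj - 2 * cos \<theta> * sin \<theta> * \<rho> = ((cos \<theta>)\<^sup>2 + (sin \<theta>)\<^sup>2) * (bi + bj) - \<phi> \<theta>"
    unfolding \<phi>_def by (simp only: algebra_simps)
  also have "\<dots> = bj + \<delta>" using \<theta> by simp
  finally have nj: "gj' \<bullet>c gj' = complex_of_real (bj + \<delta>)" .
  show ?thesis using car ni nj form by blast
qed

text \<open>
  The vectors \<open>u l\<close> scaled by the square root of \<open>y l\<close> have the desired frame operator and the squared
  norms \<open>y\<close>. Transfers lead from \<open>y\<close> to \<open>a\<close>, and each transfer is realized by rotating two vectors.
\<close>

lemma frame_with_norms: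
  assumes u: "onb d u" and y: "\<And>l. l < d \<Longrightarrow> 0 \<le> y l" and a: "\<And>i. i < k \<Longrightarrow> 0 \<le> a i"
    and maj: "maj k a d y"
  shows "\<exists>G. length G = k \<and> set G \<subseteq> carrier_vec d \<and> frame_op d G = spectral d u y \<and>
     (\<forall>i<k. G ! i \<bullet>c G ! i = complex_of_real (a i))"
proof -
  define P where "P b \<longleftrightarrow> (\<exists>g. (\<forall>i<k. g i \<in> carrier_vec d \<and> g i \<bullet>c g i = complex_of_real (b i)) \<and>
     (\<forall>v\<in>carrier_vec d. \<forall>w\<in>carrier_vec d.
        (\<Sum>i<k. (v \<bullet>c g i) * cnj (w \<bullet>c g i)) = (spectral d u y *\<^sub>v v) \<bullet>c w))" for b
  define y' where "y' = rearr d y"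
  have pre: "(\<Sum>i<j. rearr k a i) \<le> (\<Sum>i<j. y' i)" for j using maj by (simp add: maj_def y'_def)
  have tot: "(\<Sum>i<k. rearr k a i) = (\<Sum>i<d. y' i)"
    using maj sum_rearr[of "\<lambda>t. t" k a] sum_rearr[of "\<lambda>t. t" d y] by (simp add: maj_def y'_def)
  have y'0: "0 \<le> y' i" for i unfolding y'_def by (rule rearr_nonneg[OF y])
  have y'd: "y' i = 0" if "d \<le> i" for i using that by (simp add: y'_def rearr_def)
  \<comment> \<open>a family of \<open>k\<close> entries is only majorized by spectra with at most \<open>k\<close> nonzero entries\<close>
  have y'k: "y' i = 0" if "k \<le> i" for i
  proof (cases "i < d")
    case True
    have "(\<Sum>i<k. y' i) + y' i = sum y' (insert i {..<k})" using that by simp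
    also have "\<dots> \<le> sum y' {..<d}" by (rule sum_mono2) (use True that y'0 in auto)
    finally show ?thesis using pre[of k] tot y'0[of i] by linarith
  qed (simp add: y'd)
  define \<pi> where "\<pi> = sorting d y"
  have \<pi>: "bij_betw \<pi> {..<d} {..<d}" unfolding \<pi>_def by (rule sorting_bij)
  have y'\<pi>: "y' i = y (\<pi> i)" if "i < d" for i using that by (simp add: y'_def rearr_def \<pi>_def)
  have u\<pi>: "onb d (u \<circ> \<pi>)" by (rule onb_permute[OF \<pi> u])
  have "P y'"
    unfolding P_def
  proof (intro exI conjI allI impI ballI)
    let ?g = "\<lambda>i. if i < d then complex_of_real (sqrt (y' i)) \<cdot>\<^sub>v u (\<pi> i) else 0\<^sub>v d"
    have cu: "u (\<pi> i) \<in> carrier_vec d" if "i < d" for i using onb_carrier[OF u\<pi> that] by simp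
    have sq: "complex_of_real (sqrt (y' i)) * complex_of_real (sqrt (y' i)) = complex_of_real (y' i)" for i
      unfolding of_real_mult[symmetric] using y'0[of i] by simp
    show "?g i \<in> carrier_vec d" for i using cu by simp
    show "?g i \<bullet>c ?g i = complex_of_real (y' i)" for i
    proof (cases "i < d")
      case True
      have "?g i \<bullet>c ?g i = complex_of_real (sqrt (y' i)) * (complex_of_real (sqrt (y' i)) * (u (\<pi> i) \<bullet>c u (\<pi> i)))"
        using True cu[OF True] by (simp add: cip_smult_left[of _ d] cip_smult_right[of _ d])
      also have "\<dots> = complex_of_real (y' i)" using onb_cip[OF u\<pi> True True] sq[of i] by simp
      finally show ?thesis .
    qed (simp add: y'd)
    fix v w :: "complex vec" assume v: "v \<in> carrier_vec d" and w: "w \<in> carrier_vec d"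
    have summand: "(v \<bullet>c ?g i) * cnj (w \<bullet>c ?g i) = complex_of_real (y' i) * (v \<bullet>c u (\<pi> i)) * cnj (w \<bullet>c u (\<pi> i))"
      if "i < d" for i
    proof -
      have "(v \<bullet>c ?g i) * cnj (w \<bullet>c ?g i) =
          (complex_of_real (sqrt (y' i)) * complex_of_real (sqrt (y' i))) * (v \<bullet>c u (\<pi> i)) * cnj (w \<bullet>c u (\<pi> i))"
        using that by (simp add: cip_smult_right[OF v cu[OF that]] cip_smult_right[OF w cu[OF that]])
      then show ?thesis unfolding sq .
    qed
    have "(\<Sum>i<k. (v \<bullet>c ?g i) * cnj (w \<bullet>c ?g i)) = (\<Sum>i<min k d. (v \<bullet>c ?g i) * cnj (w \<bullet>c ?g i))"
      by (rule sum.mono_neutral_right) (use v in auto)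
    also have "\<dots> = (\<Sum>i<min k d. complex_of_real (y' i) * (v \<bullet>c u (\<pi> i)) * cnj (w \<bullet>c u (\<pi> i)))"
      by (intro sum.cong refl) (rule summand, simp)
    also have "\<dots> = (\<Sum>i<d. complex_of_real (y' i) * (v \<bullet>c u (\<pi> i)) * cnj (w \<bullet>c u (\<pi> i)))"
      by (rule sum.mono_neutral_left) (use y'k in auto)
    also have "\<dots> = (\<Sum>i<d. complex_of_real ((y \<circ> \<pi>) i) * (v \<bullet>c (u \<circ> \<pi>) i) * cnj (w \<bullet>c (u \<circ> \<pi>) i))"
      by (intro sum.cong refl) (simp add: y'\<pi>)
    also have "\<dots> = (spectral d u y *\<^sub>v v) \<bullet>c w"
      unfolding spectral_permute[OF \<pi>, of u y, symmetric] by (rule spectral_form[OF u\<pi> v w, symmetric])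
    finally show "(\<Sum>i<k. (v \<bullet>c ?g i) * cnj (w \<bullet>c ?g i)) = (spectral d u y *\<^sub>v v) \<bullet>c w" .
  qed
  moreover have "P (b(i := b i - \<delta>, j := b j + \<delta>))"
    if Pb: "P b" and ij: "i < j" "j < k" and \<delta>: "0 \<le> \<delta>" "\<delta> \<le> b i - b j" for b i j \<delta>
  proof -
    obtain g where g: "\<And>i. i < k \<Longrightarrow> g i \<in> carrier_vec d" "\<And>i. i < k \<Longrightarrow> g i \<bullet>c g i = complex_of_real (b i)"
      "\<And>v w. v \<in> carrier_vec d \<Longrightarrow> w \<in> carrier_vec d \<Longrightarrow>
        (\<Sum>i<k. (v \<bullet>c g i) * cnj (w \<bullet>c g i)) = (spectral d u y *\<^sub>v v) \<bullet>c w"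
      using Pb unfolding P_def by blast
    have ik: "i < k" using ij by simp
    obtain gi' gj' where r: "gi' \<in> carrier_vec d" "gj' \<in> carrier_vec d"
       "gi' \<bullet>c gi' = complex_of_real (b i - \<delta>)" "gj' \<bullet>c gj' = complex_of_real (b j + \<delta>)"
       "\<And>v w. v\<in>carrier_vec d \<Longrightarrow> w\<in>carrier_vec d \<Longrightarrow> (v \<bullet>c gi') * cnj (w \<bullet>c gi') + (v \<bullet>c gj') * cnj (w \<bullet>c gj')
          = (v \<bullet>c g i) * cnj (w \<bullet>c g i) + (v \<bullet>c g j) * cnj (w \<bullet>c g j)"
      using rotate_pair[OF g(1)[OF ik] g(1)[OF ij(2)] g(2)[OF ik] g(2)[OF ij(2)] \<delta>] by blast
    let ?g = "g(i := gi', j := gj')"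
    have split: "sum h {..<k} = h i + h j + sum h ({..<k} - {i} - {j})" for h :: "nat \<Rightarrow> complex"
    proof -
      have "sum h {..<k} = h i + sum h ({..<k} - {i})" by (rule sum.remove) (use ik in auto)
      also have "sum h ({..<k} - {i}) = h j + sum h ({..<k} - {i} - {j})" by (rule sum.remove) (use ij in auto)
      finally show ?thesis by simp
    qed
    show ?thesis
      unfolding P_def
    proof (rule exI[of _ ?g], intro conjI allI impI ballI)
      show "?g m \<in> carrier_vec d" if "m < k" for m using that g(1) r by auto
      show "?g m \<bullet>c ?g m = complex_of_real ((b(i := b i - \<delta>, j := b j + \<delta>)) m)" if "m < k" for m
        using that g(2) r ij by auto
      fix v w :: "complex vec" assume v: "v \<in> carrier_vec d" and w: "w \<in> carrier_vec d"
      let ?h = "\<lambda>g m. (v \<bullet>c g m) * cnj (w \<bullet>c g m)"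
      have "(\<Sum>m<k. ?h ?g m) = (\<Sum>m<k. ?h g m)"
      proof -
        have "sum (?h ?g) ({..<k} - {i} - {j}) = sum (?h g) ({..<k} - {i} - {j})" by (rule sum.cong) auto
        moreover have "?h ?g i + ?h ?g j = ?h g i + ?h g j" using r(5)[OF v w] ij by simp
        ultimately show ?thesis unfolding split[of "?h ?g"] split[of "?h g"] by simp
      qed
      then show "(\<Sum>m<k. ?h ?g m) = (spectral d u y *\<^sub>v v) \<bullet>c w" using g(3)[OF v w] by simp
    qed
  qed
  moreover have "(\<Sum>i<k. rearr k a i) = (\<Sum>i<k. y' i)"
  proof -
    have "(\<Sum>i<d. y' i) = (\<Sum>i<min k d. y' i)" by (rule sum.mono_neutral_right) (use y'k in auto)
    also have "\<dots> = (\<Sum>i<k. y' i)" by (rule sum.mono_neutral_left) (use y'd in auto)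
    finally show ?thesis using tot by simp
  qed
  ultimately obtain z where "P z" and z: "\<And>i. i < k \<Longrightarrow> z i = rearr k a i"
    using transfers_reach[of P k "rearr k a" y'] rearr_nonincreasing[of k a] pre by blast
  then obtain g where g: "\<And>i. i < k \<Longrightarrow> g i \<in> carrier_vec d" "\<And>i. i < k \<Longrightarrow> g i \<bullet>c g i = complex_of_real (z i)"
      "\<And>v w. v \<in> carrier_vec d \<Longrightarrow> w \<in> carrier_vec d \<Longrightarrow>
        (\<Sum>i<k. (v \<bullet>c g i) * cnj (w \<bullet>c g i)) = (spectral d u y *\<^sub>v v) \<bullet>c w"
    unfolding P_def by blast
  define \<sigma> where "\<sigma> = sorting k a"
  have \<sigma>: "bij_betw \<sigma> {..<k} {..<k}" unfolding \<sigma>_def by (rule sorting_bij)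
  define \<tau> where "\<tau> = inv_into {..<k} \<sigma>"
  have \<tau>: "bij_betw \<tau> {..<k} {..<k}" unfolding \<tau>_def by (rule bij_betw_inv_into[OF \<sigma>])
  have \<tau>k: "\<tau> i < k" if "i < k" for i using \<tau> that by (auto simp: bij_betw_def)
  have \<sigma>\<tau>: "\<sigma> (\<tau> i) = i" if "i < k" for i
    unfolding \<tau>_def using \<sigma> that by (intro f_inv_into_f) (auto simp: bij_betw_def)
  define G where "G = map (\<lambda>i. g (\<tau> i)) [0..<k]"
  have len: "length G = k" by (simp add: G_def)
  have Gi: "G ! i = g (\<tau> i)" if "i < k" for i using that by (simp add: G_def)
  have Gc: "set G \<subseteq> carrier_vec d" using g(1) \<tau>k by (auto simp: G_def)
  have "frame_op d G = spectral d u y"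
  proof (rule mat_eqI_form[OF u frame_op_carrier[OF Gc] spectral_carrier])
    fix v w :: "complex vec" assume v: "v \<in> carrier_vec d" and w: "w \<in> carrier_vec d"
    have "(frame_op d G *\<^sub>v v) \<bullet>c w = (\<Sum>i<k. (v \<bullet>c g (\<tau> i)) * cnj (w \<bullet>c g (\<tau> i)))"
      unfolding frame_op_form[OF Gc v w] len by (intro sum.cong refl) (simp add: Gi)
    also have "\<dots> = (\<Sum>i<k. (v \<bullet>c g i) * cnj (w \<bullet>c g i))"
      by (rule sum.reindex_bij_betw[OF \<tau>])
    finally show "(frame_op d G *\<^sub>v v) \<bullet>c w = (spectral d u y *\<^sub>v v) \<bullet>c w" using g(3)[OF v w] by simp
  qed
  moreover have "G ! i \<bullet>c G ! i = complex_of_real (a i)" if "i < k" for i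
    using Gi[OF that] g(2)[OF \<tau>k[OF that]] z[OF \<tau>k[OF that]] \<sigma>\<tau>[OF that] \<tau>k[OF that] by (simp add: rearr_def \<sigma>_def)
  ultimately show ?thesis using len Gc by blast
qed

section \<open>Closing a convex function at zero\<close>

text \<open>
  The slopes of the secants ending at \<open>1\<close> are monotone and bounded below by the slope from \<open>0\<close>, so
  they converge at \<open>0\<close>.
\<close>

lemma convex_limit_at_zero:
  fixes f :: "real \<Rightarrow> real"
  assumes f: "convex_on {0..} f"
  shows "\<exists>L. (f \<longlongrightarrow> L) (at_right 0)"
proof -
  define q where "q x = (f x - f 1) / (x - 1)" for x
  define m where "m = Inf (q ` {0<..<1})"
  have q0: "q 0 \<le> q x" if "0 < x" "x < 1" for x
    using convex_on_slope_le(2)[OF f, of 0 1 x] that by (simp add: q_def)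
  have mono: "q x \<le> q y" if "0 < x" "x \<le> y" "y < 1" for x y
    using convex_on_slope_le(2)[OF f, of x 1 y] that by (cases "x = y") (auto simp: q_def)
  have bdd: "bdd_below (q ` {0<..<1})" using q0 by (auto intro!: bdd_belowI2[of _ "q 0"])
  have lower: "m \<le> q x" if "0 < x" "x < 1" for x
    unfolding m_def by (rule cInf_lower[OF _ bdd]) (use that in auto)
  have "(q \<longlongrightarrow> m) (at_right 0)"
  proof (rule decreasing_tendsto)
    show "\<forall>\<^sub>F x in at_right 0. m \<le> q x"
      unfolding eventually_at_right_field using lower by (intro exI[of _ 1]) auto
    fix t assume "m < t"
    then obtain y where y: "0 < y" "y < 1" "q y < t"
      using cInf_lessD[of "q ` {0<..<1}" t] unfolding m_def by force
    show "\<forall>\<^sub>F x in at_right 0. q x < t"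
      unfolding eventually_at_right_field
    proof (intro exI[of _ y] conjI allI impI)
      fix x assume "0 < x" "x < y"
      then show "q x < t" using mono[of x y] y by simp
    qed (use y in auto)
  qed
  then have "((\<lambda>x. f 1 + q x * (x - 1)) \<longlongrightarrow> f 1 + m * (0 - 1)) (at_right 0)"
    by (intro tendsto_intros)
  moreover have "\<forall>\<^sub>F x in at_right 0. f 1 + q x * (x - 1) = f x"
    unfolding eventually_at_right_field by (intro exI[of _ 1]) (auto simp: q_def)
  ultimately have "(f \<longlongrightarrow> f 1 + m * (0 - 1)) (at_right 0)" by (rule Lim_transform_eventually)
  then show ?thesis by blast
qed

text \<open>
  Near \<open>x\<close> all slopes at \<open>x\<close> lie between those of the secants to \<open>0\<close> and to \<open>2 x\<close>.
\<close>

lemma convex_continuous_pos: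
  fixes f :: "real \<Rightarrow> real"
  assumes f: "convex_on {0..} f"
  shows "continuous_on {0<..} f"
  unfolding continuous_on_eq_continuous_at[OF open_greaterThan]
proof
  fix x :: real assume "x \<in> {0<..}"
  then have x: "0 < x" by simp
  define m M where "m = (f x - f 0) / (x - 0)" and "M = (f x - f (2 * x)) / (x - 2 * x)"
  have bound: "norm (f t - f x) \<le> (\<bar>m\<bar> + \<bar>M\<bar>) * norm (t - x)" if t: "0 < t" "t < 2 * x" for t
  proof (cases "t = x")
    case False
    define s where "s = (f x - f t) / (x - t)"
    have "m \<le> s" "s \<le> M"
      unfolding m_def s_def M_def
      using convex_slope_mono[OF f, of 0 x t x] convex_slope_mono[OF f, of t x "2 * x" x] t x False by auto
    then have "\<bar>s\<bar> \<le> \<bar>m\<bar> + \<bar>M\<bar>" by linarith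
    moreover have "f t - f x = s * (t - x)" using False by (simp add: s_def field_simps)
    ultimately show ?thesis by (simp add: abs_mult mult_right_mono)
  qed simp
  have "((\<lambda>t. f t - f x) \<longlongrightarrow> 0) (at x)"
  proof (rule tendsto_norm_zero_cancel,
      rule tendsto_sandwich[where f = "\<lambda>_. 0" and h = "\<lambda>t. (\<bar>m\<bar> + \<bar>M\<bar>) * norm (t - x)"])
    show "\<forall>\<^sub>F t in at x. norm (f t - f x) \<le> (\<bar>m\<bar> + \<bar>M\<bar>) * norm (t - x)"
      unfolding eventually_at using bound x by (intro exI[of _ x]) (auto simp: dist_real_def)
    have "((\<lambda>t. (\<bar>m\<bar> + \<bar>M\<bar>) * norm (t - x)) \<longlongrightarrow> (\<bar>m\<bar> + \<bar>M\<bar>) * norm (x - x)) (at x)"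
      by (intro tendsto_intros)
    then show "((\<lambda>t. (\<bar>m\<bar> + \<bar>M\<bar>) * norm (t - x)) \<longlongrightarrow> 0) (at x)" by simp
    show "((\<lambda>t. 0) \<longlongrightarrow> (0::real)) (at x)" by (rule tendsto_const)
  qed simp
  then show "isCont f x" unfolding isCont_def by (rule LIM_zero_cancel)
qed

lemma strictly_convexD:
  assumes "strictly_convex_on S f" "x \<in> S" "y \<in> S" "x \<noteq> y" "0 < u" "0 < v" "u + v = 1"
  shows "f (u * x + v * y) < u * f x + v * f y"
  using assms unfolding strictly_convex_on_def by blast

lemma convex_combination_limit_at_zero:
  fixes f :: "real \<Rightarrow> real"
  assumes f: "convex_on {0..} f" and L: "(f \<longlongrightarrow> L) (at_right 0)" and y: "0 < y" and t: "0 < t" "t < 1"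
  shows "f (t * y) \<le> (1 - t) * L + t * f y"
proof (rule tendsto_le)
  show "at_right (0::real) \<noteq> bot" by simp
  show "((\<lambda>x. (1 - t) * f x + t * f y) \<longlongrightarrow> (1 - t) * L + t * f y) (at_right 0)"
    by (intro tendsto_intros L)
  have "isCont f (t * y)"
    using convex_continuous_pos[OF f] y t by (simp add: continuous_on_eq_continuous_at)
  moreover have "((\<lambda>x. (1 - t) * x + t * y) \<longlongrightarrow> (1 - t) * 0 + t * y) (at_right 0)"
    by (intro tendsto_intros)
  ultimately show "((\<lambda>x. f ((1 - t) * x + t * y)) \<longlongrightarrow> f (t * y)) (at_right 0)"
    using isCont_tendsto_compose[of "t * y" f "\<lambda>x. (1 - t) * x + t * y"] by simp
  show "\<forall>\<^sub>F x in at_right 0. f ((1 - t) * x + t * y) \<le> (1 - t) * f x + t * f y"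
    unfolding eventually_at_right_field
  proof (intro exI[of _ 1] conjI allI impI)
    fix x :: real assume "0 < x" "x < 1"
    then show "f ((1 - t) * x + t * y) \<le> (1 - t) * f x + t * f y"
      using convex_onD[OF f, of t x y] t y by simp
  qed simp
qed

text \<open>
  A convex function can only jump upwards at the endpoint \<open>0\<close>. Lowering its value there to the
  limit produces a continuous function to which a compactness argument applies.
\<close>

lemma strictly_convex_closure:
  fixes f :: "real \<Rightarrow> real"
  assumes f: "strictly_convex_on {0..} f"
  shows "\<exists>g. strictly_convex_on {0..} g \<and> continuous_on {0..} g \<and> (\<forall>x>0. g x = f x) \<and> g 0 \<le> f 0"
proof -
  note cf = strictly_convex_imp_convex[OF f]
  obtain L where L: "(f \<longlongrightarrow> L) (at_right 0)" using convex_limit_at_zero[OF cf] by blast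
  define g where "g x = (if x = 0 then L else f x)" for x
  have strict0: "g (v * y) < u * L + v * f y" if y: "0 < y" and uv: "0 < u" "0 < v" "u + v = 1" for u v y
  proof -
    have v1: "v < 1" using uv by simp
    \<comment> \<open>\<open>v y\<close> is a proper convex combination of \<open>v y / 2\<close> and \<open>y\<close>, where \<open>f\<close> itself is strictly convex\<close>
    define s where "s = (1 - v) / (1 - v / 2)"
    have s: "0 < s" "s < 1" using uv v1 by (auto simp: s_def field_simps)
    have e: "s * (1 - v / 2) = u" using uv by (simp add: s_def)
    have "s * (v / 2) + (1 - s) = 1 - s * (1 - v / 2)" by (simp add: algebra_simps)
    then have e2: "s * (v / 2) + (1 - s) = v" unfolding e using uv by simp
    have "f (s * (v / 2 * y) + (1 - s) * y) < s * f (v / 2 * y) + (1 - s) * f y"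
      by (rule strictly_convexD[OF f]) (use y s uv v1 in auto)
    also have "s * (v / 2 * y) + (1 - s) * y = (s * (v / 2) + (1 - s)) * y" by (simp add: algebra_simps)
    also have "\<dots> = v * y" unfolding e2 ..
    also have "s * f (v / 2 * y) \<le> s * ((1 - v / 2) * L + v / 2 * f y)"
      by (intro mult_left_mono convex_combination_limit_at_zero[OF cf L y]) (use s uv v1 in auto)
    also have "s * ((1 - v / 2) * L + v / 2 * f y) + (1 - s) * f y
        = (s * (1 - v / 2)) * L + (s * (v / 2) + (1 - s)) * f y" by (simp add: algebra_simps)
    also have "\<dots> = u * L + v * f y" unfolding e e2 ..
    finally show ?thesis using y uv by (simp add: g_def)
  qed
  have "strictly_convex_on {0..} g"
    unfolding strictly_convex_on_def
  proof (intro conjI ballI allI impI)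
    fix x y u v :: real
    assume x: "x \<in> {0..}" and y: "y \<in> {0..}" and u: "0 < u" and v: "0 < v" and ne: "x \<noteq> y" and uv: "u + v = 1"
    consider "x = 0" "0 < y" | "0 < x" "y = 0" | "0 < x" "0 < y" using x y ne by fastforce
    then show "g (u * x + v * y) < u * g x + v * g y"
    proof cases
      case 1
      then show ?thesis using strict0[OF 1(2) u v uv] by (simp add: g_def)
    next
      case 2
      then show ?thesis using strict0[OF 2(1) v u] uv by (simp add: g_def add.commute)
    next
      case 3
      then have "u * x + v * y \<noteq> 0" using u v by (metis add_pos_pos less_irrefl mult_pos_pos)
      then show ?thesis using 3 strictly_convexD[OF f x y ne u v uv] by (simp add: g_def)
    qed
  qed simp
  moreover have "continuous_on {0..} g"
    unfolding continuous_on_eq_continuous_within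
  proof
    fix x :: real assume "x \<in> {0..}"
    then consider "x = 0" | "0 < x" by fastforce
    then show "continuous (at x within {0..}) g"
    proof cases
      case 1
      have "(g \<longlongrightarrow> L) (at_right 0)"
        by (rule Lim_transform_eventually[OF L])
          (auto simp: eventually_at_right_field g_def intro!: exI[of _ 1])
      moreover have "at 0 within {0..} = at_right (0::real)" by (rule at_within_Ici_at_right)
      ultimately show ?thesis using 1 by (simp add: continuous_within g_def)
    next
      case 2
      have "isCont f x" using convex_continuous_pos[OF cf] 2 by (simp add: continuous_on_eq_continuous_at)
      moreover have "\<forall>\<^sub>F t in nhds x. t \<in> {0<..}" using 2 by (intro eventually_nhds_in_open) auto
      then have "\<forall>\<^sub>F t in nhds x. g t = f t" by (rule eventually_mono) (simp add: g_def)
      ultimately have "isCont g x" using isCont_cong by blast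
      then show ?thesis by (rule continuous_at_imp_continuous_at_within)
    qed
  qed
  moreover have "L \<le> f 0"
  proof (rule tendsto_le)
    show "at_right (0::real) \<noteq> bot" by simp
    show "(f \<longlongrightarrow> L) (at_right 0)" by (rule L)
    have "((\<lambda>x. (1 - x) * f 0 + x * f 1) \<longlongrightarrow> (1 - 0) * f 0 + 0 * f 1) (at_right 0)" by (intro tendsto_intros)
    then show "((\<lambda>x. (1 - x) * f 0 + x * f 1) \<longlongrightarrow> f 0) (at_right 0)" by simp
    show "\<forall>\<^sub>F x in at_right 0. f x \<le> (1 - x) * f 0 + x * f 1"
      unfolding eventually_at_right_field
    proof (intro exI[of _ 1] conjI allI impI)
      fix x :: real assume "0 < x" "x < 1"
      then show "f x \<le> (1 - x) * f 0 + x * f 1" using convex_onD[OF cf, of x 0 1] by simp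
    qed simp
  qed
  ultimately show ?thesis by (intro exI[of _ g]) (auto simp: g_def)
qed

section \<open>Minimizing over the admissible spectra\<close>

text \<open>
  The zeros beyond \<open>d\<close> make a spectrum a single element of the function type, so that uniqueness is
  plain equality and compactness refers to the product topology.
\<close>

definition spectra :: "nat \<Rightarrow> (nat \<Rightarrow> real) \<Rightarrow> nat \<Rightarrow> (nat \<Rightarrow> real) set" where
  "spectra k a d = {\<mu>. (\<forall>i<d. 0 \<le> \<mu> i) \<and> (\<forall>i\<ge>d. \<mu> i = 0) \<and> (\<forall>i j. i \<le> j \<longrightarrow> j < d \<longrightarrow> \<mu> i \<le> \<mu> j) \<and> maj k a d \<mu>}"

text \<open>
  The sum of the \<open>j\<close> largest entries of a nondecreasing \<open>\<mu>\<close>. It is linear in \<open>\<mu>\<close>, which makes the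
  majorization constraints closed and convex.
\<close>

definition top_sum :: "nat \<Rightarrow> (nat \<Rightarrow> real) \<Rightarrow> nat \<Rightarrow> real" where
  "top_sum d \<mu> j = (\<Sum>i<min j d. \<mu> (d - 1 - i))"

lemma prefix_rearr_eq_top_sum:
  assumes "\<And>i j. i \<le> j \<Longrightarrow> j < d \<Longrightarrow> \<mu> i \<le> \<mu> j"
  shows "(\<Sum>i<j. rearr d \<mu> i) = top_sum d \<mu> j"
proof -
  have b: "bij_betw (\<lambda>i. d - 1 - i) {..<d} {..<d}"
    by (rule bij_betw_byWitness[of _ "\<lambda>i. d - 1 - i"]) auto
  have "nonincreasing d (\<mu> \<circ> (\<lambda>i. d - 1 - i))" using assms by (auto simp: nonincreasing_def)
  from rearr_eqI[OF b this] have r: "rearr d \<mu> i = \<mu> (d - 1 - i)" if "i < d" for i using that .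
  have "(\<Sum>i<j. rearr d \<mu> i) = (\<Sum>i<min j d. rearr d \<mu> i)"
    by (rule sum.mono_neutral_right) (auto simp: rearr_def)
  then show ?thesis by (simp add: top_sum_def r)
qed

lemma spectra_iff:
  "\<mu> \<in> spectra k a d \<longleftrightarrow> (\<forall>i<d. 0 \<le> \<mu> i) \<and> (\<forall>i\<ge>d. \<mu> i = 0) \<and> (\<forall>i j. i \<le> j \<longrightarrow> j < d \<longrightarrow> \<mu> i \<le> \<mu> j) \<and>
     (\<forall>j. (\<Sum>i<j. rearr k a i) \<le> top_sum d \<mu> j) \<and> (\<Sum>i<k. a i) = (\<Sum>i<d. \<mu> i)"
  unfolding spectra_def maj_def using prefix_rearr_eq_top_sum[of d \<mu>] by auto

lemma compact_spectra: "compact (spectra k a d)"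
proof -
  define A where "A = (\<Sum>i<k. a i)"
  have coord: "continuous_on UNIV (\<lambda>\<mu> :: nat \<Rightarrow> real. \<mu> i)" for i
    by (rule continuous_on_product_coordinates)
  have cont: "continuous_on UNIV (\<lambda>\<mu>. top_sum d \<mu> j)" for j
    unfolding top_sum_def by (intro continuous_on_sum coord)
  have "spectra k a d = {\<mu>. (\<forall>i. i < d \<longrightarrow> 0 \<le> \<mu> i) \<and> (\<forall>i. d \<le> i \<longrightarrow> \<mu> i = 0) \<and>
      (\<forall>i j. i \<le> j \<longrightarrow> j < d \<longrightarrow> \<mu> i \<le> \<mu> j) \<and>
      (\<forall>j. (\<Sum>i<j. rearr k a i) \<le> top_sum d \<mu> j) \<and> (\<Sum>i<k. a i) = (\<Sum>i<d. \<mu> i)}"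
    by (rule Set.set_eqI) (simp only: spectra_iff mem_Collect_eq)
  also have "closed \<dots>"
    by (intro closed_Collect_conj closed_Collect_all closed_Collect_imp open_Collect_const
        closed_Collect_le closed_Collect_eq continuous_on_sum continuous_on_const coord cont)
  finally have "closed (spectra k a d)" .
  moreover have "spectra k a d \<subseteq> PiE UNIV (\<lambda>_. {0..max A 0})"
  proof
    fix \<mu> assume \<mu>: "\<mu> \<in> spectra k a d"
    have "\<mu> i \<le> A" if "i < d" for i
    proof -
      have "\<mu> i \<le> (\<Sum>i<d. \<mu> i)" by (rule member_le_sum) (use \<mu> that in \<open>auto simp: spectra_iff\<close>)
      then show ?thesis using \<mu> by (simp add: spectra_iff A_def)
    qed
    then have "0 \<le> \<mu> i \<and> \<mu> i \<le> max A 0" for i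
      using \<mu> max.coboundedI1[of "\<mu> i" A 0] by (cases "i < d") (auto simp: spectra_iff)
    then show "\<mu> \<in> PiE UNIV (\<lambda>_. {0..max A 0})" by auto
  qed
  moreover have "compact (PiE UNIV (\<lambda>_::nat. {0..max A 0}))"
  proof -
    have "compactin (product_topology (\<lambda>_::nat. euclidean) UNIV) (PiE UNIV (\<lambda>_. {0..max A 0}))"
      by (simp add: compactin_PiE)
    then show ?thesis by (simp add: euclidean_product_topology)
  qed
  ultimately show ?thesis by (metis closed_Int_compact inf.absorb1)
qed

text \<open>
  The spectrum concentrated in one entry majorizes everything with the same total.
\<close>

lemma spectra_nonempty:
  assumes d: "0 < d" and a: "\<And>i. i < k \<Longrightarrow> 0 \<le> a i"
  shows "spectra k a d \<noteq> {}"
proof -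
  define A where "A = (\<Sum>i<k. a i)"
  have A: "0 \<le> A" using a by (auto simp: A_def intro: sum_nonneg)
  define \<mu> where "\<mu> i = (if i = d - 1 then A else 0)" for i
  have \<mu>0: "0 \<le> \<mu> i" for i using A by (simp add: \<mu>_def)
  have "maj k a d \<mu>"
  proof (subst maj_iff_subset_sums[OF a \<mu>0], assumption, intro conjI allI impI)
    fix I assume I: "I \<subseteq> {..<k}"
    show "\<exists>K\<subseteq>{..<d}. card K \<le> card I \<and> sum a I \<le> sum \<mu> K"
    proof (cases "I = {}")
      case False
      have fI: "finite I" using I finite_subset by blast
      have "sum a I \<le> A" unfolding A_def by (rule sum_mono2) (use I a in auto)
      moreover have "1 \<le> card I" using False fI by (simp add: Suc_le_eq card_gt_0_iff)
      ultimately show ?thesis using d by (intro exI[of _ "{d - 1}"]) (simp add: \<mu>_def)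
    qed auto
  next
    show "(\<Sum>i<k. a i) = (\<Sum>i<d. \<mu> i)" using d by (simp add: \<mu>_def A_def)
  qed
  then have "\<mu> \<in> spectra k a d" using \<mu>0 A d by (auto simp: spectra_def \<mu>_def)
  then show ?thesis by blast
qed

lemma spectra_midpoint:
  assumes "\<mu> \<in> spectra k a d" "\<nu> \<in> spectra k a d"
  shows "(\<lambda>i. (\<mu> i + \<nu> i) / 2) \<in> spectra k a d"
proof -
  have t: "top_sum d (\<lambda>i. (\<mu> i + \<nu> i) / 2) j = (top_sum d \<mu> j + top_sum d \<nu> j) / 2" for j
    by (simp add: top_sum_def sum.distrib sum_divide_distrib[symmetric])
  have "(\<Sum>i<j. rearr k a i) \<le> (top_sum d \<mu> j + top_sum d \<nu> j) / 2" for j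
    using assms by (simp add: spectra_iff) (smt (verit) field_sum_of_halves)
  moreover have "(\<mu> i + \<nu> i) / 2 \<le> (\<mu> j + \<nu> j) / 2" if "i \<le> j" "j < d" for i j
  proof -
    have "\<mu> i \<le> \<mu> j" "\<nu> i \<le> \<nu> j" using assms that by (auto simp: spectra_iff)
    then show ?thesis by simp
  qed
  moreover have "(\<Sum>i<d. (\<mu> i + \<nu> i) / 2) = (\<Sum>i<k. a i)"
    using assms by (simp add: spectra_iff sum_divide_distrib[symmetric] sum.distrib)
  ultimately show ?thesis using assms unfolding spectra_iff t by auto
qed

lemma strictly_convex_transfer:
  assumes g: "strictly_convex_on {0..} g" and p: "0 \<le> p" "0 < \<epsilon>" "\<epsilon> < q - (p::real)"
  shows "g (p + \<epsilon>) + g (q - \<epsilon>) < g p + g q"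
proof -
  define r where "r = \<epsilon> / (q - p)"
  have r: "0 < r" "r < 1" "r * (q - p) = \<epsilon>" using p by (auto simp: r_def)
  have 1: "g ((1 - r) * p + r * q) < (1 - r) * g p + r * g q"
    by (rule strictly_convexD[OF g]) (use r p in auto)
  have 2: "g (r * p + (1 - r) * q) < r * g p + (1 - r) * g q"
    by (rule strictly_convexD[OF g]) (use r p in auto)
  have "(1 - r) * p + r * q = p + r * (q - p)" "r * p + (1 - r) * q = q - r * (q - p)"
    by (simp_all add: algebra_simps)
  with 1 2 show ?thesis unfolding r(3) by (simp add: algebra_simps)
qed

text \<open>
  Suppose \<open>\<beta> i + \<mu> i = 0\<close>. Then \<open>\<beta>\<close> vanishes from \<open>i\<close> on, and the bound on the number of its zeros
  leaves \<open>\<mu>\<close> with \<open>q < k\<close> positive entries. These carry the whole total, more than the \<open>q\<close> largest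
  entries of the positive family \<open>a\<close>. So the constraint at \<open>q\<close> is slack, and some mass can be moved
  from the smallest positive entry \<open>\<mu> m\<close> to the zero entry \<open>\<mu> n\<close> before it. As \<open>\<beta>\<close> vanishes at both
  places, strict convexity makes the sum smaller.
\<close>

lemma minimizer_positive:
  assumes g: "strictly_convex_on {0..} g"
    and \<beta>: "\<And>i. i < d \<Longrightarrow> 0 \<le> \<beta> i" "nonincreasing d \<beta>"
    and a: "\<And>i. i < k \<Longrightarrow> 0 < a i" and rk: "card {i. i < d \<and> \<beta> i = 0} \<le> k"
    and \<mu>: "\<mu> \<in> spectra k a d"
    and min: "\<And>\<nu>. \<nu> \<in> spectra k a d \<Longrightarrow> (\<Sum>i<d. g (\<beta> i + \<mu> i)) \<le> (\<Sum>i<d. g (\<beta> i + \<nu> i))"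
    and i: "i < d"
  shows "0 < \<beta> i + \<mu> i"
proof (rule ccontr)
  assume npos: "\<not> 0 < \<beta> i + \<mu> i"
  have \<mu>0: "\<And>i. i < d \<Longrightarrow> 0 \<le> \<mu> i" and \<mu>mono: "\<And>i j. i \<le> j \<Longrightarrow> j < d \<Longrightarrow> \<mu> i \<le> \<mu> j"
    and pre: "\<And>j. (\<Sum>i<j. rearr k a i) \<le> top_sum d \<mu> j" and tot: "(\<Sum>i<k. a i) = (\<Sum>i<d. \<mu> i)"
    and out: "\<And>i. d \<le> i \<Longrightarrow> \<mu> i = 0"
    using \<mu> by (auto simp: spectra_iff)
  have "\<beta> i = 0" "\<mu> i = 0" using npos \<beta>(1)[OF i] \<mu>0[OF i] by auto
  have \<beta>z: "\<beta> j = 0" if "i \<le> j" "j < d" for j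
    using nonincreasingD[OF \<beta>(2) that] \<beta>(1)[OF that(2)] \<open>\<beta> i = 0\<close> by simp
  have "{i..<d} \<subseteq> {i. i < d \<and> \<beta> i = 0}" using \<beta>z by auto
  then have "card {i..<d} \<le> card {i. i < d \<and> \<beta> i = 0}" by (intro card_mono) auto
  then have dk: "d - i \<le> k" using rk by simp
  then have k: "0 < k" using i by simp
  have Apos: "0 < (\<Sum>i<k. a i)" by (rule sum_pos) (use k a in auto)
  have "\<exists>m. m < d \<and> 0 < \<mu> m"
  proof (rule ccontr)
    assume "\<not> ?thesis"
    then have "(\<Sum>i<d. \<mu> i) \<le> 0" by (intro sum_nonpos) force
    then show False using Apos tot by simp
  qed
  define m where "m = (LEAST m. m < d \<and> 0 < \<mu> m)"
  have m: "m < d" "0 < \<mu> m" using LeastI_ex[OF \<open>\<exists>m. m < d \<and> 0 < \<mu> m\<close>] by (auto simp: m_def)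
  have below: "\<mu> j = 0" if "j < m" for j
    using not_less_Least[of j "\<lambda>m. m < d \<and> 0 < \<mu> m"] that m \<mu>0[of j] by (force simp: m_def)
  have im: "i < m"
  proof (rule ccontr)
    assume "\<not> i < m"
    then show False using \<mu>mono[of m i] i m \<open>\<mu> i = 0\<close> by simp
  qed
  define n where "n = m - 1"
  have n: "m = Suc n" "i \<le> n" "n < d" "\<mu> n = 0" using im m below[of n] by (auto simp: n_def)
  define q where "q = d - m"
  have q: "0 < q" "q \<le> d" "q < k" using m im dk by (auto simp: q_def)
  have "(\<Sum>i<q. rearr k a i) < (\<Sum>i<k. a i)"
  proof -
    have "(\<Sum>i<q. rearr k a i) < (\<Sum>i<k. rearr k a i)"
    proof (rule sum_strict_mono2[of _ _ q])
      show "0 < rearr k a q" using q a sorting_less[of q k a] by (simp add: rearr_def)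
      show "0 \<le> rearr k a j" for j by (rule rearr_nonneg) (use a in force)
    qed (use q in auto)
    also have "\<dots> = (\<Sum>i<k. a i)" by (rule sum_rearr)
    finally show ?thesis .
  qed
  define \<epsilon> where "\<epsilon> = min (\<mu> m / 2) ((\<Sum>i<k. a i) - (\<Sum>i<q. rearr k a i))"
  have \<epsilon>: "0 < \<epsilon>" "\<epsilon> \<le> \<mu> m / 2" "\<epsilon> \<le> (\<Sum>i<k. a i) - (\<Sum>i<q. rearr k a i)"
    using m \<open>(\<Sum>i<q. rearr k a i) < (\<Sum>i<k. a i)\<close> by (auto simp: \<epsilon>_def min_def)
  define \<nu> where "\<nu> = \<mu>(n := \<epsilon>, m := \<mu> m - \<epsilon>)"
  have \<nu>n: "\<nu> n = \<epsilon>" and \<nu>m: "\<nu> m = \<mu> m - \<epsilon>" and \<nu>o: "\<And>j. j \<noteq> n \<Longrightarrow> j \<noteq> m \<Longrightarrow> \<nu> j = \<mu> j"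
    using n by (auto simp: \<nu>_def)
  have sum\<nu>: "(\<Sum>i\<in>D. h (\<nu> i) i) = (\<Sum>i\<in>D. h (\<mu> i) i) - h 0 n - h (\<mu> m) m + h \<epsilon> n + h (\<mu> m - \<epsilon>) m"
    if "finite D" "n \<in> D" "m \<in> D" for D and h :: "real \<Rightarrow> nat \<Rightarrow> real"
  proof -
    have s: "sum F D = F n + (F m + sum F (D - {n} - {m}))" for F :: "nat \<Rightarrow> real"
      using that n by (subst sum.remove[of D n]) (auto intro!: sum.remove)
    have "(\<Sum>i\<in>D - {n} - {m}. h (\<nu> i) i) = (\<Sum>i\<in>D - {n} - {m}. h (\<mu> i) i)"
      by (rule sum.cong) (auto simp: \<nu>o)
    then show ?thesis unfolding s[of "\<lambda>i. h (\<nu> i) i"] s[of "\<lambda>i. h (\<mu> i) i"] by (simp add: \<nu>n \<nu>m n(4))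
  qed
  have top: "top_sum d \<nu> j = top_sum d \<mu> j - (if j = q then \<epsilon> else 0)" for j
  proof -
    have im: "top_sum d \<kappa> j = sum \<kappa> {d - min j d..<d}" for \<kappa>
      unfolding top_sum_def
      by (rule sum.reindex_bij_witness[of _ "\<lambda>i. d - 1 - i" "\<lambda>i. d - 1 - i"]) auto
    consider "j < q" | "j = q" | "q < j" by linarith
    then show ?thesis
    proof cases
      case 1
      then have "sum \<nu> {d - min j d..<d} = sum \<mu> {d - min j d..<d}"
        by (intro sum.cong refl \<nu>o) (use n q in \<open>auto simp: q_def\<close>)
      then show ?thesis using 1 by (simp add: im)
    next
      case 2
      have D: "{d - min j d..<d} = insert m {Suc m..<d}" using 2 m by (auto simp: q_def)
      have "sum \<nu> {Suc m..<d} = sum \<mu> {Suc m..<d}" by (intro sum.cong refl \<nu>o) (use n in auto)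
      then show ?thesis using 2 unfolding im D by (simp add: \<nu>m)
    next
      case 3
      have "sum \<nu> {d - min j d..<d} = sum \<mu> {d - min j d..<d}"
      proof -
        have "d - min j d \<le> n" using 3 n(1) m by (simp add: q_def min_def) linarith
        then have "n \<in> {d - min j d..<d}" "m \<in> {d - min j d..<d}" using n m by auto
        from sum\<nu>[OF _ this, of "\<lambda>t _. t"] show ?thesis by simp
      qed
      then show ?thesis using 3 by (simp add: im)
    qed
  qed
  have "top_sum d \<mu> q = (\<Sum>i<k. a i)"
  proof -
    have "top_sum d \<mu> q = (\<Sum>i\<in>{m..<d}. \<mu> i)"
      unfolding top_sum_def using m
      by (intro sum.reindex_bij_witness[of _ "\<lambda>i. d - 1 - i" "\<lambda>i. d - 1 - i"]) (auto simp: q_def)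
    also have "\<dots> = (\<Sum>i<d. \<mu> i)" by (rule sum.mono_neutral_left) (auto simp: below)
    finally show ?thesis using tot by simp
  qed
  then have "(\<Sum>i<j. rearr k a i) \<le> top_sum d \<nu> j" for j
    using pre[of j] \<epsilon> by (simp add: top)
  moreover have "(\<Sum>i<d. \<nu> i) = (\<Sum>i<k. a i)"
    using sum\<nu>[of "{..<d}" "\<lambda>t _. t"] n m tot by simp
  moreover have "\<nu> i \<le> \<nu> j" if ij: "i \<le> j" "j < d" for i j
  proof -
    consider "i = j" | "i < n" "i < j" | "i = n" "j = m" | "n \<le> i" "i < j" "m < j" using ij n by linarith
    then show ?thesis
    proof cases
      case 2
      have "0 \<le> \<nu> j" using \<mu>0[OF ij(2)] \<epsilon> m by (cases "j = n"; cases "j = m") (auto simp: \<nu>n \<nu>m \<nu>o)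
      then show ?thesis using 2 below[of i] n by (simp add: \<nu>o)
    next
      case 3
      then show ?thesis using \<epsilon> by (simp add: \<nu>n \<nu>m)
    next
      case 4
      have "\<nu> j = \<mu> j" using 4 n by (simp add: \<nu>o)
      moreover have "\<nu> i \<le> \<mu> j"
      proof -
        consider "i = n" | "i = m" | "i \<noteq> n" "i \<noteq> m" by blast
        then show ?thesis
          using \<mu>mono[of m j] \<mu>mono[of i j] ij 4 \<epsilon> m by cases (simp_all add: \<nu>n \<nu>m \<nu>o)
      qed
      ultimately show ?thesis by simp
    qed simp
  qed
  moreover have "0 \<le> \<nu> j" if "j < d" for j
    using \<mu>0[OF that] \<epsilon> m by (cases "j = n"; cases "j = m") (auto simp: \<nu>n \<nu>m \<nu>o)
  moreover have "\<nu> j = 0" if "d \<le> j" for j using that out n m by (simp add: \<nu>o)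
  ultimately have "\<nu> \<in> spectra k a d" unfolding spectra_iff by auto
  from min[OF this] have "g 0 + g (\<mu> m) \<le> g \<epsilon> + g (\<mu> m - \<epsilon>)"
    using sum\<nu>[of "{..<d}" "\<lambda>t j. g (\<beta> j + t)"] n m \<beta>z[of n] \<beta>z[of m] im by simp
  then show False using strictly_convex_transfer[OF g, of 0 \<epsilon> "\<mu> m"] \<epsilon> m by simp
qed

text \<open>
  A minimizer for the closure of \<open>f\<close> only sees arguments at which the closure agrees with \<open>f\<close>, and
  the closure lies below \<open>f\<close>. Uniqueness follows by taking midpoints.
\<close>

lemma unique_minimizer:
  assumes f: "strictly_convex_on {0..} f" and d: "0 < d"
    and \<beta>: "\<And>i. i < d \<Longrightarrow> 0 \<le> \<beta> i" "nonincreasing d \<beta>"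
    and a: "\<And>i. i < k \<Longrightarrow> 0 < a i" and rk: "card {i. i < d \<and> \<beta> i = 0} \<le> k"
  shows "\<exists>\<mu>\<in>spectra k a d. \<forall>\<nu>\<in>spectra k a d. (\<Sum>i<d. f (\<beta> i + \<mu> i)) \<le> (\<Sum>i<d. f (\<beta> i + \<nu> i)) \<and>
     ((\<Sum>i<d. f (\<beta> i + \<nu> i)) \<le> (\<Sum>i<d. f (\<beta> i + \<mu> i)) \<longrightarrow> \<nu> = \<mu>)"
proof -
  obtain g where g: "strictly_convex_on {0..} g" "continuous_on {0..} g" "\<And>x. 0 < x \<Longrightarrow> g x = f x" "g 0 \<le> f 0"
    using strictly_convex_closure[OF f] by blast
  have nn: "0 \<le> \<beta> i + \<mu> i" if "i < d" "\<mu> \<in> spectra k a d" for i \<mu>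
    using \<beta>(1)[OF that(1)] that by (auto simp: spectra_iff)
  have "continuous_on (spectra k a d) (\<lambda>\<mu>. \<Sum>i<d. g (\<beta> i + \<mu> i))"
  proof (rule continuous_on_sum)
    fix i assume i: "i \<in> {..<d}"
    have "continuous_on (spectra k a d) (\<lambda>\<mu>. \<beta> i + \<mu> i)"
      by (intro continuous_on_add continuous_on_const continuous_on_subset[OF continuous_on_product_coordinates]) simp
    then show "continuous_on (spectra k a d) (\<lambda>\<mu>. g (\<beta> i + \<mu> i))"
      by (rule continuous_on_compose2[OF g(2)]) (use i nn in auto)
  qed
  moreover have "spectra k a d \<noteq> {}" by (rule spectra_nonempty[OF d less_imp_le[OF a]])
  ultimately obtain \<mu> where \<mu>: "\<mu> \<in> spectra k a d"
    and min: "\<And>\<nu>. \<nu> \<in> spectra k a d \<Longrightarrow> (\<Sum>i<d. g (\<beta> i + \<mu> i)) \<le> (\<Sum>i<d. g (\<beta> i + \<nu> i))"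
    using continuous_attains_inf[OF compact_spectra] by blast
  have pos: "0 < \<beta> i + \<mu> i" if "i < d" for i
    by (rule minimizer_positive[OF g(1) \<beta> a rk \<mu> min that])
  have eq: "(\<Sum>i<d. f (\<beta> i + \<mu> i)) = (\<Sum>i<d. g (\<beta> i + \<mu> i))"
    by (rule sum.cong) (use pos g(3) in auto)
  have gle: "(\<Sum>i<d. g (\<beta> i + \<nu> i)) \<le> (\<Sum>i<d. f (\<beta> i + \<nu> i))" if "\<nu> \<in> spectra k a d" for \<nu>
  proof (rule sum_mono)
    fix i assume "i \<in> {..<d}"
    then have "0 \<le> \<beta> i + \<nu> i" using nn that by simp
    then show "g (\<beta> i + \<nu> i) \<le> f (\<beta> i + \<nu> i)" using g(3)[of "\<beta> i + \<nu> i"] g(4) by (cases "\<beta> i + \<nu> i = 0") auto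
  qed
  have least: "(\<Sum>i<d. f (\<beta> i + \<mu> i)) \<le> (\<Sum>i<d. f (\<beta> i + \<nu> i))" if "\<nu> \<in> spectra k a d" for \<nu>
    using min[OF that] gle[OF that] eq by simp
  have "\<nu> = \<mu>" if \<nu>: "\<nu> \<in> spectra k a d" and le: "(\<Sum>i<d. f (\<beta> i + \<nu> i)) \<le> (\<Sum>i<d. f (\<beta> i + \<mu> i))" for \<nu>
  proof (rule ccontr)
    assume "\<nu> \<noteq> \<mu>"
    then obtain i where "\<nu> i \<noteq> \<mu> i" by blast
    moreover from this have "i < d" using \<mu> \<nu> by (metis not_less spectra_iff)
    ultimately have "\<exists>i\<in>{..<d}. \<beta> i + \<nu> i \<noteq> \<beta> i + \<mu> i" by auto
    then have "(\<Sum>i<d. f ((\<beta> i + \<nu> i + (\<beta> i + \<mu> i)) / 2)) < ((\<Sum>i<d. f (\<beta> i + \<nu> i)) + (\<Sum>i<d. f (\<beta> i + \<mu> i))) / 2"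
      by (intro strictly_convex_midpoint_sum[OF f]) (use nn \<mu> \<nu> in auto)
    moreover have mid: "(\<beta> i + \<nu> i + (\<beta> i + \<mu> i)) / 2 = \<beta> i + (\<nu> i + \<mu> i) / 2" for i by (simp add: field_simps)
    ultimately have "(\<Sum>i<d. f (\<beta> i + (\<nu> i + \<mu> i) / 2)) < ((\<Sum>i<d. f (\<beta> i + \<nu> i)) + (\<Sum>i<d. f (\<beta> i + \<mu> i))) / 2"
      by (simp only: mid)
    moreover have False if "M < (N + U) / 2" "U \<le> M" "N \<le> U" for M N U :: real
      using that by (simp add: field_simps)
    ultimately show False using least[OF spectra_midpoint[OF \<nu> \<mu>]] le by blast
  qed
  then show ?thesis using \<mu> least by blast
qed

section \<open>Equality in Lidskii's inequality\<close>

lemma lidskii_prefix: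
  assumes u: "onb d u" and w: "onb d w" and t: "onb d t"
    and x: "nonincreasing d x" and y: "nonincreasing d (\<lambda>l. - y l)" and z: "nonincreasing d z"
    and sum: "spectral d t z = spectral d u x + spectral d w y"
    and z0: "\<And>l. l < d \<Longrightarrow> 0 \<le> z l" and j: "j \<le> d"
  shows "(\<Sum>i<j. rearr d (\<lambda>l. x l + y l) i) \<le> (\<Sum>i<j. z i)"
proof -
  obtain I where I: "I \<subseteq> {..<d}" "card I \<le> j" "(\<Sum>i<j. rearr d (\<lambda>l. x l + y l) i) = (\<Sum>i\<in>I. x i + y i)"
    using prefix_rearr_eq_subset_sum by blast
  have "(\<Sum>i\<in>I. x i + y i) \<le> (\<Sum>i<card I. z i)" by (rule lidskii[OF u w t x y z sum I(1)])
  also have "\<dots> \<le> (\<Sum>i<j. z i)" by (rule sum_mono2) (use I j z0 in auto)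
  finally show ?thesis using I(3) by simp
qed

lemma lidskii_convex:
  assumes u: "onb d u" and w: "onb d w" and t: "onb d t"
    and x: "nonincreasing d x" and y: "nonincreasing d (\<lambda>l. - y l)" and z: "nonincreasing d z"
    and sum: "spectral d t z = spectral d u x + spectral d w y"
    and nn: "\<And>l. l < d \<Longrightarrow> 0 \<le> x l" "\<And>l. l < d \<Longrightarrow> 0 \<le> y l" "\<And>l. l < d \<Longrightarrow> 0 \<le> z l"
    and f: "strictly_convex_on {0..} f"
  shows "(\<Sum>l<d. f (x l + y l)) \<le> (\<Sum>l<d. f (z l))"
    and "(\<Sum>l<d. f (z l)) \<le> (\<Sum>l<d. f (x l + y l)) \<Longrightarrow> l < d \<Longrightarrow> z l = rearr d (\<lambda>l. x l + y l) l"
proof -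
  let ?r = "rearr d (\<lambda>l. x l + y l)"
  have r0: "0 \<le> ?r i" for i by (rule rearr_nonneg) (use nn in auto)
  have pre: "(\<Sum>i<j. ?r i) \<le> (\<Sum>i<j. z i)" if "j \<le> d" for j
    by (rule lidskii_prefix[OF u w t x y z sum nn(3) that])
  have tot: "(\<Sum>i<d. ?r i) = (\<Sum>i<d. z i)"
    using sum_rearr[of "\<lambda>t. t" d "\<lambda>l. x l + y l"] spectral_sum_trace[OF u w t sum] by (simp add: sum.distrib)
  have fr: "(\<Sum>l<d. f (?r l)) = (\<Sum>l<d. f (x l + y l))" by (rule sum_rearr)
  show "(\<Sum>l<d. f (x l + y l)) \<le> (\<Sum>l<d. f (z l))"
    unfolding fr[symmetric]
    by (rule karamata[OF strictly_convex_imp_convex[OF f] rearr_nonincreasing r0 z nn(3) pre tot])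
  show "z l = ?r l" if "(\<Sum>l<d. f (z l)) \<le> (\<Sum>l<d. f (x l + y l))" "l < d"
    using karamata_strict[OF f rearr_nonincreasing r0 z nn(3) pre tot that(1)[folded fr] that(2)] by simp
qed

text \<open>
  The Hilbert-Schmidt norm can be computed in any orthonormal basis.
\<close>

lemma hilbert_schmidt_spectral:
  assumes u: "onb d u" and t: "onb d t"
  shows "(\<Sum>i<d. Re ((spectral d t z *\<^sub>v u i) \<bullet>c (spectral d t z *\<^sub>v u i))) = (\<Sum>l<d. (z l)\<^sup>2)"
proof -
  have "(\<Sum>i<d. Re ((spectral d t z *\<^sub>v u i) \<bullet>c (spectral d t z *\<^sub>v u i)))
      = (\<Sum>i<d. \<Sum>l<d. (z l)\<^sup>2 * (cmod (t l \<bullet>c u i))\<^sup>2)"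
  proof (rule sum.cong[OF refl])
    fix i assume "i \<in> {..<d}"
    then have ui: "u i \<in> carrier_vec d" using onb_carrier[OF u] by simp
    have "Re ((spectral d t z *\<^sub>v u i) \<bullet>c (spectral d t z *\<^sub>v u i)) = (\<Sum>l<d. (cmod ((spectral d t z *\<^sub>v u i) \<bullet>c t l))\<^sup>2)"
      by (rule parseval_norm[OF t mult_mat_vec_carrier[OF spectral_carrier ui], symmetric])
    also have "\<dots> = (\<Sum>l<d. (z l)\<^sup>2 * (cmod (t l \<bullet>c u i))\<^sup>2)"
    proof (rule sum.cong[OF refl])
      fix l assume "l \<in> {..<d}"
      then have l: "l < d" by simp
      have "cmod (u i \<bullet>c t l) = cmod (t l \<bullet>c u i)"
        using cip_commute[OF ui onb_carrier[OF t l]] by simp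
      then show "(cmod ((spectral d t z *\<^sub>v u i) \<bullet>c t l))\<^sup>2 = (z l)\<^sup>2 * (cmod (t l \<bullet>c u i))\<^sup>2"
        unfolding spectral_coeff[OF t ui l] by (simp add: norm_mult power_mult_distrib)
    qed
    finally show "Re ((spectral d t z *\<^sub>v u i) \<bullet>c (spectral d t z *\<^sub>v u i)) = (\<Sum>l<d. (z l)\<^sup>2 * (cmod (t l \<bullet>c u i))\<^sup>2)" .
  qed
  also have "\<dots> = (\<Sum>l<d. (z l)\<^sup>2 * (\<Sum>i<d. (cmod (t l \<bullet>c u i))\<^sup>2))"
    by (subst sum.swap) (simp add: sum_distrib_left)
  also have "\<dots> = (\<Sum>l<d. (z l)\<^sup>2)"
    by (rule sum.cong[OF refl]) (simp add: parseval_norm[OF u onb_carrier[OF t]] onb_cip[OF t])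
  finally show ?thesis .
qed

lemma cip_add_self:
  assumes p: "p \<in> carrier_vec d" and q: "q \<in> carrier_vec d"
  shows "Re ((p + q) \<bullet>c (p + q)) = Re (p \<bullet>c p) + 2 * Re (p \<bullet>c q) + Re (q \<bullet>c q)"
proof -
  have s: "p + q \<in> carrier_vec d" using p q by simp
  have 1: "p \<bullet>c (p + q) = cnj (p \<bullet>c p + q \<bullet>c p)" 
    using cip_commute[OF p s] cip_add_left[OF p q p] by simp
  have 2: "q \<bullet>c (p + q) = cnj (p \<bullet>c q + q \<bullet>c q)" 
    using cip_commute[OF q s] cip_add_left[OF p q q] by simp
  have 3: "Re (q \<bullet>c p) = Re (p \<bullet>c q)" using cip_commute[OF q p] by simp
  show ?thesis unfolding cip_add_left[OF p q s] 1 2 using 3 by simp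
qed

text \<open>
  Compare the Hilbert-Schmidt norms of the two sides of \<open>C = A + B\<close>. The assumption on the spectra
  gives \<open>\<Sum> (x i + y i)\<^sup>2\<close> on the left, which leaves \<open>\<Sum> x i y i\<close> for the trace of \<open>A B\<close>.
\<close>

lemma trace_equality:
  assumes u: "onb d u" and w: "onb d w" and t: "onb d t"
    and sum: "spectral d t z = spectral d u x + spectral d w y"
    and eq: "\<And>l. l < d \<Longrightarrow> z l = rearr d (\<lambda>l. x l + y l) l"
  shows "(\<Sum>i<d. x i * Re ((spectral d w y *\<^sub>v u i) \<bullet>c u i)) = (\<Sum>i<d. x i * y i)"
proof -
  define b where "b i = Re ((spectral d w y *\<^sub>v u i) \<bullet>c u i)" for i
  have "(\<Sum>l<d. (z l)\<^sup>2) = (\<Sum>l<d. (rearr d (\<lambda>l. x l + y l) l)\<^sup>2)" by (rule sum.cong) (use eq in auto)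
  also have "\<dots> = (\<Sum>l<d. (x l + y l)\<^sup>2)" by (rule sum_rearr)
  finally have 1: "(\<Sum>l<d. (z l)\<^sup>2) = (\<Sum>l<d. (x l)\<^sup>2) + (\<Sum>l<d. (y l)\<^sup>2) + 2 * (\<Sum>l<d. x l * y l)"
    by (simp add: power2_sum sum.distrib sum_distrib_left mult.assoc)
  have "(\<Sum>l<d. (z l)\<^sup>2) = (\<Sum>i<d. Re ((spectral d t z *\<^sub>v u i) \<bullet>c (spectral d t z *\<^sub>v u i)))"
    by (rule hilbert_schmidt_spectral[OF u t, symmetric])
  also have "\<dots> = (\<Sum>i<d. Re ((spectral d u x *\<^sub>v u i) \<bullet>c (spectral d u x *\<^sub>v u i)) + 2 * (x i * b i)
      + Re ((spectral d w y *\<^sub>v u i) \<bullet>c (spectral d w y *\<^sub>v u i)))"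
  proof (rule sum.cong[OF refl])
    fix i assume "i \<in> {..<d}"
    then have i: "i < d" and ui: "u i \<in> carrier_vec d" using onb_carrier[OF u] by auto
    have p: "spectral d u x *\<^sub>v u i \<in> carrier_vec d" and q: "spectral d w y *\<^sub>v u i \<in> carrier_vec d"
      using mult_mat_vec_carrier[OF spectral_carrier ui] by auto
    have "Re ((spectral d u x *\<^sub>v u i) \<bullet>c (spectral d w y *\<^sub>v u i)) = x i * b i"
      unfolding spectral_eigen[OF u i] cip_smult_left[OF ui q] b_def
      using cip_commute[OF ui q] by simp
    then show "Re ((spectral d t z *\<^sub>v u i) \<bullet>c (spectral d t z *\<^sub>v u i)) =
       Re ((spectral d u x *\<^sub>v u i) \<bullet>c (spectral d u x *\<^sub>v u i)) + 2 * (x i * b i)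
      + Re ((spectral d w y *\<^sub>v u i) \<bullet>c (spectral d w y *\<^sub>v u i))"
      unfolding sum add_mult_distrib_mat_vec[OF spectral_carrier spectral_carrier ui] cip_add_self[OF p q] by simp
  qed
  also have "\<dots> = (\<Sum>l<d. (x l)\<^sup>2) + 2 * (\<Sum>i<d. x i * b i) + (\<Sum>l<d. (y l)\<^sup>2)"
    by (simp add: sum.distrib hilbert_schmidt_spectral[OF u u] hilbert_schmidt_spectral[OF u w] sum_distrib_left)
  finally show ?thesis using 1 by (simp add: b_def)
qed

lemma abel_summation:
  fixes x e :: "nat \<Rightarrow> real"
  shows "(\<Sum>i<Suc n. x i * e i) = x n * (\<Sum>i<Suc n. e i) + (\<Sum>m<n. (x m - x (Suc m)) * (\<Sum>i<Suc m. e i))"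
  by (induction n) (simp_all add: algebra_simps)

text \<open>
  Let \<open>B\<close> be the operator with the increasing spectrum \<open>y\<close>, and \<open>b\<close> its diagonal in the basis \<open>u\<close>. The
  sum of the first \<open>m\<close> entries of \<open>b\<close> exceeds that of \<open>y\<close> by an amount \<open>E m \<ge> 0\<close>, and by Abel summation
  the trace equality forces \<open>E m = 0\<close> at each cut \<open>m\<close> where \<open>x\<close> drops. There the slack of the linear
  programming bound vanishes: eigenvectors of \<open>B\<close> with an eigenvalue below \<open>y m\<close> lie in the span of
  \<open>u 0, \<dots>, u (m - 1)\<close>, and those with an eigenvalue above \<open>y m\<close> are orthogonal to it. Hence \<open>B\<close> has no
  matrix entry across the cut.
\<close>

lemma trace_equality_block:
  assumes u: "onb d u" and w: "onb d w"
    and x: "nonincreasing d x" and y: "nonincreasing d (\<lambda>l. - y l)"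
    and tr: "(\<Sum>i<d. x i * Re ((spectral d w y *\<^sub>v u i) \<bullet>c u i)) = (\<Sum>i<d. x i * y i)"
    and ij: "i < j" "j < d" and ne: "x i \<noteq> x j"
  shows "(spectral d w y *\<^sub>v u i) \<bullet>c u j = 0"
proof -
  define b where "b i = Re ((spectral d w y *\<^sub>v u i) \<bullet>c u i)" for i
  define c where "c i l = (cmod (u i \<bullet>c w l))\<^sup>2" for i l
  have b: "b i = (\<Sum>l<d. y l * c i l)" if "i < d" for i
    unfolding b_def c_def by (rule quadratic_form_spectral[OF w onb_carrier[OF u that]])
  have row: "(\<Sum>l<d. c i l) = 1" if "i < d" for i
    unfolding c_def parseval_norm[OF w onb_carrier[OF u that]] by (simp add: onb_cip[OF u that that])
  have col: "(\<Sum>i<d. c i l) = 1" if "l < d" for l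
  proof -
    have "(\<Sum>i<d. c i l) = (\<Sum>i<d. (cmod (w l \<bullet>c u i))\<^sup>2)"
      unfolding c_def
      by (rule sum.cong[OF refl]) (use cip_commute[OF onb_carrier[OF u] onb_carrier[OF w that]] in simp)
    then show ?thesis unfolding parseval_norm[OF u onb_carrier[OF w that]] by (simp add: onb_cip[OF w that that])
  qed
  have c0: "0 \<le> c i l" for i l by (simp add: c_def)
  define p where "p m l = (\<Sum>i<m. c i l)" for m l
  define E where "E m = (\<Sum>i<m. b i - y i)" for m
  define gap where "gap m = (\<Sum>l<m. (1 - p m l) * (y m - y l)) + (\<Sum>l\<in>{..<d} - {..<m}. p m l * (y l - y m))" for m
  have p: "0 \<le> p m l" "p m l \<le> 1" if "m \<le> d" "l < d" for m l
  proof -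
    show "0 \<le> p m l" by (simp add: p_def c0 sum_nonneg)
    have "p m l \<le> (\<Sum>i<d. c i l)" unfolding p_def by (rule sum_mono2) (use that c0 in auto)
    then show "p m l \<le> 1" using col[OF that(2)] by simp
  qed
  have bp: "(\<Sum>i<m. b i) = (\<Sum>l<d. p m l * y l)" if "m \<le> d" for m
  proof -
    have "(\<Sum>i<m. b i) = (\<Sum>i<m. \<Sum>l<d. y l * c i l)" by (rule sum.cong) (use b that in auto)
    also have "\<dots> = (\<Sum>l<d. p m l * y l)"
      unfolding p_def by (subst sum.swap) (simp add: sum_distrib_left mult.commute)
    finally show ?thesis .
  qed
  have sp: "(\<Sum>l<d. p m l) = real m" if "m \<le> d" for m
  proof -
    have "(\<Sum>l<d. p m l) = (\<Sum>i<m. \<Sum>l<d. c i l)" unfolding p_def by (rule sum.swap)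
    also have "\<dots> = (\<Sum>i<m. 1)" by (rule sum.cong) (use row that in auto)
    finally show ?thesis by simp
  qed
  have ymono: "y l \<le> y m" if "l \<le> m" "m < d" for l m using nonincreasingD[OF y that] by simp
  have gapE: "gap m \<le> E m" if m: "m < d" for m
  proof -
    have "(\<Sum>l<d. p m l * - y l) + (\<Sum>l<m. (1 - p m l) * (- y l - - y m)) + (\<Sum>l\<in>{..<d} - {..<m}. p m l * (- y m - - y l)) \<le> (\<Sum>l<m. - y l)"
      by (rule weighted_sum_gap) (use m sp[of m] in auto)
    then have "(\<Sum>l<m. y l) + gap m \<le> (\<Sum>l<d. p m l * y l)"
      by (simp add: gap_def sum_negf)
    then show ?thesis using bp[of m] m by (simp add: E_def sum_subtractf)
  qed
  have t1: "0 \<le> (1 - p m l) * (y m - y l)" if "m < d" "l < m" for m l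
    using p[of m l] ymono[of l m] that by simp
  have t2: "0 \<le> p m l * (y l - y m)" if "m \<le> l" "l < d" for m l
    using p[of m l] ymono[of m l] that by simp
  have gap0: "0 \<le> gap m" if "m < d" for m
    unfolding gap_def using t1 t2 that by (intro add_nonneg_nonneg sum_nonneg) auto
  have Ed: "E d = 0"
  proof -
    have "(\<Sum>i<d. b i) = (\<Sum>l<d. y l)" unfolding bp[OF order_refl] by (rule sum.cong) (simp_all add: p_def col)
    then show ?thesis by (simp add: E_def sum_subtractf)
  qed
  have drop: "E (Suc m) = 0" if m: "Suc m < d" "x (Suc m) < x m" for m
  proof -
    have d: "d = Suc (d - 1)" using m by simp
    have "0 = (\<Sum>i<d. x i * (b i - y i))" using tr by (simp add: b_def right_diff_distrib sum_subtractf)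
    also have "\<dots> = x (d - 1) * E d + (\<Sum>m<d - 1. (x m - x (Suc m)) * E (Suc m))"
      using abel_summation[of x "\<lambda>i. b i - y i" "d - 1"] d by (simp add: E_def)
    finally have z: "(\<Sum>m<d - 1. (x m - x (Suc m)) * E (Suc m)) = 0" using Ed by simp
    have nn: "0 \<le> (x m - x (Suc m)) * E (Suc m)" if "m \<in> {..<d - 1}" for m
    proof -
      have "x (Suc m) \<le> x m" by (rule nonincreasingD[OF x]) (use that in auto)
      moreover have "0 \<le> E (Suc m)" using gap0[of "Suc m"] gapE[of "Suc m"] that by force
      ultimately show ?thesis by simp
    qed
    have "(x m - x (Suc m)) * E (Suc m) = 0"
      using z m(1) sum_nonneg_eq_0_iff[of "{..<d - 1}" "\<lambda>m. (x m - x (Suc m)) * E (Suc m)"] nn by simp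
    then show ?thesis using m(2) by simp
  qed
  have "\<exists>m. i \<le> m \<and> m < j \<and> x (Suc m) < x m"
  proof (rule ccontr)
    assume "\<not> ?thesis"
    then have step: "x m \<le> x (Suc m)" if "i \<le> m" "m < j" for m using that by force
    have "x i \<le> x n" if "i \<le> n" "n \<le> j" for n
      using that
    proof (induction n rule: dec_induct)
      case (step n)
      then show ?case using \<open>\<And>m. i \<le> m \<Longrightarrow> m < j \<Longrightarrow> x m \<le> x (Suc m)\<close>[of n] by simp
    qed simp
    then have "x i \<le> x j" using ij by simp
    then show False using nonincreasingD[OF x, of i j] ij ne by simp
  qed
  then obtain m' where m': "i \<le> m'" "m' < j" "x (Suc m') < x m'" by blast
  define m where "m = Suc m'"
  have m: "i < m" "m \<le> j" "m < d" using m' ij by (auto simp: m_def)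
  have "gap m = 0" using gap0[OF m(3)] gapE[OF m(3)] drop[of m'] m m' by (simp add: m_def)
  moreover have "0 \<le> (\<Sum>l<m. (1 - p m l) * (y m - y l))" "0 \<le> (\<Sum>l\<in>{..<d} - {..<m}. p m l * (y l - y m))"
    using t1 t2 m by (auto intro!: sum_nonneg)
  ultimately have "(\<Sum>l<m. (1 - p m l) * (y m - y l)) = 0" "(\<Sum>l\<in>{..<d} - {..<m}. p m l * (y l - y m)) = 0"
    unfolding gap_def by linarith+
  note gap_parts = this
  have z1: "(1 - p m l) * (y m - y l) = 0" if "l < m" for l
    using gap_parts(1) sum_nonneg_eq_0_iff[of "{..<m}" "\<lambda>l. (1 - p m l) * (y m - y l)"] t1[OF m(3)] that by simp
  have z2: "p m l * (y l - y m) = 0" if "m \<le> l" "l < d" for l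
    using gap_parts(2) sum_nonneg_eq_0_iff[of "{..<d} - {..<m}" "\<lambda>l. p m l * (y l - y m)"] t2[of m] that by simp
  have vanish: "complex_of_real (y l - y m) * ((u i \<bullet>c w l) * cnj (u j \<bullet>c w l)) = 0" if l: "l < d" for l
  proof (cases "y l = y m")
    case False
    show ?thesis
    proof (cases "l < m")
      case True
      then have "p m l = 1" using z1[of l] False by auto
      moreover have "p m l + c j l \<le> (\<Sum>i<d. c i l)"
      proof -
        have "p m l + c j l = (\<Sum>i\<in>insert j {..<m}. c i l)" using m by (simp add: p_def)
        also have "\<dots> \<le> (\<Sum>i<d. c i l)" by (rule sum_mono2) (use m ij c0 in auto)
        finally show ?thesis .
      qed
      ultimately have "c j l = 0" using col[OF l] c0[of j l] by simp
      then show ?thesis by (simp add: c_def)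
    next
      case f: False
      then have "p m l = 0" using z2[of l] l False by auto
      then have "c i l = 0" unfolding p_def using m c0 by (simp add: sum_nonneg_eq_0_iff)
      then show ?thesis by (simp add: c_def)
    qed
  qed simp
  have i: "i < d" using ij by simp
  have "(spectral d w y *\<^sub>v u i) \<bullet>c u j = (\<Sum>l<d. complex_of_real (y l) * ((u i \<bullet>c w l) * cnj (u j \<bullet>c w l)))"
    unfolding spectral_form[OF w onb_carrier[OF u i] onb_carrier[OF u ij(2)]] by (simp add: mult.assoc)
  also have "\<dots> = (\<Sum>l<d. complex_of_real (y l - y m) * ((u i \<bullet>c w l) * cnj (u j \<bullet>c w l))
       + complex_of_real (y m) * ((u i \<bullet>c w l) * cnj (u j \<bullet>c w l)))"
    by (rule sum.cong) (simp_all add: algebra_simps)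
  also have "\<dots> = complex_of_real (y m) * (\<Sum>l<d. (u i \<bullet>c w l) * cnj (u j \<bullet>c w l))"
    unfolding sum.distrib sum_distrib_left using vanish by (simp add: sum.neutral)
  also have "\<dots> = 0"
    unfolding parseval[OF w onb_carrier[OF u i] onb_carrier[OF u ij(2)]] using ij by (simp add: onb_cip[OF u])
  finally show ?thesis .
qed

section \<open>Joint diagonalization\<close>

text \<open>
  The hypothesis says that the operators \<open>A\<close> and \<open>B\<close> commute. Diagonalize \<open>M = c A + B\<close> for a \<open>c\<close>
  chosen such that an eigenvalue of \<open>M\<close> determines its parts from \<open>A\<close> and from \<open>B\<close>. The component of an
  eigenvector of \<open>M\<close> in an eigenspace of \<open>A\<close> is again an eigenvector of \<open>M\<close>, hence of \<open>B\<close>, so only one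
  such component is nonzero.
\<close>

lemma joint_basis:
  assumes u: "onb d u" and w: "onb d w"
    and block: "\<And>i j. i < d \<Longrightarrow> j < d \<Longrightarrow> x i \<noteq> x j \<Longrightarrow> (spectral d w y *\<^sub>v u i) \<bullet>c u j = 0"
  shows "\<exists>v x' y'. onb d v \<and> spectral d u x = spectral d v x' \<and> spectral d w y = spectral d v y'"
proof -
  let ?A = "spectral d u x" and ?B = "spectral d w y"
  \<comment> \<open>the finitely many \<open>c\<close> for which \<open>c x i + y j = c x i' + y j'\<close> has a solution with \<open>x i \<noteq> x i'\<close>\<close>
  define bad where "bad = (\<lambda>(i, i', j, j'). (y j' - y j) / (x i - x i')) ` ({..<d} \<times> {..<d} \<times> {..<d} \<times> {..<d})"
  have "finite bad" by (simp add: bad_def)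
  then obtain c where c: "c \<notin> bad" using ex_new_if_finite[OF infinite_UNIV_char_0] by blast
  have sep: "x i = x i'" if "i < d" "i' < d" "j < d" "j' < d" "c * (x i - x i') = y j' - y j" for i i' j j'
  proof (rule ccontr)
    assume "x i \<noteq> x i'"
    then have "c = (y j' - y j) / (x i - x i')" using that(5) by (simp add: field_simps)
    then have "c \<in> bad" unfolding bad_def using that by (intro image_eqI[of _ _ "(i, i', j, j')"]) auto
    with c show False by simp
  qed
  let ?M = "spectral d u (\<lambda>i. c * x i) + ?B"
  have hM: "hermitian_op d ?M" by (intro hermitian_op_add hermitian_spectral u w)
  then obtain v m where v: "onb d v" "?M = spectral d v m" using spectral_theorem by blast
  have hB: "hermitian_op d ?B" by (rule hermitian_spectral[OF w])
  have cB: "?B *\<^sub>v h \<in> carrier_vec d" and cA: "spectral d u z *\<^sub>v h \<in> carrier_vec d" if "h \<in> carrier_vec d" for h z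
    using mult_mat_vec_carrier[OF spectral_carrier that] by auto
  have Bexp: "(?B *\<^sub>v h) \<bullet>c u r = (\<Sum>i<d. (h \<bullet>c u i) * cnj ((?B *\<^sub>v u r) \<bullet>c u i))"
    if h: "h \<in> carrier_vec d" and r: "r < d" for h r
    unfolding hermitian_opD[OF hB h onb_carrier[OF u r]]
    by (rule parseval[OF u h cB[OF onb_carrier[OF u r]], symmetric])
  have Mcoeff: "(?M *\<^sub>v h) \<bullet>c u r = complex_of_real (c * x r) * (h \<bullet>c u r) + (?B *\<^sub>v h) \<bullet>c u r"
    if h: "h \<in> carrier_vec d" and r: "r < d" for h r
    unfolding add_mult_distrib_mat_vec[OF spectral_carrier spectral_carrier h]
      cip_add_left[OF cA[OF h] cB[OF h] onb_carrier[OF u r]] spectral_coeff[OF u h r] ..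
  have single: "\<exists>\<alpha>. ?A *\<^sub>v v l = complex_of_real \<alpha> \<cdot>\<^sub>v v l \<and> ?B *\<^sub>v v l = complex_of_real (m l - c * \<alpha>) \<cdot>\<^sub>v v l"
    if l: "l < d" for l
  proof -
    note vl = onb_carrier[OF v(1) l]
    have Mv: "?M *\<^sub>v v l = complex_of_real (m l) \<cdot>\<^sub>v v l" unfolding v(2) by (rule spectral_eigen[OF v(1) l])
    have eig: "\<exists>j<d. y j = m l - c * x i" if i: "i < d" and nz: "v l \<bullet>c u i \<noteq> 0" for i
    proof -
      \<comment> \<open>the component of \<open>v l\<close> in the eigenspace with eigenvalue \<open>x i\<close>\<close>
      obtain h where h: "h \<in> carrier_vec d" "\<And>r. r < d \<Longrightarrow> h \<bullet>c u r = (if x r = x i then v l \<bullet>c u r else 0)"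
        using onb_combination[OF u, of "\<lambda>r. if x r = x i then v l \<bullet>c u r else 0"] by blast
      have Bh: "(?B *\<^sub>v h) \<bullet>c u r = (if x r = x i then (?B *\<^sub>v v l) \<bullet>c u r else 0)" if r: "r < d" for r
        unfolding Bexp[OF h(1) r] Bexp[OF vl r]
      proof (cases "x r = x i")
        case True
        have "(h \<bullet>c u s) * cnj ((?B *\<^sub>v u r) \<bullet>c u s) = (v l \<bullet>c u s) * cnj ((?B *\<^sub>v u r) \<bullet>c u s)" if s: "s < d" for s
          using h(2)[OF s] block[OF r s] True by (cases "x s = x i") auto
        then have "(\<Sum>s<d. (h \<bullet>c u s) * cnj ((?B *\<^sub>v u r) \<bullet>c u s)) = (\<Sum>s<d. (v l \<bullet>c u s) * cnj ((?B *\<^sub>v u r) \<bullet>c u s))"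
          by (intro sum.cong) auto
        then show "(\<Sum>s<d. (h \<bullet>c u s) * cnj ((?B *\<^sub>v u r) \<bullet>c u s)) =
          (if x r = x i then \<Sum>s<d. (v l \<bullet>c u s) * cnj ((?B *\<^sub>v u r) \<bullet>c u s) else 0)"
          using True by simp
      next
        case False
        have "(h \<bullet>c u s) * cnj ((?B *\<^sub>v u r) \<bullet>c u s) = 0" if s: "s < d" for s
          using h(2)[OF s] block[OF r s] False by (cases "x s = x i") auto
        then have "(\<Sum>s<d. (h \<bullet>c u s) * cnj ((?B *\<^sub>v u r) \<bullet>c u s)) = 0"
          by (intro sum.neutral) auto
        then show "(\<Sum>s<d. (h \<bullet>c u s) * cnj ((?B *\<^sub>v u r) \<bullet>c u s)) =
          (if x r = x i then \<Sum>s<d. (v l \<bullet>c u s) * cnj ((?B *\<^sub>v u r) \<bullet>c u s) else 0)"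
          using False by simp
      qed
      have BE: "?B *\<^sub>v h = complex_of_real (m l - c * x i) \<cdot>\<^sub>v h"
      proof (rule onb_vec_eqI[OF u cB[OF h(1)]])
        fix r assume r: "r < d"
        show "(?B *\<^sub>v h) \<bullet>c u r = (complex_of_real (m l - c * x i) \<cdot>\<^sub>v h) \<bullet>c u r"
        proof (cases "x r = x i")
          case True
          have "complex_of_real (m l) * (v l \<bullet>c u r) = complex_of_real (c * x r) * (v l \<bullet>c u r) + (?B *\<^sub>v v l) \<bullet>c u r"
            using Mcoeff[OF vl r] unfolding Mv cip_smult_left[OF vl onb_carrier[OF u r]] .
          then show ?thesis
            unfolding Bh[OF r] cip_smult_left[OF h(1) onb_carrier[OF u r]] h(2)[OF r] using True
            by (simp add: algebra_simps)
        next
          case False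
          then show ?thesis
            unfolding Bh[OF r] cip_smult_left[OF h(1) onb_carrier[OF u r]] h(2)[OF r] by simp
        qed
      qed (use h in simp)
      have "\<exists>j<d. h \<bullet>c w j \<noteq> 0"
      proof (rule ccontr)
        assume "\<not> ?thesis"
        then have "h = 0\<^sub>v d"
          by (intro onb_vec_eqI[OF w h(1) zero_carrier_vec]) (use onb_carrier[OF w] in auto)
        then have "h \<bullet>c u i = 0" using onb_carrier[OF u i] by simp
        then show False using h(2)[OF i] nz by simp
      qed
      then obtain j where j: "j < d" "h \<bullet>c w j \<noteq> 0" by blast
      have "complex_of_real (y j) * (h \<bullet>c w j) = complex_of_real (m l - c * x i) * (h \<bullet>c w j)"
        using spectral_coeff[OF w h(1) j(1), of y] unfolding BE cip_smult_left[OF h(1) onb_carrier[OF w j(1)]] by (rule sym)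
      then have "y j = m l - c * x i" using j(2) by (metis mult_cancel_right of_real_eq_iff)
      then show ?thesis using j(1) by blast
    qed
    have "\<exists>i<d. v l \<bullet>c u i \<noteq> 0"
    proof (rule ccontr)
      assume "\<not> ?thesis"
      then have "v l = 0\<^sub>v d"
        by (intro onb_vec_eqI[OF u vl zero_carrier_vec]) (use onb_carrier[OF u] in auto)
      then show False using onb_cip[OF v(1) l l] by simp
    qed
    then obtain i where i: "i < d" "v l \<bullet>c u i \<noteq> 0" by blast
    have same: "x r = x i" if r: "r < d" "v l \<bullet>c u r \<noteq> 0" for r
    proof -
      obtain j where j: "j < d" "y j = m l - c * x r" using eig[OF r] by blast
      obtain j' where j': "j' < d" "y j' = m l - c * x i" using eig[OF i] by blast
      show ?thesis by (rule sep[OF r(1) i(1) j(1) j'(1)]) (simp add: j j' algebra_simps)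
    qed
    have Av: "spectral d u (\<lambda>i. k * x i) *\<^sub>v v l = complex_of_real (k * x i) \<cdot>\<^sub>v v l" for k
    proof (rule onb_vec_eqI[OF u cA[OF vl]])
      fix r assume r: "r < d"
      show "(spectral d u (\<lambda>i. k * x i) *\<^sub>v v l) \<bullet>c u r = (complex_of_real (k * x i) \<cdot>\<^sub>v v l) \<bullet>c u r"
        unfolding spectral_coeff[OF u vl r] cip_smult_left[OF vl onb_carrier[OF u r]]
        using same[OF r] by (cases "v l \<bullet>c u r = 0") auto
    qed (use vl in simp)
    have "?B *\<^sub>v v l = complex_of_real (m l - c * x i) \<cdot>\<^sub>v v l"
    proof (rule onb_vec_eqI[OF u cB[OF vl]])
      fix r assume r: "r < d"
      have "complex_of_real (m l) * (v l \<bullet>c u r) = complex_of_real (c * x r) * (v l \<bullet>c u r) + (?B *\<^sub>v v l) \<bullet>c u r"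
        using Mcoeff[OF vl r] unfolding Mv cip_smult_left[OF vl onb_carrier[OF u r]] .
      moreover have "complex_of_real (c * x r) * (v l \<bullet>c u r) = complex_of_real (c * x i) * (v l \<bullet>c u r)"
        using same[OF r] by (cases "v l \<bullet>c u r = 0") auto
      ultimately have "(?B *\<^sub>v v l) \<bullet>c u r = complex_of_real (m l) * (v l \<bullet>c u r) - complex_of_real (c * x i) * (v l \<bullet>c u r)"
        by (metis add_diff_cancel_left')
      then show "(?B *\<^sub>v v l) \<bullet>c u r = (complex_of_real (m l - c * x i) \<cdot>\<^sub>v v l) \<bullet>c u r"
        unfolding cip_smult_left[OF vl onb_carrier[OF u r]] by (simp add: left_diff_distrib)
    qed (use vl in simp)
    moreover have "?A *\<^sub>v v l = complex_of_real (x i) \<cdot>\<^sub>v v l" using Av[of 1] by simp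
    ultimately show ?thesis by blast
  qed
  then obtain \<alpha> where \<alpha>: "\<And>l. l < d \<Longrightarrow> ?A *\<^sub>v v l = complex_of_real (\<alpha> l) \<cdot>\<^sub>v v l"
    "\<And>l. l < d \<Longrightarrow> ?B *\<^sub>v v l = complex_of_real (m l - c * \<alpha> l) \<cdot>\<^sub>v v l"
    by metis
  have "?A = spectral d v \<alpha>" by (rule spectralI[OF v(1) spectral_carrier \<alpha>(1)])
  moreover have "?B = spectral d v (\<lambda>l. m l - c * \<alpha> l)" by (rule spectralI[OF v(1) spectral_carrier \<alpha>(2)])
  ultimately show ?thesis using v(1) by blast
qed

section \<open>The rank condition\<close>

text \<open>
  The operator is a sum of rank-one matrices, one for each nonzero eigenvalue.
\<close>

lemma rank_spectral_le:
  "vec_space.rank d (spectral d u x) \<le> card {l. l < d \<and> x l \<noteq> 0}"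
proof -
  interpret vec_space "TYPE(complex)" d .
  define S where "S m = mat d d (\<lambda>(i, j). \<Sum>l<m. complex_of_real (x l) * (u l $ i * cnj (u l $ j)))" for m
  have "rank (S m) \<le> card {l. l < m \<and> x l \<noteq> 0}" for m
  proof (induction m)
    case 0
    have "S 0 = 0\<^sub>m d d" by (rule eq_matI) (auto simp: S_def)
    then show ?case using rank_0I by simp
  next
    case (Suc m)
    define R where "R = mat d d (\<lambda>(i, j). complex_of_real (x m) * (u m $ i * cnj (u m $ j)))"
    have S: "S (Suc m) = S m + R" by (rule eq_matI) (auto simp: S_def R_def)
    have c: "S m \<in> carrier_mat d d" "R \<in> carrier_mat d d" by (auto simp: S_def R_def)
    show ?case
    proof (cases "x m = 0")
      case True
      then have "{l. l < Suc m \<and> x l \<noteq> 0} = {l. l < m \<and> x l \<noteq> 0}" by (auto simp: less_Suc_eq)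
      moreover have "S (Suc m) = S m" unfolding S using True by (intro eq_matI) (auto simp: R_def S_def)
      ultimately show ?thesis using Suc by simp
    next
      case False
      then have e: "{l. l < Suc m \<and> x l \<noteq> 0} = insert m {l. l < m \<and> x l \<noteq> 0}" by (auto simp: less_Suc_eq)
      have "rank R \<le> 1"
        by (rule rank_le_1_product_entries[OF c(2), of "\<lambda>i. complex_of_real (x m) * u m $ i" "\<lambda>j. cnj (u m $ j)"])
          (simp add: R_def)
      then show ?thesis using rank_subadditive[OF c] Suc unfolding S e by simp
    qed
  qed
  from this[of d] show ?thesis by (simp add: S_def spectral_def)
qed

lemma initial_data_zero_eigenvalues:
  assumes ini: "initial_data d F a" and S: "frame_op d F = spectral d u x"
  shows "card {i. i < d \<and> x i = 0} \<le> length a"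
proof -
  have "{..<d} = {i. i < d \<and> x i = 0} \<union> {i. i < d \<and> x i \<noteq> 0}" by auto
  then have "d = card ({i. i < d \<and> x i = 0} \<union> {i. i < d \<and> x i \<noteq> 0})" by (metis card_lessThan)
  also have "\<dots> = card {i. i < d \<and> x i = 0} + card {i. i < d \<and> x i \<noteq> 0}"
    by (rule card_Un_disjoint) auto
  finally show ?thesis using ini rank_spectral_le[of d u x] by (simp add: initial_data_def S)
qed

section \<open>Moving spectrum between two eigenvectors\<close>

text \<open>
  The subset constraint for a fixed \<open>I\<close> survives a small transfer from \<open>l\<close> to \<open>m\<close>. Otherwise each \<open>K\<close>
  with at most \<open>card I\<close> elements and a sum reaching \<open>N\<close> has sum exactly \<open>N\<close>, contains \<open>l\<close> and omits \<open>m\<close>.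
  Exchanging single elements shows that \<open>K\<close> has full size, that its entries exceed \<open>y m\<close>, and that the
  entries outside stay below \<open>y l\<close>. The weights \<open>p\<close> of \<open>I\<close> attain the linear programming bound: the
  largest entry outside \<open>K\<close> as threshold yields \<open>p l = 1\<close>, the smallest entry inside yields \<open>p m = 0\<close>.
  So the vectors of \<open>I\<close> exhaust the direction \<open>u l\<close> and avoid \<open>u m\<close>, and the vector \<open>G ! j\<close> fits neither
  inside \<open>I\<close> nor outside.
\<close>

lemma transfer_subset:
  assumes G: "set G \<subseteq> carrier_vec d" and u: "onb d u" and S: "frame_op d G = spectral d u y"
    and lm: "l < d" "m < d" "l \<noteq> m" and j: "j < length G" "G ! j \<bullet>c u l \<noteq> 0" "G ! j \<bullet>c u m \<noteq> 0"
    and I: "I \<subseteq> {..<length G}"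
  shows "\<exists>e>0. \<forall>\<epsilon>. 0 \<le> \<epsilon> \<longrightarrow> \<epsilon> \<le> e \<longrightarrow> (\<exists>K\<subseteq>{..<d}. card K \<le> card I \<and>
      (\<Sum>i\<in>I. Re (G ! i \<bullet>c G ! i)) \<le> sum (y(l := y l - \<epsilon>, m := y m + \<epsilon>)) K)"
proof -
  define N where "N = (\<Sum>i\<in>I. Re (G ! i \<bullet>c G ! i))"
  define y' where "y' \<epsilon> = y(l := y l - \<epsilon>, m := y m + \<epsilon>)" for \<epsilon>
  have y0: "0 \<le> y i" if "i < d" for i by (rule frame_op_eigenvalue_nonneg[OF G u S that])
  have n0: "0 \<le> Re (G ! i \<bullet>c G ! i)" if "i < length G" for i
    using cip_self[of "G ! i" d] G that by (simp add: sum_nonneg subset_iff)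
  have sum': "sum (y' \<epsilon>) K = sum y K - (if l \<in> K then \<epsilon> else 0) + (if m \<in> K then \<epsilon> else 0)" if K: "K \<subseteq> {..<d}" for K \<epsilon>
  proof -
    have fK: "finite K" using K finite_subset by blast
    have "sum (y' \<epsilon>) K = (\<Sum>i\<in>K. y i - (if i = l then \<epsilon> else 0) + (if i = m then \<epsilon> else 0))"
      by (rule sum.cong) (use lm in \<open>auto simp: y'_def\<close>)
    then show ?thesis using fK by (simp add: sum.distrib sum_subtractf)
  qed
  define good where "good e \<longleftrightarrow> (\<forall>\<epsilon>. 0 \<le> \<epsilon> \<longrightarrow> \<epsilon> \<le> e \<longrightarrow> (\<exists>K\<subseteq>{..<d}. card K \<le> card I \<and> N \<le> sum (y' \<epsilon>) K))" for e
  have good1: "\<exists>e>0. good e" if K: "K \<subseteq> {..<d}" "card K \<le> card I" "N < sum y K" for K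
  proof (intro exI[of _ "sum y K - N"] conjI)
    show "good (sum y K - N)"
      unfolding good_def
    proof (intro allI impI exI[of _ K] conjI K(1,2))
      fix \<epsilon> assume "0 \<le> \<epsilon>" "\<epsilon> \<le> sum y K - N"
      then show "N \<le> sum (y' \<epsilon>) K" using sum'[OF K(1), of \<epsilon>] by auto
    qed
  qed (use K in simp)
  have good2: "\<exists>e>0. good e" if K: "K \<subseteq> {..<d}" "card K \<le> card I" "N \<le> sum y K" "l \<notin> K \<or> m \<in> K" for K
    unfolding good_def using K sum'[OF K(1)] by (intro exI[of _ 1] conjI allI impI exI[of _ K]) auto
  have swap: "card (insert q (K - {p})) = card K" "sum y (insert q (K - {p})) = sum y K - y p + y q"
    "insert q (K - {p}) \<subseteq> {..<d}"
    if "K \<subseteq> {..<d}" "p \<in> K" "q \<notin> K" "q < d" for K p q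
  proof -
    have fK: "finite K" using that finite_subset by blast
    have "0 < card K" using that(2) fK by (auto simp: card_gt_0_iff)
    then show "card (insert q (K - {p})) = card K" using that fK by (simp add: card_insert_if)
    show "sum y (insert q (K - {p})) = sum y K - y p + y q" using that fK by (simp add: sum_diff1)
    show "insert q (K - {p}) \<subseteq> {..<d}" using that by auto
  qed
  have "maj (length G) (\<lambda>i. Re (G ! i \<bullet>c G ! i)) d y \<longleftrightarrow>
      (\<forall>I\<subseteq>{..<length G}. \<exists>K\<subseteq>{..<d}. card K \<le> card I \<and> (\<Sum>i\<in>I. Re (G ! i \<bullet>c G ! i)) \<le> sum y K) \<and>
      (\<Sum>i<length G. Re (G ! i \<bullet>c G ! i)) = (\<Sum>i<d. y i)"
    by (rule maj_iff_subset_sums[OF n0 y0])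
  with frame_norms_maj[OF G u S]
  have "\<forall>I\<subseteq>{..<length G}. \<exists>K\<subseteq>{..<d}. card K \<le> card I \<and> (\<Sum>i\<in>I. Re (G ! i \<bullet>c G ! i)) \<le> sum y K"
    by (rule iffD1[THEN conjunct1, rotated])
  then obtain K where K: "K \<subseteq> {..<d}" "card K \<le> card I" "N \<le> sum y K"
    using I unfolding N_def by blast
  have fK: "finite K" using K finite_subset by blast
  have "\<exists>e>0. good e"
  proof (rule ccontr)
    assume no: "\<not> ?thesis"
    have opt: "sum y K' \<le> N" if "K' \<subseteq> {..<d}" "card K' \<le> card I" for K'
      using good1[OF that] no by force
    have lK: "l \<in> K'" and mK: "m \<notin> K'" if "K' \<subseteq> {..<d}" "card K' \<le> card I" "N \<le> sum y K'" for K'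
      using good2[OF that] no by auto
    have NK: "sum y K = N" using opt[OF K(1,2)] K(3) by simp
    have off: "y q < y l" if "q < d" "q \<notin> K" for q
    proof (rule ccontr)
      assume "\<not> ?thesis"
      then show False
        using lK[of "insert q (K - {l})"] swap[OF K(1) lK[OF K] that(2,1)] K(2) NK that lK[OF K] by auto
    qed
    have on: "y m < y p" if "p \<in> K" for p
    proof (rule ccontr)
      assume "\<not> ?thesis"
      then show False
        using mK[of "insert m (K - {p})"] swap[OF K(1) that mK[OF K] lm(2)] K(2) NK by auto
    qed
    have cross: "y q \<le> y p" if "p \<in> K" "q < d" "q \<notin> K" for p q
      using opt[of "insert q (K - {p})"] swap[OF K(1) that(1,3,2)] K(2) NK by simp
    have cKI: "card K = card I"
    proof (rule ccontr)
      assume "card K \<noteq> card I"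
      then have "card (insert m K) \<le> card I" using K(2) fK by (simp add: card_insert_if)
      then show False using mK[of "insert m K"] K NK lm y0[OF lm(2)] mK[OF K] fK by simp
    qed
    obtain p where p: "\<And>i. i < d \<Longrightarrow> 0 \<le> p i \<and> p i \<le> 1 \<and> p i * y i = (\<Sum>k\<in>I. (cmod (G ! k \<bullet>c u i))\<^sup>2)"
      "(\<Sum>i<d. p i) \<le> real (card I)" "N = (\<Sum>i<d. p i * y i)"
      using frame_norm_weights[OF G u S I] unfolding N_def by blast
    have tight: "(1 - p l) * (y l - s) = 0" "p m * (s - y m) = 0"
      if s: "0 \<le> s" "\<And>p. p \<in> K \<Longrightarrow> s \<le> y p" "\<And>q. q < d \<Longrightarrow> q \<notin> K \<Longrightarrow> y q \<le> s" for s
    proof -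
      have "(\<Sum>i<d. p i * y i) + (\<Sum>i\<in>K. (1 - p i) * (y i - s)) + (\<Sum>i\<in>{..<d} - K. p i * (s - y i)) \<le> sum y K"
        by (rule weighted_sum_gap) (use K(1) p(2) cKI s(1) in \<open>auto intro: mult_left_mono\<close>)
      then have le: "(\<Sum>i\<in>K. (1 - p i) * (y i - s)) + (\<Sum>i\<in>{..<d} - K. p i * (s - y i)) \<le> 0"
        using NK p(3) by simp
      have 1: "0 \<le> (1 - p i) * (y i - s)" if "i \<in> K" for i using p(1)[of i] s(2)[OF that] K(1) that by auto
      have 2: "0 \<le> p i * (s - y i)" if "i \<in> {..<d} - K" for i using p(1)[of i] s(3)[of i] that by auto
      have "0 \<le> (\<Sum>i\<in>K. (1 - p i) * (y i - s))" "0 \<le> (\<Sum>i\<in>{..<d} - K. p i * (s - y i))"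
        using 1 2 by (auto intro: sum_nonneg)
      with le have z: "(\<Sum>i\<in>K. (1 - p i) * (y i - s)) = 0" "(\<Sum>i\<in>{..<d} - K. p i * (s - y i)) = 0" by linarith+
      show "(1 - p l) * (y l - s) = 0"
        using z(1) sum_nonneg_eq_0_iff[OF fK, of "\<lambda>i. (1 - p i) * (y i - s)"] 1 lK[OF K] by auto
      show "p m * (s - y m) = 0"
        using z(2) sum_nonneg_eq_0_iff[of "{..<d} - K" "\<lambda>i. p i * (s - y i)"] 2 mK[OF K] lm(2) by auto
    qed
    have fin: "finite (y ` ({..<d} - K))" "y ` ({..<d} - K) \<noteq> {}" "finite (y ` K)" "y ` K \<noteq> {}"
      using mK[OF K] lK[OF K] lm fK by auto
    have "p l = 1"
    proof -
      define s where "s = Max (y ` ({..<d} - K))"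
      have s1: "y q \<le> s" if "q < d" "q \<notin> K" for q unfolding s_def using fin(1) that by (intro Max_ge) auto
      have s2: "s < y l" unfolding s_def using fin(1,2) off by (subst Max_less_iff) auto
      have s3: "s \<le> y p" if "p \<in> K" for p unfolding s_def using fin(1,2) cross that by (subst Max_le_iff) auto
      have "0 \<le> s" using s1[of m] y0[OF lm(2)] lm(2) mK[OF K] by simp
      from tight(1)[OF this s3 s1] s2 show ?thesis by simp
    qed
    moreover have "p m = 0"
    proof -
      define s where "s = Min (y ` K)"
      have s1: "s \<le> y p" if "p \<in> K" for p unfolding s_def using fin(3) that by (intro Min_le) auto
      have s2: "y m < s" unfolding s_def using fin(3,4) on by (subst Min_gr_iff) auto
      have s3: "y q \<le> s" if "q < d" "q \<notin> K" for q unfolding s_def using fin(3,4) cross that by (subst Min_ge_iff) auto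
      have "0 \<le> s" using s2 y0[OF lm(2)] by simp
      from tight(2)[OF this s1 s3] s2 show ?thesis by simp
    qed
    ultimately have pl: "y l = (\<Sum>k\<in>I. (cmod (G ! k \<bullet>c u l))\<^sup>2)" and pm: "(\<Sum>k\<in>I. (cmod (G ! k \<bullet>c u m))\<^sup>2) = 0"
      using p(1)[OF lm(1)] p(1)[OF lm(2)] by auto
    have fI: "finite I" using I finite_subset by blast
    have "j \<notin> I" using pm j(3) fI by (auto simp: sum_nonneg_eq_0_iff)
    then have "y l + (cmod (G ! j \<bullet>c u l))\<^sup>2 = (\<Sum>k\<in>insert j I. (cmod (G ! k \<bullet>c u l))\<^sup>2)"
      using pl fI by simp
    also have "\<dots> \<le> (\<Sum>k<length G. (cmod (G ! k \<bullet>c u l))\<^sup>2)" by (rule sum_mono2) (use I j in auto)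
    also have "\<dots> = y l" by (rule frame_op_eigenvalue_eq[OF G u S lm(1), symmetric])
    finally show False using j(2) by simp
  qed
  then show ?thesis unfolding good_def N_def y'_def .
qed

text \<open>
  There are finitely many subset constraints, so a common bound for the transfer exists.
\<close>

lemma transfer_spectrum:
  assumes G: "set G \<subseteq> carrier_vec d" and u: "onb d u" and S: "frame_op d G = spectral d u y"
    and lm: "l < d" "m < d" "l \<noteq> m" and j: "j < length G" "G ! j \<bullet>c u l \<noteq> 0" "G ! j \<bullet>c u m \<noteq> 0"
  shows "\<exists>e>0. \<forall>\<epsilon>. 0 < \<epsilon> \<longrightarrow> \<epsilon> \<le> e \<longrightarrow> \<epsilon> \<le> y l \<and>
     maj (length G) (\<lambda>i. Re (G ! i \<bullet>c G ! i)) d (y(l := y l - \<epsilon>, m := y m + \<epsilon>))"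
proof -
  let ?n = "\<lambda>i. Re (G ! i \<bullet>c G ! i)"
  let ?y = "\<lambda>\<epsilon>. y(l := y l - \<epsilon>, m := y m + \<epsilon>)"
  have y0: "0 \<le> y i" if "i < d" for i by (rule frame_op_eigenvalue_nonneg[OF G u S that])
  have n0: "0 \<le> ?n i" if "i < length G" for i
    using cip_self[of "G ! i" d] G that by (simp add: sum_nonneg subset_iff)
  have yl: "0 < y l"
  proof -
    have "0 < (cmod (G ! j \<bullet>c u l))\<^sup>2" using j by simp
    also have "\<dots> \<le> (\<Sum>k<length G. (cmod (G ! k \<bullet>c u l))\<^sup>2)" by (rule member_le_sum) (use j in auto)
    also have "\<dots> = y l" by (rule frame_op_eigenvalue_eq[OF G u S lm(1), symmetric])
    finally show ?thesis .
  qed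
  define room where "room I e \<longleftrightarrow> 0 < e \<and> (\<forall>\<epsilon>. 0 \<le> \<epsilon> \<longrightarrow> \<epsilon> \<le> e \<longrightarrow>
      (\<exists>K\<subseteq>{..<d}. card K \<le> card I \<and> sum ?n I \<le> sum (?y \<epsilon>) K))" for I e
  define E where "E I = (SOME e. room I e)" for I
  have room: "room I (E I)" if "I \<subseteq> {..<length G}" for I
    unfolding E_def by (rule someI_ex) (unfold room_def, rule transfer_subset[OF G u S lm j that])
  have E1: "0 < E I" if "I \<subseteq> {..<length G}" for I using room[OF that] by (simp add: room_def)
  define e where "e = Min (insert (y l) (E ` Pow {..<length G}))"
  have fin: "finite (insert (y l) (E ` Pow {..<length G}))" by simp
  have e: "0 < e" "e \<le> y l" and eE: "\<And>I. I \<subseteq> {..<length G} \<Longrightarrow> e \<le> E I"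
    unfolding e_def using E1 yl by (auto simp: Min_gr_iff intro!: Min_le)
  show ?thesis
  proof (intro exI[of _ e] conjI allI impI e(1))
    fix \<epsilon> assume \<epsilon>: "0 < \<epsilon>" "\<epsilon> \<le> e"
    then show "\<epsilon> \<le> y l" using e by simp
    have y'0: "0 \<le> ?y \<epsilon> i" if "i < d" for i using y0 that lm \<epsilon> e by auto
    have "(\<Sum>i<d. ?y \<epsilon> i) = (\<Sum>i<d. y i - (if i = l then \<epsilon> else 0) + (if i = m then \<epsilon> else 0))"
      by (rule sum.cong) (use lm in auto)
    also have "\<dots> = (\<Sum>i<d. y i)" using lm by (simp add: sum.distrib sum_subtractf)
    finally have tot: "(\<Sum>i<length G. ?n i) = (\<Sum>i<d. ?y \<epsilon> i)"
      using frame_norms_maj[OF G u S] by (simp add: maj_def)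
    show "maj (length G) ?n d (?y \<epsilon>)"
    proof (subst maj_iff_subset_sums[OF n0 y'0], assumption, assumption, intro conjI allI impI tot)
      fix I assume I: "I \<subseteq> {..<length G}"
      show "\<exists>K\<subseteq>{..<d}. card K \<le> card I \<and> sum ?n I \<le> sum (?y \<epsilon>) K"
        using room[OF I] \<epsilon> eE[OF I] unfolding room_def by (meson less_imp_le order_trans)
    qed
  qed
qed

section \<open>Completions\<close>

lemma decreasing_map_id: "nonincreasing d x \<Longrightarrow> decreasing (map x [0..<d]) = map x [0..<d]"
  using decreasing_map_sorting[of "\<lambda>i. i" d x] by (simp add: o_def bij_betw_def)

lemma increasing_map_id: "nonincreasing d (\<lambda>l. - y l) \<Longrightarrow> increasing (map y [0..<d]) = map y [0..<d]"
  unfolding increasing_def by (rule sorted_sort_id) (auto simp: sorted_iff_nth_mono nonincreasing_def)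

lemma frame_op_spectral_incr:
  assumes "set G \<subseteq> carrier_vec d"
  shows "\<exists>w y. onb d w \<and> frame_op d G = spectral d w y \<and> nonincreasing d (\<lambda>l. - y l) \<and> (\<forall>l\<ge>d. y l = 0)"
proof -
  obtain u x where u: "onb d u" "frame_op d G = spectral d u x" "nonincreasing d x"
    using frame_op_spectral[OF assms] by blast
  define \<pi> where "\<pi> i = d - 1 - i" for i
  have \<pi>: "bij_betw \<pi> {..<d} {..<d}" by (rule bij_betw_byWitness[of _ \<pi>]) (auto simp: \<pi>_def)
  define y where "y l = (if l < d then x (\<pi> l) else 0)" for l
  have "frame_op d G = spectral d (u \<circ> \<pi>) (x \<circ> \<pi>)" unfolding u(2) by (rule spectral_permute[OF \<pi>, symmetric])
  also have "\<dots> = spectral d (u \<circ> \<pi>) y" by (rule spectral_cong) (simp add: y_def)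
  finally have "frame_op d G = spectral d (u \<circ> \<pi>) y" .
  moreover have "nonincreasing d (\<lambda>l. - y l)" using u(3) by (auto simp: nonincreasing_def y_def \<pi>_def)
  moreover have "\<forall>l\<ge>d. y l = 0" by (simp add: y_def)
  ultimately show ?thesis using onb_permute[OF \<pi> u(1)] by blast
qed

lemma completions_iff:
  "H @ G \<in> completions d a H \<longleftrightarrow> set G \<subseteq> carrier_vec d \<and> length G = length a \<and>
     (\<forall>i<length a. G ! i \<bullet>c G ! i = complex_of_real (a ! i))"
  by (auto simp: completions_def)

lemma op_completions_iff:
  "H @ G \<in> op_completions d a H \<longleftrightarrow> H @ G \<in> completions d a H \<and>
     eigenvalue_list (frame_op d (H @ G)) =
       decreasing (map2 (+) (eigenvalue_list (frame_op d H)) (eigenvalue_list_incr (frame_op d G)))"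
  by (auto simp: op_completions_def)

lemma completion_norms_maj:
  assumes G: "H @ G \<in> completions d a H" and w: "onb d w" and S: "frame_op d G = spectral d w y"
  shows "maj (length a) ((!) a) d y"
proof -
  have *: "set G \<subseteq> carrier_vec d" "length G = length a" "\<And>i. i < length a \<Longrightarrow> Re (G ! i \<bullet>c G ! i) = a ! i"
    using G by (auto simp: completions_iff)
  show ?thesis
    using frame_norms_maj[OF *(1) w S] maj_cong[of "length a" "\<lambda>i. Re (G ! i \<bullet>c G ! i)" "(!) a" d y y] *(2,3) by simp
qed

text \<open>
  All that a single completion reveals: its potential is at least the value determined by its
  spectrum, and equality characterizes \<open>op_completions\<close> and yields a common eigenbasis.
\<close>

lemma completion_bounds:
  assumes H: "set H \<subseteq> carrier_vec d" and u: "onb d u" and SH: "frame_op d H = spectral d u x" and x: "nonincreasing d x"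
    and G: "H @ G \<in> completions d a H" and f: "strictly_convex_on {0..} f"
  shows "\<exists>y\<in>spectra (length a) ((!) a) d. eigenvalue_list_incr (frame_op d G) = map y [0..<d] \<and>
     (\<Sum>l<d. f (x l + y l)) \<le> convex_potential d f (H @ G) \<and>
     (H @ G \<in> op_completions d a H \<longleftrightarrow> convex_potential d f (H @ G) \<le> (\<Sum>l<d. f (x l + y l))) \<and>
     (convex_potential d f (H @ G) \<le> (\<Sum>l<d. f (x l + y l)) \<longrightarrow>
        (\<exists>v x' y'. onb d v \<and> frame_op d H = spectral d v x' \<and> frame_op d G = spectral d v y'))"
proof -
  have cG: "set G \<subseteq> carrier_vec d" using G by (simp add: completions_iff)
  then have cF: "set (H @ G) \<subseteq> carrier_vec d" using H by simp
  obtain w y where w: "onb d w" and SG: "frame_op d G = spectral d w y" and y: "nonincreasing d (\<lambda>l. - y l)"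
    and yout: "\<And>l. d \<le> l \<Longrightarrow> y l = 0"
    using frame_op_spectral_incr[OF cG] by blast
  obtain t z where t: "onb d t" and SF: "frame_op d (H @ G) = spectral d t z" and z: "nonincreasing d z"
    using frame_op_spectral[OF cF] by blast
  have sum: "spectral d t z = spectral d u x + spectral d w y"
    using frame_op_append[OF H cG] SF SH SG by simp
  have nn: "0 \<le> x l" "0 \<le> y l" "0 \<le> z l" if "l < d" for l
    using frame_op_eigenvalue_nonneg[OF H u SH that] frame_op_eigenvalue_nonneg[OF cG w SG that]
      frame_op_eigenvalue_nonneg[OF cF t SF that] by auto
  let ?P = "convex_potential d f (H @ G)" and ?J = "\<Sum>l<d. f (x l + y l)"
  have P: "?P = (\<Sum>l<d. f (z l))" by (rule convex_potential_spectral[OF t SF])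
  have "y \<in> spectra (length a) ((!) a) d"
    using nn yout y completion_norms_maj[OF G w SG] by (auto simp: spectra_def nonincreasing_def)
  moreover have "eigenvalue_list_incr (frame_op d G) = map y [0..<d]"
    unfolding SG eigenvalue_list_incr_spectral[OF w] by (rule increasing_map_id[OF y])
  moreover have "?J \<le> ?P" unfolding P by (rule lidskii_convex(1)[OF u w t x y z sum nn f])
  moreover have eq: "z l = rearr d (\<lambda>l. x l + y l) l" if "?P \<le> ?J" "l < d" for l
    by (rule lidskii_convex(2)[OF u w t x y z sum nn f that(1)[unfolded P] that(2)])
  moreover have "H @ G \<in> op_completions d a H \<longleftrightarrow> (\<forall>l<d. z l = rearr d (\<lambda>l. x l + y l) l)"
  proof -
    have m2: "map2 (+) (map x [0..<d]) (map y [0..<d]) = map (\<lambda>l. x l + y l) [0..<d]"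
      by (rule nth_equalityI) auto
    have "eigenvalue_list (frame_op d (H @ G)) = map z [0..<d]"
      unfolding SF eigenvalue_list_spectral[OF t] by (rule decreasing_map_id[OF z])
    moreover have "eigenvalue_list (frame_op d H) = map x [0..<d]"
      unfolding SH eigenvalue_list_spectral[OF u] by (rule decreasing_map_id[OF x])
    moreover have "eigenvalue_list_incr (frame_op d G) = map y [0..<d]"
      unfolding SG eigenvalue_list_incr_spectral[OF w] by (rule increasing_map_id[OF y])
    ultimately have "H @ G \<in> op_completions d a H \<longleftrightarrow> map z [0..<d] = map (rearr d (\<lambda>l. x l + y l)) [0..<d]"
      unfolding op_completions_iff using G by (simp only: m2 decreasing_map_eq_rearr simp_thms)
    then show ?thesis by (simp add: list_eq_iff_nth_eq)
  qed
  moreover have "?P \<le> ?J" if "\<forall>l<d. z l = rearr d (\<lambda>l. x l + y l) l"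
  proof -
    have "?P = (\<Sum>l<d. f (rearr d (\<lambda>l. x l + y l) l))" unfolding P by (rule sum.cong) (use that in auto)
    also have "\<dots> = ?J" by (rule sum_rearr)
    finally show ?thesis by simp
  qed
  moreover have "\<exists>v x' y'. onb d v \<and> frame_op d H = spectral d v x' \<and> frame_op d G = spectral d v y'" if le: "?P \<le> ?J"
  proof -
    have tr: "(\<Sum>i<d. x i * Re ((spectral d w y *\<^sub>v u i) \<bullet>c u i)) = (\<Sum>i<d. x i * y i)"
      by (rule trace_equality[OF u w t sum eq[OF le]])
    have "(spectral d w y *\<^sub>v u i) \<bullet>c u j = 0" if ij: "i < d" "j < d" "x i \<noteq> x j" for i j
    proof (cases "i < j")
      case True
      then show ?thesis by (rule trace_equality_block[OF u w x y tr _ ij(2,3)])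
    next
      case False
      then have "j < i" using ij by (cases "i = j") auto
      then have "(spectral d w y *\<^sub>v u j) \<bullet>c u i = 0"
        by (rule trace_equality_block[OF u w x y tr _ ij(1) ij(3)[symmetric]])
      then show ?thesis
        using hermitian_opD[OF hermitian_spectral[OF w] onb_carrier[OF u ij(1)] onb_carrier[OF u ij(2)], of y]
          cip_commute[OF onb_carrier[OF u ij(1)] mult_mat_vec_carrier[OF spectral_carrier onb_carrier[OF u ij(2)]], of w y]
        by simp
    qed
    then show ?thesis using joint_basis[OF u w, of x y] unfolding SH SG by blast
  qed
  ultimately show ?thesis by blast
qed

lemma completion_with_spectrum:
  assumes u: "onb d u" and y: "\<And>l. l < d \<Longrightarrow> 0 \<le> y l" and a: "\<forall>\<alpha>\<in>set a. 0 < \<alpha>" and maj: "maj (length a) ((!) a) d y"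
  shows "\<exists>G. H @ G \<in> completions d a H \<and> frame_op d G = spectral d u y"
proof -
  have a0: "0 \<le> a ! i" if "i < length a" for i using a that by (simp add: less_imp_le)
  show ?thesis using frame_with_norms[OF u y a0 maj] by (auto simp: completions_iff)
qed

lemma potential_completion_joint:
  assumes "set H \<subseteq> carrier_vec d" "H @ G \<in> completions d a H" "onb d u"
    "frame_op d H = spectral d u x" "frame_op d G = spectral d u y"
  shows "frame_op d (H @ G) = spectral d u (\<lambda>l. x l + y l)"
    and "convex_potential d f (H @ G) = (\<Sum>l<d. f (x l + y l))"
proof -
  show 1: "frame_op d (H @ G) = spectral d u (\<lambda>l. x l + y l)"
    using frame_op_append[of H d G] assms by (simp add: completions_iff spectral_add)
  show "convex_potential d f (H @ G) = (\<Sum>l<d. f (x l + y l))"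
    by (rule convex_potential_spectral[OF assms(3) 1])
qed

lemma minimizers_of_completions:
  assumes ini: "initial_data d H a" and f: "strictly_convex_on {0..} f"
    and \<mu>: "\<mu> \<in> spectra (length a) ((!) a) d"
    and u: "onb d u" and SH: "frame_op d H = spectral d u x" and x: "nonincreasing d x"
    and opt: "\<forall>\<nu>\<in>spectra (length a) ((!) a) d. (\<Sum>i<d. f (x i + \<mu> i)) \<le> (\<Sum>i<d. f (x i + \<nu> i)) \<and>
      ((\<Sum>i<d. f (x i + \<nu> i)) \<le> (\<Sum>i<d. f (x i + \<mu> i)) \<longrightarrow> \<nu> = \<mu>)"
    and G: "H @ G \<in> completions d a H"
  shows "is_arg_min (convex_potential d f) (\<lambda>F. F \<in> completions d a H) (H @ G) \<longleftrightarrow>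
      convex_potential d f (H @ G) \<le> (\<Sum>i<d. f (x i + \<mu> i))"
    and "convex_potential d f (H @ G) \<le> (\<Sum>i<d. f (x i + \<mu> i)) \<longleftrightarrow>
      H @ G \<in> op_completions d a H \<and> eigenvalue_list_incr (frame_op d G) = map \<mu> [0..<d]"
    and "\<exists>G. H @ G \<in> op_completions d a H \<and> convex_potential d f (H @ G) = (\<Sum>i<d. f (x i + \<mu> i))"
proof -
  let ?J = "\<Sum>i<d. f (x i + \<mu> i)"
  have cH: "set H \<subseteq> carrier_vec d" and a: "\<forall>\<alpha>\<in>set a. 0 < \<alpha>" using ini by (auto simp: initial_data_def)
  note bounds = completion_bounds[OF cH u SH x _ f]
  have lower: "?J \<le> convex_potential d f F" if F: "F \<in> completions d a H" for F
  proof -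
    obtain G' where G': "F = H @ G'" using F by (auto simp: completions_def)
    then show ?thesis using bounds[of G' a] F opt by fastforce
  qed
  have iff: "convex_potential d f (H @ G) \<le> ?J \<longleftrightarrow>
      H @ G \<in> op_completions d a H \<and> eigenvalue_list_incr (frame_op d G) = map \<mu> [0..<d]"
    if G: "H @ G \<in> completions d a H" for G
  proof -
    obtain y where y: "y \<in> spectra (length a) ((!) a) d" "eigenvalue_list_incr (frame_op d G) = map y [0..<d]"
      "(\<Sum>l<d. f (x l + y l)) \<le> convex_potential d f (H @ G)"
      "H @ G \<in> op_completions d a H \<longleftrightarrow> convex_potential d f (H @ G) \<le> (\<Sum>l<d. f (x l + y l))"
      using bounds[OF G] by blast
    show ?thesis
    proof
      assume le: "convex_potential d f (H @ G) \<le> ?J"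
      then have "y = \<mu>" using opt y(1,3) by (meson order_trans)
      then show "H @ G \<in> op_completions d a H \<and> eigenvalue_list_incr (frame_op d G) = map \<mu> [0..<d]"
        using y le by simp
    next
      assume op: "H @ G \<in> op_completions d a H \<and> eigenvalue_list_incr (frame_op d G) = map \<mu> [0..<d]"
      then have "y l = \<mu> l" for l using y(1,2) \<mu> by (cases "l < d") (auto simp: spectra_def)
      then have "y = \<mu>" by blast
      then show "convex_potential d f (H @ G) \<le> ?J" using op y(4) by simp
    qed
  qed
  have "maj (length a) ((!) a) d \<mu>" "\<And>l. l < d \<Longrightarrow> 0 \<le> \<mu> l" using \<mu> by (auto simp: spectra_def)
  then obtain G' where G': "H @ G' \<in> completions d a H" "frame_op d G' = spectral d u \<mu>"
    using completion_with_spectrum[OF u _ a] by blast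
  have P': "convex_potential d f (H @ G') = ?J" by (rule potential_completion_joint(2)[OF cH G'(1) u SH G'(2)])
  show "is_arg_min (convex_potential d f) (\<lambda>F. F \<in> completions d a H) (H @ G) \<longleftrightarrow> convex_potential d f (H @ G) \<le> ?J"
  proof
    assume "is_arg_min (convex_potential d f) (\<lambda>F. F \<in> completions d a H) (H @ G)"
    then have "\<not> convex_potential d f (H @ G') < convex_potential d f (H @ G)"
      using G'(1) unfolding is_arg_min_def by blast
    then show "convex_potential d f (H @ G) \<le> ?J" using P' by simp
  next
    assume "convex_potential d f (H @ G) \<le> ?J"
    then have "\<not> convex_potential d f F < convex_potential d f (H @ G)" if "F \<in> completions d a H" for F
      using lower[OF that] by simp
    then show "is_arg_min (convex_potential d f) (\<lambda>F. F \<in> completions d a H) (H @ G)"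
      using G unfolding is_arg_min_def by blast
  qed
  show "convex_potential d f (H @ G) \<le> ?J \<longleftrightarrow>
      H @ G \<in> op_completions d a H \<and> eigenvalue_list_incr (frame_op d G) = map \<mu> [0..<d]"
    by (rule iff[OF G])
  show "\<exists>G. H @ G \<in> op_completions d a H \<and> convex_potential d f (H @ G) = ?J"
    using iff[OF G'(1)] P' by auto
qed

section \<open>Structure of the minimizers\<close>

text \<open>
  Moving spectrum from \<open>v l\<close> to \<open>v m\<close> would otherwise give a completion, diagonal in the same basis,
  with a smaller potential.
\<close>

lemma minimizer_components:
  assumes H: "set H \<subseteq> carrier_vec d" and a: "\<forall>\<alpha>\<in>set a. 0 < \<alpha>" and G: "H @ G \<in> completions d a H"
    and f: "strictly_convex_on {0..} f"
    and min: "\<And>F. F \<in> completions d a H \<Longrightarrow> convex_potential d f (H @ G) \<le> convex_potential d f F"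
    and v: "onb d v" and SH: "frame_op d H = spectral d v x" and SG: "frame_op d G = spectral d v y"
    and lm: "l < d" "m < d" and j: "j < length G" "G ! j \<bullet>c v l \<noteq> 0" "G ! j \<bullet>c v m \<noteq> 0"
  shows "x l + y l \<le> x m + y m"
proof (rule ccontr)
  assume "\<not> ?thesis"
  then have gt: "x m + y m < x l + y l" by simp
  then have lnm: "l \<noteq> m" by auto
  have cG: "set G \<subseteq> carrier_vec d" and len: "length G = length a"
    and norms: "\<And>i. i < length a \<Longrightarrow> Re (G ! i \<bullet>c G ! i) = a ! i" using G by (auto simp: completions_iff)
  have x0: "0 \<le> x i" if "i < d" for i by (rule frame_op_eigenvalue_nonneg[OF H v SH that])
  have y0: "0 \<le> y i" if "i < d" for i by (rule frame_op_eigenvalue_nonneg[OF cG v SG that])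
  obtain e where e: "0 < e" "\<And>\<epsilon>. 0 < \<epsilon> \<Longrightarrow> \<epsilon> \<le> e \<Longrightarrow> \<epsilon> \<le> y l \<and>
     maj (length G) (\<lambda>i. Re (G ! i \<bullet>c G ! i)) d (y(l := y l - \<epsilon>, m := y m + \<epsilon>))"
    using transfer_spectrum[OF cG v SG lm lnm j] by blast
  define \<epsilon> where "\<epsilon> = min e ((x l + y l - (x m + y m)) / 2)"
  have \<epsilon>: "0 < \<epsilon>" "\<epsilon> \<le> e" "\<epsilon> < x l + y l - (x m + y m)" using e gt by (auto simp: \<epsilon>_def min_def)
  define y' where "y' = y(l := y l - \<epsilon>, m := y m + \<epsilon>)"
  have "maj (length a) ((!) a) d y'"
    using e(2)[OF \<epsilon>(1,2)] maj_cong[of "length a" "\<lambda>i. Re (G ! i \<bullet>c G ! i)" "(!) a" d y' y'] norms len by (simp add: y'_def)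
  moreover have "0 \<le> y' i" if "i < d" for i using y0[OF that] y0[OF lm(2)] e(2)[OF \<epsilon>(1,2)] \<epsilon>(1) by (auto simp: y'_def)
  ultimately obtain G' where G': "H @ G' \<in> completions d a H" "frame_op d G' = spectral d v y'"
    using completion_with_spectrum[OF v _ a] by blast
  have "(\<Sum>i<d. f (x i + y i)) \<le> (\<Sum>i<d. f (x i + y' i))"
    using min[OF G'(1)] potential_completion_joint(2)[OF H G v SH SG]
      potential_completion_joint(2)[OF H G'(1) v SH G'(2)] by simp
  moreover have "(\<Sum>i<d. h i) = h l + (h m + (\<Sum>i\<in>{..<d} - {l} - {m}. h i))" for h :: "nat \<Rightarrow> real"
    using lm lnm by (subst sum.remove[of _ l]) (auto intro!: sum.remove)
  moreover have "(\<Sum>i\<in>{..<d} - {l} - {m}. f (x i + y' i)) = (\<Sum>i\<in>{..<d} - {l} - {m}. f (x i + y i))"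
    by (rule sum.cong) (auto simp: y'_def)
  ultimately have "f (x l + y l) + f (x m + y m) \<le> f (x l + y l - \<epsilon>) + f (x m + y m + \<epsilon>)"
    using lnm by (simp add: y'_def add.assoc add_diff_eq)
  then show False
    using strictly_convex_transfer[OF f, of "x m + y m" \<epsilon> "x l + y l"] x0 y0 lm \<epsilon> by simp
qed

lemma minimizer_eigenvectors:
  assumes H: "set H \<subseteq> carrier_vec d" and a: "\<forall>\<alpha>\<in>set a. 0 < \<alpha>" and G: "H @ G \<in> completions d a H"
    and f: "strictly_convex_on {0..} f"
    and min: "\<And>F. F \<in> completions d a H \<Longrightarrow> convex_potential d f (H @ G) \<le> convex_potential d f F"
    and v: "onb d v" and SH: "frame_op d H = spectral d v x" and SG: "frame_op d G = spectral d v y"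
    and g: "g \<in> set G"
  shows "\<exists>c. frame_op d (H @ G) *\<^sub>v g = complex_of_real c \<cdot>\<^sub>v g"
proof -
  obtain j where j: "j < length G" "g = G ! j" using g by (auto simp: in_set_conv_nth)
  have gc: "g \<in> carrier_vec d" using G g by (auto simp: completions_iff)
  have SF: "frame_op d (H @ G) = spectral d v (\<lambda>l. x l + y l)"
    by (rule potential_completion_joint(1)[OF H G v SH SG])
  have eq: "x l + y l = x m + y m" if "l < d" "m < d" "g \<bullet>c v l \<noteq> 0" "g \<bullet>c v m \<noteq> 0" for l m
    using minimizer_components[OF H a G f min v SH SG that(1,2) j(1)]
      minimizer_components[OF H a G f min v SH SG that(2,1) j(1)] that(3,4) j(2) by simp
  obtain c where c: "\<And>l. l < d \<Longrightarrow> g \<bullet>c v l \<noteq> 0 \<Longrightarrow> x l + y l = c"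
  proof (cases "\<exists>m<d. g \<bullet>c v m \<noteq> 0")
    case True
    then obtain m where "m < d" "g \<bullet>c v m \<noteq> 0" by blast
    then show ?thesis using eq that by blast
  qed (use that in blast)
  have "frame_op d (H @ G) *\<^sub>v g = complex_of_real c \<cdot>\<^sub>v g"
    unfolding SF
  proof (rule onb_vec_eqI[OF v mult_mat_vec_carrier[OF spectral_carrier gc]])
    fix l assume l: "l < d"
    show "(spectral d v (\<lambda>l. x l + y l) *\<^sub>v g) \<bullet>c v l = (complex_of_real c \<cdot>\<^sub>v g) \<bullet>c v l"
      unfolding spectral_coeff[OF v gc l] cip_smult_left[OF gc onb_carrier[OF v l]]
      using c[OF l] by (cases "g \<bullet>c v l = 0") auto
  qed (use gc in simp)
  then show ?thesis by blast
qed

text \<open>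
  Eigenvectors of a Hermitian operator with distinct eigenvalues are orthogonal, so the vectors
  sharing the eigenvalue of the first one form an orthogonal part of the sequence.
\<close>

lemma irreducible_common_eigenvalue:
  assumes S: "hermitian_op d S" and H: "set H \<subseteq> carrier_vec d" and irr: "irreducible_seq H"
    and eig: "\<And>h. h \<in> set H \<Longrightarrow> \<exists>c. S *\<^sub>v h = complex_of_real c \<cdot>\<^sub>v h"
  shows "\<exists>c. \<forall>h\<in>set H. S *\<^sub>v h = complex_of_real c \<cdot>\<^sub>v h"
proof (cases "H = []")
  case False
  then obtain c where c: "S *\<^sub>v (H ! 0) = complex_of_real c \<cdot>\<^sub>v (H ! 0)" using eig[of "H ! 0"] by auto
  define A where "A = {i. i < length H \<and> S *\<^sub>v (H ! i) = complex_of_real c \<cdot>\<^sub>v (H ! i)}"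
  define B where "B = {..<length H} - A"
  have "H ! i \<bullet>c H ! j = 0" if i: "i \<in> A" and j: "j \<in> B" for i j
  proof -
    have ci: "H ! i \<in> carrier_vec d" and cj: "H ! j \<in> carrier_vec d" using i j H by (auto simp: A_def B_def)
    obtain c' where c': "S *\<^sub>v (H ! j) = complex_of_real c' \<cdot>\<^sub>v (H ! j)"
      using eig[of "H ! j"] j by (auto simp: B_def)
    have "c' \<noteq> c" using c' j by (auto simp: A_def B_def)
    moreover have "complex_of_real c * (H ! i \<bullet>c H ! j) = complex_of_real c' * (H ! i \<bullet>c H ! j)"
      using hermitian_opD[OF S ci cj] i c'
      by (simp add: A_def cip_smult_left[OF ci cj] cip_smult_right[OF ci cj] del: mult_cancel_right)
    ultimately show ?thesis by (metis mult_cancel_right of_real_eq_iff)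
  qed
  moreover have "0 \<in> A" using c False by (simp add: A_def)
  moreover have "A \<union> B = {..<length H}" "A \<inter> B = {}" by (auto simp: A_def B_def)
  ultimately have "B = {}" using irr unfolding irreducible_seq_def by blast
  then have "\<forall>h\<in>set H. S *\<^sub>v h = complex_of_real c \<cdot>\<^sub>v h"
    by (auto simp: A_def B_def in_set_conv_nth)
  then show ?thesis by blast
qed simp

lemma frame_eigenvalue_pos:
  assumes F: "set F \<subseteq> carrier_vec d" and h: "h \<in> set F" "h \<noteq> 0\<^sub>v d"
    and c: "frame_op d F *\<^sub>v h = complex_of_real c \<cdot>\<^sub>v h"
  shows "0 < c"
proof -
  have hc: "h \<in> carrier_vec d" using F h by auto
  obtain j where j: "j < length F" "F ! j = h" using h by (auto simp: in_set_conv_nth)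
  have pos: "0 < Re (h \<bullet>c h)" by (rule cip_self_pos[OF hc h(2)])
  then have "0 < (cmod (h \<bullet>c F ! j))\<^sup>2" using j by auto
  also have "\<dots> \<le> (\<Sum>i<length F. (cmod (h \<bullet>c F ! i))\<^sup>2)" by (rule member_le_sum) (use j in auto)
  also have "\<dots> = Re ((frame_op d F *\<^sub>v h) \<bullet>c h)"
    unfolding frame_op_form[OF F hc hc] by (simp add: complex_mult_cnj cmod_power2)
  also have "\<dots> = c * Re (h \<bullet>c h)" unfolding c cip_smult_left[OF hc hc] by simp
  finally show ?thesis using pos by (simp add: zero_less_mult_iff)
qed

text \<open>
  With \<open>T\<close> the frame operator of \<open>H\<close>, both products are \<open>c T - T\<^sup>2\<close>, since \<open>S\<close> acts as \<open>c - T\<close> on the vectors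
  of \<open>H\<close>.
\<close>

lemma commute_of_eigenvectors:
  assumes S: "hermitian_op d S" and H: "set H \<subseteq> carrier_vec d" and u: "onb d u"
    and eig: "\<And>h. h \<in> set H \<Longrightarrow> S *\<^sub>v h + frame_op d H *\<^sub>v h = complex_of_real c \<cdot>\<^sub>v h"
  shows "frame_op d H * S = S * frame_op d H"
proof -
  let ?T = "frame_op d H"
  have T: "hermitian_op d ?T" by (rule frame_op_hermitian[OF H])
  note cS = hermitian_op_carrier[OF S] and cT = hermitian_op_carrier[OF T]
  have Sv: "S *\<^sub>v v \<in> carrier_vec d" and Tv: "?T *\<^sub>v v \<in> carrier_vec d" if "v \<in> carrier_vec d" for v
    using mult_mat_vec_carrier[OF cS that] mult_mat_vec_carrier[OF cT that] by auto
  have coeff: "(S *\<^sub>v v) \<bullet>c h = complex_of_real c * (v \<bullet>c h) - (?T *\<^sub>v v) \<bullet>c h"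
    if v: "v \<in> carrier_vec d" and h: "h \<in> set H" for v h
  proof -
    have hc: "h \<in> carrier_vec d" using h H by auto
    have "(S *\<^sub>v h + ?T *\<^sub>v h) \<bullet>c v = complex_of_real c * (h \<bullet>c v)"
      unfolding eig[OF h] by (rule cip_smult_left[OF hc v])
    then have "(S *\<^sub>v h) \<bullet>c v + (?T *\<^sub>v h) \<bullet>c v = complex_of_real c * (h \<bullet>c v)"
      unfolding cip_add_left[OF Sv[OF hc] Tv[OF hc] v] .
    then have "cnj ((S *\<^sub>v h) \<bullet>c v) + cnj ((?T *\<^sub>v h) \<bullet>c v) = complex_of_real c * cnj (h \<bullet>c v)"
      by (metis complex_cnj_add complex_cnj_complex_of_real complex_cnj_mult)
    then show ?thesis
      unfolding hermitian_opD[OF S v hc] hermitian_opD[OF T v hc]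
        cip_commute[OF v Sv[OF hc]] cip_commute[OF v Tv[OF hc]] cip_commute[OF v hc] by (simp add: algebra_simps)
  qed
  show ?thesis
  proof (rule mat_eqI_form[OF u])
    fix v w :: "complex vec" assume v: "v \<in> carrier_vec d" and w: "w \<in> carrier_vec d"
    have "((?T * S) *\<^sub>v v) \<bullet>c w = (?T *\<^sub>v (S *\<^sub>v v)) \<bullet>c w"
      unfolding assoc_mult_mat_vec[OF cT cS v] ..
    also have "\<dots> = (\<Sum>i<length H. ((S *\<^sub>v v) \<bullet>c H ! i) * cnj (w \<bullet>c H ! i))"
      by (rule frame_op_form[OF H Sv[OF v] w])
    also have "\<dots> = (\<Sum>i<length H. complex_of_real c * ((v \<bullet>c H ! i) * cnj (w \<bullet>c H ! i)) -
        ((?T *\<^sub>v v) \<bullet>c H ! i) * cnj (w \<bullet>c H ! i))"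
      by (rule sum.cong) (simp_all add: coeff[OF v] left_diff_distrib mult.assoc)
    also have "\<dots> = complex_of_real c * ((?T *\<^sub>v v) \<bullet>c w) - (?T *\<^sub>v (?T *\<^sub>v v)) \<bullet>c w"
      unfolding frame_op_form[OF H v w] frame_op_form[OF H Tv[OF v] w] by (simp add: sum_subtractf sum_distrib_left)
    also have "(?T *\<^sub>v (?T *\<^sub>v v)) \<bullet>c w = (?T *\<^sub>v v) \<bullet>c (?T *\<^sub>v w)" by (rule hermitian_opD[OF T Tv[OF v] w])
    also have "\<dots> = (\<Sum>i<length H. (v \<bullet>c H ! i) * cnj ((?T *\<^sub>v w) \<bullet>c H ! i))"
      by (rule frame_op_form[OF H v Tv[OF w]])
    also have "complex_of_real c * ((?T *\<^sub>v v) \<bullet>c w) - (\<Sum>i<length H. (v \<bullet>c H ! i) * cnj ((?T *\<^sub>v w) \<bullet>c H ! i))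
        = (\<Sum>i<length H. (v \<bullet>c H ! i) * cnj ((S *\<^sub>v w) \<bullet>c H ! i))"
      unfolding frame_op_form[OF H v w] sum_distrib_left sum_subtractf[symmetric]
      by (rule sum.cong) (simp_all add: coeff[OF w] right_diff_distrib mult_ac)
    also have "\<dots> = (?T *\<^sub>v v) \<bullet>c (S *\<^sub>v w)" by (rule frame_op_form[OF H v Sv[OF w], symmetric])
    also have "\<dots> = (S *\<^sub>v (?T *\<^sub>v v)) \<bullet>c w" by (rule hermitian_opD[OF S Tv[OF v] w, symmetric])
    also have "\<dots> = ((S * ?T) *\<^sub>v v) \<bullet>c w" unfolding assoc_mult_mat_vec[OF cS cT v] ..
    finally show "((?T * S) *\<^sub>v v) \<bullet>c w = ((S * ?T) *\<^sub>v v) \<bullet>c w" .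
  qed (use cS cT in auto)
qed

lemma sum_nths:
  fixes \<phi> :: "'a \<Rightarrow> 'b :: comm_monoid_add"
  assumes "J \<subseteq> {..<length xs}"
  shows "(\<Sum>i<length (nths xs J). \<phi> (nths xs J ! i)) = (\<Sum>j\<in>J. \<phi> (xs ! j))"
proof -
  have "sum_list (map \<phi> (nths xs J)) = (\<Sum>j\<in>J \<inter> {..<length xs}. \<phi> (xs ! j))" for J
  proof (induction xs rule: rev_induct)
    case (snoc x xs)
    have "(\<Sum>j\<in>J \<inter> {..<length xs}. \<phi> ((xs @ [x]) ! j)) = (\<Sum>j\<in>J \<inter> {..<length xs}. \<phi> (xs ! j))"
      by (rule sum.cong) (auto simp: nth_append)
    moreover have "J \<inter> {..<Suc (length xs)} = (if length xs \<in> J then insert (length xs) (J \<inter> {..<length xs}) else J \<inter> {..<length xs})"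
      by (auto simp: less_Suc_eq)
    ultimately show ?case using snoc by (simp add: nths_append add.commute)
  qed simp
  from this[of J] show ?thesis
    using assms by (simp add: Int_absorb2 sum_list_sum_nth atLeast0LessThan)
qed

text \<open>
  The vectors of the other blocks are orthogonal to \<open>h\<close> and contribute nothing.
\<close>

lemma frame_op_block:
  assumes F: "set F \<subseteq> carrier_vec d" "F = H @ G" and P: "irreducible_partition d F {length H..<length F} P" and J: "J \<in> P"
    and h: "h \<in> set (nths F J)" and u: "onb d u"
  shows "frame_op d G *\<^sub>v h = frame_op d (nths F J) *\<^sub>v h"
proof -
  interpret vec_space "TYPE(complex)" d .
  have part: "partition_on {length H..<length F} P" using P by (simp add: irreducible_partition_def)
  have sub: "set (nths F K) \<subseteq> carrier_vec d" for K using F(1) set_nths_subset[of F K] by blast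
  have cG: "set G \<subseteq> carrier_vec d" using F by auto
  have Jsub: "J \<subseteq> {length H..<length F}" using part J by (auto simp: partition_on_def)
  have hc: "h \<in> carrier_vec d" using h sub by blast
  have orth: "h \<bullet>c F ! j = 0" if j: "j \<in> {length H..<length F}" "j \<notin> J" for j
  proof -
    have "j \<in> \<Union> P" using part j(1) by (simp add: partition_on_def)
    then obtain K where K: "K \<in> P" "j \<in> K" by blast
    have "F ! j \<in> set (nths F K)" using K j by (auto simp: set_nths)
    then have "F ! j \<in> span (set (nths F K))" using span_mem[OF sub] by blast
    moreover have "h \<in> span (set (nths F J))" using span_mem[OF sub h] .
    moreover have "J \<noteq> K" using K j by auto
    ultimately show ?thesis using P J K unfolding irreducible_partition_def by blast
  qed
  show ?thesis
  proof (rule onb_vec_eqI[OF u mult_mat_vec_carrier[OF frame_op_carrier[OF cG] hc] mult_mat_vec_carrier[OF frame_op_carrier[OF sub] hc]])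
    fix l assume l: "l < d"
    let ?\<phi> = "\<lambda>g. (h \<bullet>c g) * cnj (u l \<bullet>c g)"
    have "(frame_op d G *\<^sub>v h) \<bullet>c u l = (\<Sum>i<length G. ?\<phi> (G ! i))"
      by (rule frame_op_form[OF cG hc onb_carrier[OF u l]])
    also have "\<dots> = (\<Sum>j\<in>{length H..<length F}. ?\<phi> (F ! j))"
      by (rule sum.reindex_bij_witness[of _ "\<lambda>j. j - length H" "\<lambda>i. i + length H"]) (auto simp: F(2) nth_append)
    also have "\<dots> = (\<Sum>j\<in>J. ?\<phi> (F ! j))"
      by (rule sum.mono_neutral_right) (use Jsub orth in auto)
    also have "\<dots> = (\<Sum>i<length (nths F J). ?\<phi> (nths F J ! i))"
      by (rule sum_nths[symmetric]) (use Jsub in auto)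
    also have "\<dots> = (frame_op d (nths F J) *\<^sub>v h) \<bullet>c u l"
      by (rule frame_op_form[OF sub hc onb_carrier[OF u l], symmetric])
    finally show "(frame_op d G *\<^sub>v h) \<bullet>c u l = (frame_op d (nths F J) *\<^sub>v h) \<bullet>c u l" .
  qed
qed

theorem theorem5p1:
  fixes d :: nat and F\<^sub>0 :: "complex Matrix.vec list" and a :: "real list"
    and f :: "real \<Rightarrow> real"
  assumes "0 < d"
    and "initial_data d F\<^sub>0 a"
    and "\<forall>x\<ge>0. 0 \<le> f x"
    and "strictly_convex_on {0..} f"
  shows "(\<exists>\<mu>\<in>Gamma_maj d a.
           \<forall>H\<^sub>0. initial_data d H\<^sub>0 a \<and>
               eigenvalue_list (frame_op d H\<^sub>0) = eigenvalue_list (frame_op d F\<^sub>0) \<longrightarrow>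
             (\<forall>G. H\<^sub>0 @ G \<in> completions d a H\<^sub>0 \<longrightarrow>
               (is_arg_min (convex_potential d f) (\<lambda>F. F \<in> completions d a H\<^sub>0) (H\<^sub>0 @ G) \<longleftrightarrow>
                H\<^sub>0 @ G \<in> op_completions d a H\<^sub>0 \<and> eigenvalue_list_incr (frame_op d G) = \<mu>)))
       \<and> (\<forall>F G P. F = F\<^sub>0 @ G \<and>
             is_arg_min (convex_potential d f) (\<lambda>F. F \<in> op_completions d a F\<^sub>0) F \<and>
             irreducible_partition d F {length F\<^sub>0..<length F} P \<longrightarrow>
             (\<forall>J\<in>P.
               frame_op d (nths F J) * frame_op d F\<^sub>0 = frame_op d F\<^sub>0 * frame_op d (nths F J) \<and>
               (\<exists>c::real. 0 < c \<and>
                 (\<forall>j\<in>J. frame_op d F *\<^sub>v (F ! j) = complex_of_real c \<cdot>\<^sub>v (F ! j)))))"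
proof -
  let ?k = "length a" and ?K = "spectra (length a) ((!) a) d"
  note d = assms(1) and ini = assms(2) and f = assms(4)
  have cF0: "set F\<^sub>0 \<subseteq> carrier_vec d" and a: "\<forall>\<alpha>\<in>set a. 0 < \<alpha>" using ini by (auto simp: initial_data_def)
  obtain u x where u: "onb d u" and S0: "frame_op d F\<^sub>0 = spectral d u x" and x: "nonincreasing d x"
    using frame_op_spectral[OF cF0] by blast
  have x0: "0 \<le> x i" if "i < d" for i by (rule frame_op_eigenvalue_nonneg[OF cF0 u S0 that])
  have apos: "0 < a ! i" if "i < ?k" for i using a that by simp
  obtain \<mu> where \<mu>: "\<mu> \<in> ?K"
    and opt: "\<forall>\<nu>\<in>?K. (\<Sum>i<d. f (x i + \<mu> i)) \<le> (\<Sum>i<d. f (x i + \<nu> i)) \<and>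
      ((\<Sum>i<d. f (x i + \<nu> i)) \<le> (\<Sum>i<d. f (x i + \<mu> i)) \<longrightarrow> \<nu> = \<mu>)"
    using unique_minimizer[where a = "(!) a", OF f d x0 x apos initial_data_zero_eigenvalues[OF ini S0]] by blast
  note main = minimizers_of_completions[OF _ f \<mu> _ _ x opt]
  have "map \<mu> [0..<d] \<in> Gamma_maj d a"
  proof -
    have s: "\<And>i. i < d \<Longrightarrow> 0 \<le> \<mu> i" "maj ?k ((!) a) d \<mu>" "nonincreasing d (\<lambda>l. - \<mu> l)"
      using \<mu> by (auto simp: spectra_def nonincreasing_def)
    have "maj ?k ((!) a) d ((!) (map \<mu> [0..<d]))"
      using s(2) maj_cong[of ?k "(!) a" "(!) a" d "(!) (map \<mu> [0..<d])" \<mu>] by simp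
    then have "a \<prec>\<^sub>m map \<mu> [0..<d]"
      using majorized_iff_maj[of a "map \<mu> [0..<d]"] a s(1) by (auto simp: less_imp_le)
    then show ?thesis using s(1) increasing_map_id[OF s(3)] by (simp add: Gamma_maj_def)
  qed
  \<comment> \<open>\<open>\<mu>\<close> depends on \<open>F\<^sub>0\<close> only through \<open>x\<close>, hence serves all \<open>H\<close> with the same eigenvalues\<close>
  moreover have "is_arg_min (convex_potential d f) (\<lambda>F. F \<in> completions d a H) (H @ G) \<longleftrightarrow>
      H @ G \<in> op_completions d a H \<and> eigenvalue_list_incr (frame_op d G) = map \<mu> [0..<d]"
    if H: "initial_data d H a" "eigenvalue_list (frame_op d H) = eigenvalue_list (frame_op d F\<^sub>0)"
      and G: "H @ G \<in> completions d a H" for H G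
  proof -
    have cH: "set H \<subseteq> carrier_vec d" using H by (simp add: initial_data_def)
    obtain w y where w: "onb d w" "frame_op d H = spectral d w y" "nonincreasing d y"
      using frame_op_spectral[OF cH] by blast
    have "map y [0..<d] = map x [0..<d]"
      using H(2) unfolding w(2) S0 eigenvalue_list_spectral[OF w(1)] eigenvalue_list_spectral[OF u]
        decreasing_map_id[OF w(3)] decreasing_map_id[OF x] .
    then have "frame_op d H = spectral d w x" unfolding w(2) by (intro spectral_cong) auto
    from main(1)[OF H(1) w(1) this G] main(2)[OF H(1) w(1) this G] show ?thesis by simp
  qed
  moreover have "frame_op d (nths F J) * frame_op d F\<^sub>0 = frame_op d F\<^sub>0 * frame_op d (nths F J) \<and>
      (\<exists>c>0. \<forall>j\<in>J. frame_op d F *\<^sub>v (F ! j) = complex_of_real c \<cdot>\<^sub>v (F ! j))"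
    if F: "F = F\<^sub>0 @ G" and argmin: "is_arg_min (convex_potential d f) (\<lambda>F. F \<in> op_completions d a F\<^sub>0) F"
      and P: "irreducible_partition d F {length F\<^sub>0..<length F} P" and J: "J \<in> P" for F G P J
  proof -
    have op: "F\<^sub>0 @ G \<in> op_completions d a F\<^sub>0" using argmin F by (simp add: is_arg_min_def)
    then have G: "F\<^sub>0 @ G \<in> completions d a F\<^sub>0" by (simp add: op_completions_iff)
    then have cG: "set G \<subseteq> carrier_vec d" and lenG: "length G = ?k"
      and normG: "\<And>i. i < ?k \<Longrightarrow> G ! i \<bullet>c G ! i = complex_of_real (a ! i)" by (auto simp: completions_iff)
    have cF: "set F \<subseteq> carrier_vec d" using cF0 cG F by simp
    note mainF = main[OF ini u S0 G]
    obtain G' where "F\<^sub>0 @ G' \<in> op_completions d a F\<^sub>0" "convex_potential d f (F\<^sub>0 @ G') = (\<Sum>i<d. f (x i + \<mu> i))"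
      using mainF(3) by blast
    then have PJ: "convex_potential d f (F\<^sub>0 @ G) \<le> (\<Sum>i<d. f (x i + \<mu> i))"
      using argmin F by (metis is_arg_min_def not_less)
    then have glob: "is_arg_min (convex_potential d f) (\<lambda>F. F \<in> completions d a F\<^sub>0) (F\<^sub>0 @ G)"
      using mainF(1) by simp
    obtain v x' y' where v: "onb d v" "frame_op d F\<^sub>0 = spectral d v x'" "frame_op d G = spectral d v y'"
      using completion_bounds[OF cF0 u S0 x G f] op by blast
    have eig: "\<exists>c. frame_op d F *\<^sub>v g = complex_of_real c \<cdot>\<^sub>v g" if "g \<in> set G" for g
      unfolding F
      by (rule minimizer_eigenvectors[OF cF0 a G f _ v that]) (use glob in \<open>auto simp: is_arg_min_def not_less\<close>)
    have Jsub: "J \<subseteq> {length F\<^sub>0..<length F}" "J \<noteq> {}"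
      using P J by (auto simp: irreducible_partition_def partition_on_def)
    have inG: "F ! j \<in> set G" if "j \<in> J" for j
      using Jsub that F by (auto simp: nth_append subset_iff)
    have setH: "set (nths F J) = (!) F ` J" using Jsub by (fastforce simp: set_nths)
    have cH: "set (nths F J) \<subseteq> carrier_vec d" using cF set_nths_subset[of F J] by blast
    obtain c where c: "\<And>h. h \<in> set (nths F J) \<Longrightarrow> frame_op d F *\<^sub>v h = complex_of_real c \<cdot>\<^sub>v h"
      using irreducible_common_eigenvalue[OF frame_op_hermitian[OF cF] cH, of] P J eig inG
      unfolding setH irreducible_partition_def by (metis (no_types, lifting) imageE)
    have cpos: "0 < c"
    proof -
      obtain j where j: "j \<in> J" using Jsub by blast
      obtain i where i: "i < ?k" "F ! j = G ! i" using inG[OF j] lenG by (auto simp: in_set_conv_nth)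
      have "F ! j \<noteq> 0\<^sub>v d" using normG[OF i(1)] apos[OF i(1)] i(2) by auto
      moreover have "F ! j \<in> set F" using inG[OF j] F by simp
      ultimately show ?thesis using frame_eigenvalue_pos[OF cF] c setH j by blast
    qed
    have "frame_op d (nths F J) * frame_op d F\<^sub>0 = frame_op d F\<^sub>0 * frame_op d (nths F J)"
    proof (rule commute_of_eigenvectors[OF frame_op_hermitian[OF cF0] cH u])
      fix h assume h: "h \<in> set (nths F J)"
      then have hc: "h \<in> carrier_vec d" using cH by blast
      have "frame_op d F\<^sub>0 *\<^sub>v h + frame_op d (nths F J) *\<^sub>v h = frame_op d F\<^sub>0 *\<^sub>v h + frame_op d G *\<^sub>v h"
        using frame_op_block[OF cF F P J h u] by simp
      also have "\<dots> = frame_op d F *\<^sub>v h"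
        unfolding F frame_op_append[OF cF0 cG]
        by (rule add_mult_distrib_mat_vec[OF frame_op_carrier[OF cF0] frame_op_carrier[OF cG] hc, symmetric])
      finally show "frame_op d F\<^sub>0 *\<^sub>v h + frame_op d (nths F J) *\<^sub>v h = complex_of_real c \<cdot>\<^sub>v h" using c[OF h] by simp
    qed
    then show ?thesis using cpos c setH by blast
  qed
  ultimately show ?thesis by blast
qed

end
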